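(* Let $\psi\in C_+(\mathbb T)$ and $\Sigma\in\operatorname{Range}_+\Gamma$. For every sufficiently small step length (that is, there is $\delta_0>0$ such that for every constant step length $0<\delta t\le\delta_0$) the Predictor-Corrector algorithm described in the context is well defined, with the Newton iteration of each corrector step converging to a solution of the equation to be solved in that step, and after a finite number of predictor-corrector steps it reaches $t=1$ and returns a matrix $C\in\mathscr C_+$ solving $$g(p(1),C)=g(\psi,C)=\int G\,\psi\,(G^*C^*CG)^{-1}G^*=\Sigma .$$
   Context: Let $n\ge m\ge 1$, $A\in\mathbb C^{n\times n}$ with all eigenvalues strictly inside the unit circle, $B\in\mathbb C^{n\times m}$ of full column rank, $(A,B)$ reachable, and $G(z)=(zI-A)^{-1}B$. $\mathbb T$ is the unit circle; on $\mathbb T$, $G^*(z)$ is the conjugate transpose of $G(z)$. All integrals are over $\mathbb T$ with respect to $d\theta/2\pi$, $z=e^{i\theta}$. $\mathfrak H_n$ is the real vector space of $n\times n$ Hermitian matrices and $\mathfrak H_{+,n}$ its subset of positive definite matrices. $C(\mathbb T;\mathfrak H_m)$ is the space of continuous $\mathfrak H_m$-valued functions on $\mathbb T$; $C(\mathbb T)=C(\mathbb T;\mathfrak H_1)$ carries the max-norm and $C_+(\mathbb T)$ is its open subset of positive functions. $\Gamma:C(\mathbb T;\mathfrak H_m)\to\mathfrak H_n$, $\Gamma(\Phi)=\int G\Phi G^*$, and $\operatorname{Range}_+\Gamma=\operatorname{Range}\Gamma\cap\mathfrak H_{+,n}$. $\mathfrak C$ is the real vector space of matrices $C\in\mathbb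 C^{m\times n}$ such that $CB$ is lower triangular with real diagonal entries. $\mathscr C_+\subset\mathfrak C$ is the open subset of those $C$ for which $CB$ is lower triangular with real and positive diagonal entries and $A-B(CB)^{-1}CA$ has all its eigenvalues in the open unit disk. The real dimensions of $\mathfrak C$ and $\operatorname{Range}\Gamma$ coincide. The moment map is $g:C_+(\mathbb T)\times\mathscr C_+\to\operatorname{Range}_+\Gamma$, $g(\psi,C)=\int G\psi(G^*C^*CG)^{-1}G^*$. Its partial derivatives are the linear maps $g_1'(\psi,C;\xi)=\int G\,\xi\,(G^*C^*CG)^{-1}G^*$ for $\xi\in C(\mathbb T)$, and, for $V\in\mathfrak C$, $$g_2'(\psi,C;V)=-\int G\psi(G^*C^*CG)^{-1}G^*(V^*C+C^*V)G(G^*C^*CG)^{-1}G^* .$$ It is known that $g_2'(\psi,C):\mathfrak C\to\operatorname{Range}\Gamma$ is invertible for all $(\psi,C)\in C_+(\mathbb T)\times\mathscr C_+$. Let $p(t)=(1-t)\mathbf 1+t\psi$ for $t\in[0,1]$, where $\mathbf 1$ is the constant function $1$ on $\mathbb T$; so $p'(t)=\psi-\mathbf 1$. Predictor-Corrector algorithm with step length $\delta t>0$: Set $k=0$, $t_0=0$, and $C^{(0)}=L^{-*}B^*\Sigma^{-1}$, where $L$ is the lower triangular matrix with positive diagonal entries such that $B^*\Sigma^{-1}B=L^*L$ and $L^{-*}=(L^{-1})^*$ (it is known that $C^{(0)}\in\mathscr C_+$ and $g(\mathbf 1,C^{(0)})=\Sigma$). While $t_k<1$: (1) put $t_{k+1}=\min\{1,t_k+\delta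 t\}$; (2) predictor (Euler step): $Z^{(k+1)}=C^{(k)}+(t_{k+1}-t_k)\,v_k$ with $v_k=-[g_2'(p(t_k),C^{(k)})]^{-1}g_1'(p(t_k),C^{(k)};\psi-\mathbf 1)$; (3) corrector: solve $g(p(t_{k+1}),C)=\Sigma$ by Newton's method $Y_{j+1}=Y_j-[g_2'(p(t_{k+1}),Y_j)]^{-1}\bigl(g(p(t_{k+1}),Y_j)-\Sigma\bigr)$ started at $Y_0=Z^{(k+1)}$ (all iterates are required to lie in $\mathscr C_+$), and let $C^{(k+1)}\in\mathscr C_+$ be the limit of the iterates; (4) replace $k$ by $k+1$. When $t_k=1$, return $C^{(k)}$. *)

theory Defs
  imports "HOL-Analysis.Analysis"
begin

text \<open>A matrix in $C^{m \times n}$ is an element of \<open>complex^'n^'m\<close> (columns first). Triangular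
  shape refers to the order of the index type, hence the sort \<open>{finite,wellorder}\<close> for it
  (every linear order on a finite type is a well-order).\<close>

definition adj :: "complex^'n^'m \<Rightarrow> complex^'m^'n" where
  "adj M = (\<chi> i j. cnj (M $ j $ i))"

definition hermitian :: "complex^'n^'n \<Rightarrow> bool" where
  "hermitian M \<longleftrightarrow> adj M = M"

definition pos_def :: "complex^'n^'n \<Rightarrow> bool" where
  "pos_def M \<longleftrightarrow> hermitian M \<and>
     (\<forall>x. x \<noteq> 0 \<longrightarrow> 0 < Re (\<Sum>i\<in>UNIV. cnj (x $ i) * (M *v x) $ i))"

definition lower_triangular :: "complex^'m::{finite,wellorder}^'m::_ \<Rightarrow> bool" where
  "lower_triangular M \<longleftrightarrow> (\<forall>i j. i < j \<longrightarrow> M $ i $ j = 0)"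

definition real_diag :: "complex^'m^'m \<Rightarrow> bool" where
  "real_diag M \<longleftrightarrow> (\<forall>i. M $ i $ i \<in> \<real>)"

definition pos_diag :: "complex^'m^'m \<Rightarrow> bool" where
  "pos_diag M \<longleftrightarrow> (\<forall>i. M $ i $ i \<in> \<real> \<and> 0 < Re (M $ i $ i))"

definition is_eigenvalue :: "complex^'n^'n \<Rightarrow> complex \<Rightarrow> bool" where
  "is_eigenvalue M \<mu> \<longleftrightarrow> (\<exists>v. v \<noteq> 0 \<and> M *v v = \<mu> *s v)"

definition schur_stable :: "complex^'n^'n \<Rightarrow> bool" where
  "schur_stable M \<longleftrightarrow> (\<forall>\<mu>. is_eigenvalue M \<mu> \<longrightarrow> cmod \<mu> < 1)"

text \<open>The columns of $B, AB, \dots, A^{n-1}B$ span the complex vector space $C^n$. (The product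
  \<open>*\<close> on the type \<open>complex^'n^'n\<close> is entrywise, so \<open>A ^ k\<close> would not be the matrix power.)\<close>

definition reachable :: "complex^'n^'n \<Rightarrow> complex^'m^'n \<Rightarrow> bool" where
  "reachable A B \<longleftrightarrow>
     vec.span (\<Union>k<CARD('n). columns ((((**) A) ^^ k) B)) = UNIV"

text \<open>Functions on the unit circle are represented by functions on \<open>complex\<close>; only their
  values on \<open>sphere 0 1\<close> are ever used.\<close>

definition circ_mean :: "(complex \<Rightarrow> 'a::banach) \<Rightarrow> 'a" where
  "circ_mean F = (1 / (2 * pi)) *\<^sub>R integral {0..2 * pi} (\<lambda>\<theta>. F (cis \<theta>))"

definition C_herm :: "(complex \<Rightarrow> complex^'m^'m) set" where
  "C_herm = {\<Phi>. continuous_on (sphere 0 1) \<Phi> \<and> (\<forall>z\<in>sphere 0 1. hermitian (\<Phi> z))}"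

definition C_pos :: "(complex \<Rightarrow> real) set" where
  "C_pos = {\<psi>. continuous_on (sphere 0 1) \<psi> \<and> (\<forall>z\<in>sphere 0 1. 0 < \<psi> z)}"

definition Gfun :: "complex^'n^'n \<Rightarrow> complex^'m^'n \<Rightarrow> complex \<Rightarrow> complex^'m^'n" where
  "Gfun A B z = matrix_inv (mat z - A) ** B"

definition Gamma_map ::
  "complex^'n^'n \<Rightarrow> complex^'m^'n \<Rightarrow> (complex \<Rightarrow> complex^'m^'m) \<Rightarrow> complex^'n^'n" where
  "Gamma_map A B \<Phi> = circ_mean (\<lambda>z. Gfun A B z ** \<Phi> z ** adj (Gfun A B z))"

definition range_Gamma :: "complex^'n^'n \<Rightarrow> complex^'m^'n \<Rightarrow> (complex^'n^'n) set" where
  "range_Gamma A B = Gamma_map A B ` C_herm"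

definition range_Gamma_pos :: "complex^'n^'n \<Rightarrow> complex^'m^'n \<Rightarrow> (complex^'n^'n) set" where
  "range_Gamma_pos A B = range_Gamma A B \<inter> {S. pos_def S}"

definition C_space :: "complex^'m::{finite,wellorder}^'n \<Rightarrow> (complex^'n^'m::_) set" where
  "C_space B = {C. lower_triangular (C ** B) \<and> real_diag (C ** B)}"

definition C_plus ::
  "complex^'n^'n \<Rightarrow> complex^'m::{finite,wellorder}^'n \<Rightarrow> (complex^'n^'m::_) set" where
  "C_plus A B = {C. lower_triangular (C ** B) \<and> pos_diag (C ** B) \<and>
     schur_stable (A - B ** matrix_inv (C ** B) ** C ** A)}"

definition Winv ::
  "complex^'n^'n \<Rightarrow> complex^'m^'n \<Rightarrow> complex^'n^'m \<Rightarrow> complex \<Rightarrow> complex^'m^'m" where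
  "Winv A B C z = matrix_inv (adj (Gfun A B z) ** adj C ** C ** Gfun A B z)"

definition moment ::
  "complex^'n^'n \<Rightarrow> complex^'m^'n \<Rightarrow> (complex \<Rightarrow> real) \<Rightarrow> complex^'n^'m \<Rightarrow> complex^'n^'n" where
  "moment A B \<psi> C =
     circ_mean (\<lambda>z. \<psi> z *\<^sub>R (Gfun A B z ** Winv A B C z ** adj (Gfun A B z)))"

definition moment_d1 ::
  "complex^'n^'n \<Rightarrow> complex^'m^'n \<Rightarrow> (complex \<Rightarrow> real) \<Rightarrow> complex^'n^'m \<Rightarrow>
     (complex \<Rightarrow> real) \<Rightarrow> complex^'n^'n" where
  "moment_d1 A B \<psi> C \<xi> =
     circ_mean (\<lambda>z. \<xi> z *\<^sub>R (Gfun A B z ** Winv A B C z ** adj (Gfun A B z)))"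

definition moment_d2 ::
  "complex^'n^'n \<Rightarrow> complex^'m^'n \<Rightarrow> (complex \<Rightarrow> real) \<Rightarrow> complex^'n^'m \<Rightarrow>
     complex^'n^'m \<Rightarrow> complex^'n^'n" where
  "moment_d2 A B \<psi> C V =
     - circ_mean (\<lambda>z. \<psi> z *\<^sub>R
         (Gfun A B z ** Winv A B C z ** adj (Gfun A B z) **
          (adj V ** C + adj C ** V) **
          Gfun A B z ** Winv A B C z ** adj (Gfun A B z)))"

text \<open>The inverse of \<open>moment_d2 A B \<psi> C\<close> as a map from \<open>C_space B\<close> to \<open>range_Gamma A B\<close>; it is
  meaningful only under \<open>d2_invertible\<close> and on \<open>range_Gamma A B\<close>.\<close>

definition d2_invertible ::
  "complex^'n^'n \<Rightarrow> complex^'m::{finite,wellorder}^'n \<Rightarrow> (complex \<Rightarrow> real) \<Rightarrow>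
     complex^'n^'m::_ \<Rightarrow> bool" where
  "d2_invertible A B \<psi> C \<longleftrightarrow> bij_betw (moment_d2 A B \<psi> C) (C_space B) (range_Gamma A B)"

definition d2_inv ::
  "complex^'n^'n \<Rightarrow> complex^'m::{finite,wellorder}^'n \<Rightarrow> (complex \<Rightarrow> real) \<Rightarrow>
     complex^'n^'m::_ \<Rightarrow> complex^'n^'n \<Rightarrow> complex^'n^'m::_" where
  "d2_inv A B \<psi> C = inv_into (C_space B) (moment_d2 A B \<psi> C)"

definition psi_path :: "(complex \<Rightarrow> real) \<Rightarrow> real \<Rightarrow> complex \<Rightarrow> real" where
  "psi_path \<psi> t = (\<lambda>z. (1 - t) * 1 + t * \<psi> z)"

definition is_LL_factor ::
  "complex^'m::{finite,wellorder}^'m::_ \<Rightarrow> complex^'m::_^'m::_ \<Rightarrow> bool" where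
  "is_LL_factor M L \<longleftrightarrow> lower_triangular L \<and> pos_diag L \<and> M = adj L ** L"

definition C_init ::
  "complex^'m::{finite,wellorder}^'n \<Rightarrow> complex^'n^'n \<Rightarrow> complex^'n^'m::_" where
  "C_init B \<Sigma> =
     (let L = (THE L. is_LL_factor (adj B ** matrix_inv \<Sigma> ** B) L)
      in adj (matrix_inv L) ** adj B ** matrix_inv \<Sigma>)"

definition next_t :: "real \<Rightarrow> real \<Rightarrow> real" where
  "next_t \<delta> t = min 1 (t + \<delta>)"

definition predictor ::
  "complex^'n^'n \<Rightarrow> complex^'m::{finite,wellorder}^'n \<Rightarrow> (complex \<Rightarrow> real) \<Rightarrow> real \<Rightarrow>
     real \<times> (complex^'n^'m::_) \<Rightarrow> complex^'n^'m::_" where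
  "predictor A B \<psi> \<delta> = (\<lambda>(t, C).
     C + (next_t \<delta> t - t) *\<^sub>R
       (- d2_inv A B (psi_path \<psi> t) C (moment_d1 A B (psi_path \<psi> t) C (\<lambda>z. \<psi> z - 1))))"

primrec newton ::
  "complex^'n^'n \<Rightarrow> complex^'m::{finite,wellorder}^'n \<Rightarrow> (complex \<Rightarrow> real) \<Rightarrow>
     complex^'n^'n \<Rightarrow> complex^'n^'m::_ \<Rightarrow> nat \<Rightarrow> complex^'n^'m::_" where
  "newton A B \<phi> \<Sigma> Z 0 = Z"
| "newton A B \<phi> \<Sigma> Z (Suc j) =
     (let Y = newton A B \<phi> \<Sigma> Z j in Y - d2_inv A B \<phi> Y (moment A B \<phi> Y - \<Sigma>))"

abbreviation corrector_iter ::
  "complex^'n^'n \<Rightarrow> complex^'m::{finite,wellorder}^'n \<Rightarrow> (complex \<Rightarrow> real) \<Rightarrow>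
     complex^'n^'n \<Rightarrow> real \<Rightarrow> real \<times> (complex^'n^'m::_) \<Rightarrow> nat \<Rightarrow> complex^'n^'m::_" where
  "corrector_iter A B \<psi> \<Sigma> \<delta> s \<equiv>
     newton A B (psi_path \<psi> (next_t \<delta> (fst s))) \<Sigma> (predictor A B \<psi> \<delta> s)"

definition pc_step ::
  "complex^'n^'n \<Rightarrow> complex^'m::{finite,wellorder}^'n \<Rightarrow> (complex \<Rightarrow> real) \<Rightarrow>
     complex^'n^'n \<Rightarrow> real \<Rightarrow> real \<times> (complex^'n^'m::_) \<Rightarrow> real \<times> (complex^'n^'m::_)" where
  "pc_step A B \<psi> \<Sigma> \<delta> s = (next_t \<delta> (fst s), lim (corrector_iter A B \<psi> \<Sigma> \<delta> s))"

text \<open>The state $(t_k, C^{(k)})$ after \<open>k\<close> passes through the loop body.\<close>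

definition pc_state ::
  "complex^'n^'n \<Rightarrow> complex^'m::{finite,wellorder}^'n \<Rightarrow> (complex \<Rightarrow> real) \<Rightarrow>
     complex^'n^'n \<Rightarrow> real \<Rightarrow> nat \<Rightarrow> real \<times> (complex^'n^'m::_)" where
  "pc_state A B \<psi> \<Sigma> \<delta> k = (pc_step A B \<psi> \<Sigma> \<delta> ^^ k) (0, C_init B \<Sigma>)"

text \<open>Since \<open>d2_inv\<close>, \<open>lim\<close> and \<open>THE\<close> are total, well-definedness is stated separately: every
  inverse is applied to an element of the range of a bijection, every iterate is in
  \<open>C_plus A B\<close>, and every limit exists.\<close>

definition init_well_defined ::
  "complex^'n^'n \<Rightarrow> complex^'m::{finite,wellorder}^'n \<Rightarrow> complex^'n^'n \<Rightarrow> bool" where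
  "init_well_defined A B \<Sigma> \<longleftrightarrow>
     (\<exists>!L. is_LL_factor (adj B ** matrix_inv \<Sigma> ** B) L) \<and> C_init B \<Sigma> \<in> C_plus A B"

definition predictor_well_defined ::
  "complex^'n^'n \<Rightarrow> complex^'m::{finite,wellorder}^'n \<Rightarrow> (complex \<Rightarrow> real) \<Rightarrow>
     real \<times> (complex^'n^'m::_) \<Rightarrow> bool" where
  "predictor_well_defined A B \<psi> = (\<lambda>(t, C).
     C \<in> C_plus A B \<and> d2_invertible A B (psi_path \<psi> t) C \<and>
     moment_d1 A B (psi_path \<psi> t) C (\<lambda>z. \<psi> z - 1) \<in> range_Gamma A B)"

definition corrector_well_defined ::
  "complex^'n^'n \<Rightarrow> complex^'m::{finite,wellorder}^'n \<Rightarrow> (complex \<Rightarrow> real) \<Rightarrow>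
     complex^'n^'n \<Rightarrow> real \<Rightarrow> real \<times> (complex^'n^'m::_) \<Rightarrow> bool" where
  "corrector_well_defined A B \<psi> \<Sigma> \<delta> s \<longleftrightarrow>
     (let \<phi> = psi_path \<psi> (next_t \<delta> (fst s)); Y = corrector_iter A B \<psi> \<Sigma> \<delta> s in
       (\<forall>j. Y j \<in> C_plus A B \<and> d2_invertible A B \<phi> (Y j) \<and>
            moment A B \<phi> (Y j) - \<Sigma> \<in> range_Gamma A B) \<and>
       convergent Y \<and> lim Y \<in> C_plus A B)"

end

theory Submission
  imports Defs "HOL-Complex_Analysis.Cauchy_Integral_Formula"
begin

text \<open>For a parameter \<open>C\<close> put \<open>D = B (CB)\<^sup>-\<^sup>1\<close>, \<open>K = A - DCA\<close> and \<open>H(z) = (I - K/z)\<^sup>-\<^sup>1 D\<close>. On the unit circle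
  \<open>H = G (CG)\<^sup>-\<^sup>1\<close>, hence \<open>C H = I\<close> and \<open>G (G* C* C G)\<^sup>-\<^sup>1 G* = H H*\<close>: the moment map is the mean of
  \<open>\<psi> H H*\<close>. As \<open>K\<close> is stable, \<open>H\<close> is analytic in \<open>1/z\<close> on the closed disc. By the mean value
  property \<open>(I - K/z)\<^sup>-\<^sup>1\<close> has mean \<open>I\<close>, and this represents solutions of Lyapunov equations as circle means (\<open>lyapunov_reconstruct\<close>,
  \<open>lyapunov_solution\<close>).

The algorithm converges for four reasons.

\<^item> The start is right: \<open>\<Sigma>\<close> itself solves the Lyapunov equation of the initial parameter. That equation
  with a positive definite solution forces stability (\<open>schur_stable_of_lyapunov\<close>), and its solution is
  the moment of the constant weight (\<open>moment_C_init\<close>).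

\<^item> The derivative in \<open>C\<close> is invertible (\<open>moment_d2_invertible\<close>). It is a Gram operator: paired with
  a Hermitian \<open>\<Lambda>\<close> that has the same sandwich \<open>H* \<Lambda> H\<close> as \<open>V* C + C* V\<close>, it gives minus the mean of
  \<open>\<psi> |H* \<Lambda> H|\<^sup>2\<close>. For injectivity take \<open>\<Lambda> = V* C + C* V\<close>: then \<open>V H\<close> is skew-Hermitian on the circle and
  analytic, so it is constant, and triangularity makes the constant zero. For surjectivity, every
  Hermitian sandwich arises from some \<open>V\<close> (\<open>hermitian_sandwich_factor\<close>), so that nothing in the range
  is orthogonal to the image.

\<^item> The set of all solutions \<open>(t, C)\<close> with \<open>0 \<le> t \<le> 1\<close> is compact (\<open>compact_solutions\<close>). The identity
  \<open>C H = I\<close> turns the equation into \<open>C \<Sigma> = mean of p(t) H*\<close>, which bounds \<open>C\<close>; the solutions stay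
  away from the boundary of the parameter set because the Lyapunov equation survives in the limit.

\<^item> On a compact neighbourhood of the solutions the linearisation error of the moment map is
  quadratic (\<open>moment_remainder\<close>) and the inverse derivative is bounded. Newton's method therefore converges
  from every point of a ball whose radius does not depend on the solution (\<open>newton_convergence\<close>).

A single step length then serves for all solutions at once (\<open>uniform_step_length\<close>): the predictor
  lands in that ball and the corrector returns to the solution set, at the next time, so membership in
  that set is an invariant of the algorithm.\<close>

section \<open>Complex matrices\<close>

lemma adj_adj [simp]: "adj (adj M) = M"
  by (simp add: adj_def vec_eq_iff)

lemma adj_mult: "adj (M ** N) = adj N ** adj M"
  by (simp add: adj_def matrix_matrix_mult_def vec_eq_iff mult.commute)

lemma adj_add: "adj (M + N) = adj M + adj N"
  and adj_diff: "adj (M - N) = adj M - adj N"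
  and adj_scaleR: "adj (r *\<^sub>R M) = r *\<^sub>R adj M"
  and adj_zero [simp]: "adj 0 = 0"
  by (simp_all add: adj_def vec_eq_iff)

lemma adj_mat: "adj (mat c) = mat (cnj c)"
  by (auto simp: adj_def mat_def vec_eq_iff)

lemma adj_one [simp]: "adj (mat 1) = mat 1"
  by (simp add: adj_mat)

lemma inner_matrix: "inner M N = Re (\<Sum>i\<in>UNIV. \<Sum>j\<in>UNIV. cnj (M $ i $ j) * N $ i $ j)"
  for M N :: "complex^'n^'m"
  by (simp add: inner_vec_def inner_complex_def)

lemma inner_mult_left: "inner M (X ** N) = inner (adj X ** M) N"
  for M :: "complex^'n^'m" and X :: "complex^'k^'m"
proof -
  have "(\<Sum>i\<in>UNIV. \<Sum>j\<in>UNIV. cnj (M$i$j) * (X ** N)$i$j)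
      = (\<Sum>i\<in>UNIV. \<Sum>j\<in>UNIV. \<Sum>k\<in>UNIV. cnj (M$i$j) * X$i$k * N$k$j)"
    by (simp add: matrix_matrix_mult_def sum_distrib_left mult.assoc)
  also have "\<dots> = (\<Sum>i\<in>UNIV. \<Sum>k\<in>UNIV. \<Sum>j\<in>UNIV. cnj (M$i$j) * X$i$k * N$k$j)"
    by (intro sum.cong refl) (rule sum.swap)
  also have "\<dots> = (\<Sum>k\<in>UNIV. \<Sum>i\<in>UNIV. \<Sum>j\<in>UNIV. cnj (M$i$j) * X$i$k * N$k$j)"
    by (rule sum.swap)
  also have "\<dots> = (\<Sum>k\<in>UNIV. \<Sum>j\<in>UNIV. \<Sum>i\<in>UNIV. cnj (M$i$j) * X$i$k * N$k$j)"
    by (intro sum.cong refl) (rule sum.swap)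
  also have "\<dots> = (\<Sum>k\<in>UNIV. \<Sum>j\<in>UNIV. cnj ((adj X ** M)$k$j) * N$k$j)"
    by (simp add: matrix_matrix_mult_def adj_def sum_distrib_right sum_distrib_left mult.commute mult.left_commute)
  finally show ?thesis unfolding inner_matrix by (rule arg_cong)
qed

lemma inner_adj: "inner (adj M) (adj N) = inner M N"
proof -
  have "(\<Sum>i\<in>UNIV. \<Sum>j\<in>UNIV. cnj (adj M$i$j) * adj N$i$j)
      = cnj (\<Sum>i\<in>UNIV. \<Sum>j\<in>UNIV. cnj (M$j$i) * N$j$i)"
    by (simp add: adj_def)
  also have "\<dots> = cnj (\<Sum>i\<in>UNIV. \<Sum>j\<in>UNIV. cnj (M$i$j) * N$i$j)"
    by (rule arg_cong[OF sum.swap])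
  finally show ?thesis unfolding inner_matrix by (simp only: cnj.simps)
qed

lemma norm_adj [simp]: "norm (adj M) = norm M"
  by (simp add: norm_eq_sqrt_inner inner_adj)

lemma inner_mult_right: "inner M (N ** X) = inner (M ** adj X) N"
proof -
  have "inner M (N ** X) = inner (adj M) (adj X ** adj N)"
    by (simp add: inner_adj flip: adj_mult)
  also have "\<dots> = inner (adj (M ** adj X)) (adj N)"
    by (simp add: inner_mult_left adj_mult)
  finally show ?thesis by (simp add: inner_adj)
qed

lemma inner_sandwich: "inner \<Lambda> (X ** Q ** adj X) = inner (adj X ** \<Lambda> ** X) Q"
  by (metis adj_adj inner_mult_left inner_mult_right matrix_mul_assoc)

lemma norm_matrix_mult_le: "norm (M ** N) \<le> norm M * norm N"
  for M :: "complex^'k^'m" and N :: "complex^'n^'k"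
proof -
  have row: "norm ((M ** N) $ i) \<le> norm (M $ i) * norm N" for i
  proof -
    have "(M ** N) $ i = (\<Sum>k\<in>UNIV. M$i$k *s N$k)"
      by (simp add: matrix_matrix_mult_def vec_eq_iff)
    also have "norm \<dots> \<le> (\<Sum>k\<in>UNIV. norm (M$i$k *s N$k))"
      by (rule norm_sum)
    finally have "norm ((M ** N) $ i) \<le> (\<Sum>k\<in>UNIV. norm (M$i$k *s N$k))" .
    moreover have "norm (c *s v) = \<bar>norm c\<bar> * \<bar>norm v\<bar>" for c :: complex and v :: "complex^'n"
      by (simp add: norm_vec_def norm_mult L2_set_right_distrib)
    ultimately have "norm ((M ** N) $ i) \<le> (\<Sum>k\<in>UNIV. \<bar>norm (M$i$k)\<bar> * \<bar>norm (N$k)\<bar>)"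
      by simp
    moreover have "(\<Sum>k\<in>UNIV. \<bar>norm (M$i$k)\<bar> * \<bar>norm (N$k)\<bar>) \<le> norm (M $ i) * norm N"
      unfolding norm_vec_def[of "M $ i"] norm_vec_def[of N] by (rule L2_set_mult_ineq)
    ultimately show ?thesis by linarith
  qed
  have "norm (M ** N) \<le> L2_set (\<lambda>i. norm (M $ i) * norm N) UNIV"
    unfolding norm_vec_def[of "M ** N"] by (rule L2_set_mono) (use row in auto)
  also have "\<dots> = norm M * norm N"
    by (simp add: L2_set_left_distrib norm_vec_def[of M])
  finally show ?thesis .
qed

lemma norm_mult3_le: "norm (X ** Y ** Z) \<le> norm X * norm Y * norm Z"
  for X :: "complex^'b^'a" and Y :: "complex^'c^'b" and Z :: "complex^'d^'c"
  by (meson norm_matrix_mult_le order_trans mult_right_mono norm_ge_zero)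

lemma bounded_bilinear_matrix_mult:
  "bounded_bilinear ((**) :: complex^'k^'m \<Rightarrow> complex^'n^'k \<Rightarrow> complex^'n^'m)"
proof
  show "\<exists>K. \<forall>(a::complex^'k^'m) b::complex^'n^'k. norm (a ** b) \<le> norm a * norm b * K"
    by (rule exI[of _ 1]) (simp add: norm_matrix_mult_le)
qed (simp_all add: matrix_add_ldistrib matrix_matrix_mult_def vec_eq_iff ring_distribs sum.distrib
     scaleR_sum_right)

interpretation matrix_mult: bounded_bilinear
  "(**) :: complex^'k^'m \<Rightarrow> complex^'n^'k \<Rightarrow> complex^'n^'m"
  by (rule bounded_bilinear_matrix_mult)

lemmas matrix_ring = matrix_mult.add_left matrix_mult.add_right matrix_mult.diff_left
  matrix_mult.diff_right matrix_mult.minus_left matrix_mult.minus_right matrix_mult.scaleR_left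
  matrix_mult.scaleR_right matrix_mul_assoc

lemma bounded_linear_adj: "bounded_linear (adj :: complex^'n^'m \<Rightarrow> _)"
  by standard (auto simp: adj_add adj_scaleR intro!: exI[of _ 1])

lemmas continuous_on_matrix_mult [continuous_intros] = matrix_mult.continuous_on
lemmas continuous_on_adj [continuous_intros] = bounded_linear.continuous_on[OF bounded_linear_adj]

lemma continuous_on_mat [continuous_intros]:
  "continuous_on S f \<Longrightarrow> continuous_on S (\<lambda>x. mat (f x) :: complex^'n^'n)"
  unfolding mat_def
proof (intro continuous_on_vec_lambda)
  show "continuous_on S (\<lambda>x. if i = j then f x else 0)" if "continuous_on S f" for i j :: 'n
    using that by (cases "i = j") auto
qed

lemma scaleR_matrix_vector: "(r *\<^sub>R M) *v w = r *\<^sub>R (M *v w)"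
  for M :: "complex^'n^'m"
  by (simp add: vec_eq_iff matrix_vector_mult_def scaleR_sum_right)

lemma continuous_on_matrix_vector [continuous_intros]:
  fixes f :: "'a::topological_space \<Rightarrow> complex^'n^'m"
  assumes "continuous_on S f"
  shows "continuous_on S (\<lambda>x. f x *v w)"
proof -
  have "bounded_linear (\<lambda>M :: complex^'n^'m. M *v w)"
    by (rule linear_conv_bounded_linear[THEN iffD1])
       (auto intro!: linearI simp: matrix_vector_mult_add_rdistrib scaleR_matrix_vector)
  then show ?thesis using assms by (rule bounded_linear.continuous_on)
qed

lemma mat_mult_nth: "(mat w ** M) $ i $ j = w * M $ i $ j"
  and mult_mat_nth: "(M ** mat w) $ i $ j = M $ i $ j * w"
  for w :: complex
  by (simp_all add: matrix_matrix_mult_def mat_def if_distrib if_distribR cong: if_cong)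

lemma mat_mult_commute: "mat w ** M = M ** mat w"
  for w :: complex
  by (simp add: vec_eq_iff mat_mult_nth mult_mat_nth mult.commute)

lemma mult_mat_left_commute: "M ** (mat w ** N) = mat w ** (M ** N)" for w :: complex
  by (metis mat_mult_commute matrix_mul_assoc)

lemma mat_mult_mat: "mat w ** mat v = mat (w * v)"
  for w v :: complex
  by (simp add: vec_eq_iff mat_mult_nth) (simp add: mat_def)

lemma mat_vec: "mat w *v x = w *s x"
  for w :: complex
  by (simp add: matrix_vector_mult_def mat_def vec_eq_iff if_distrib if_distribR cong: if_cong)

lemma invertible_iff_ker: "invertible M \<longleftrightarrow> (\<forall>x. M *v x = 0 \<longrightarrow> x = 0)"
  for M :: "complex^'n^'n"
  by (simp add: invertible_left_inverse matrix_left_invertible_ker)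

lemma matrix_inv_mult:
  assumes "invertible M"
  shows "M ** matrix_inv M = mat 1" "matrix_inv M ** M = mat 1"
  using someI_ex[OF assms[unfolded invertible_def]] by (auto simp: matrix_inv_def)

lemma matrix_inv_eqI:
  fixes M N :: "complex^'n^'n"
  assumes "M ** N = mat 1"
  shows "matrix_inv M = N" "invertible M"
proof -
  show *: "invertible M"
    using assms matrix_left_right_inverse unfolding invertible_def by blast
  show "matrix_inv M = N"
    by (metis "*" assms matrix_inv_mult(2) matrix_mul_assoc matrix_mul_lid matrix_mul_rid)
qed

lemma invertible_adj: "invertible M \<Longrightarrow> invertible (adj M)"
  and matrix_inv_adj: "invertible M \<Longrightarrow> matrix_inv (adj M) = adj (matrix_inv M)"
  for M :: "complex^'n^'n"
proof -
  assume "invertible M"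
  then have "adj M ** adj (matrix_inv M) = mat 1"
    by (metis adj_mult adj_one matrix_inv_mult(2))
  from matrix_inv_eqI[OF this] show "invertible (adj M)" "matrix_inv (adj M) = adj (matrix_inv M)"
    by auto
qed

lemma matrix_inv_matrix_mult:
  fixes M N :: "complex^'n^'n"
  assumes "invertible M" "invertible N"
  shows "matrix_inv (M ** N) = matrix_inv N ** matrix_inv M"
proof (rule matrix_inv_eqI)
  have "M ** N ** (matrix_inv N ** matrix_inv M) = M ** (N ** matrix_inv N) ** matrix_inv M"
    by (simp add: matrix_mul_assoc)
  then show "M ** N ** (matrix_inv N ** matrix_inv M) = mat 1"
    using assms by (simp add: matrix_inv_mult)
qed

text \<open>Expanding the inverse twice by the resolvent identity \<open>W' = W - W (N' - N) W'\<close> gives the exact error of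
  its linearisation. Here \<open>\<delta>1\<close> is the linear part of the increment \<open>N' - N\<close> and \<open>\<delta>2\<close> its quadratic part;
  both terms of the error are then of second order.\<close>

lemma inverse_remainder:
  fixes W W' N N' \<delta>1 \<delta>2 :: "complex^'k^'k"
  assumes "W ** N = mat 1" "N' ** W' = mat 1" "N ** W = mat 1" "N' - N = \<delta>1 + \<delta>2"
  shows "W' - W + W ** \<delta>1 ** W = W ** (N' - N) ** W ** (N' - N) ** W' - W ** \<delta>2 ** W"
proof -
  let ?\<delta> = "N' - N"
  have "W ** ?\<delta> ** W' = W ** (N' ** W') - (W ** N) ** W'"
    by (simp add: matrix_ring)
  then have W': "W' = W - W ** ?\<delta> ** W'"
    using assms by simp
  have "W' - W = - (W ** ?\<delta> ** W')" by (subst W') simp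
  also have "\<dots> = - (W ** ?\<delta> ** (W - W ** ?\<delta> ** W'))" by (subst W') (rule refl)
  also have "\<dots> = W ** ?\<delta> ** W ** ?\<delta> ** W' - W ** ?\<delta> ** W"
    by (simp add: matrix_mult.diff_right matrix_mul_assoc)
  finally have 1: "W' - W = W ** ?\<delta> ** W ** ?\<delta> ** W' - W ** ?\<delta> ** W" .
  have 2: "W ** ?\<delta> ** W = W ** \<delta>1 ** W + W ** \<delta>2 ** W"
    by (simp add: assms(4) matrix_mult.add_right matrix_mult.add_left)
  have "p = x - y \<Longrightarrow> y = a + b \<Longrightarrow> p + a = x - b" for p x y a b :: "complex^'k^'k"
    by simp
  from this[OF 1 2] show ?thesis .
qed

text \<open>Cramer's rule makes the entries of the inverse rational in the entries of the matrix; continuity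
  and holomorphy of the inverse follow.\<close>

lemma matrix_inv_cramer:
  fixes M :: "complex^'n^'n"
  assumes "invertible M"
  shows "matrix_inv M $ k $ l = det (\<chi> i j. if j = k then axis l 1 $ i else M $ i $ j) / det M"
proof -
  have "M *v column l (matrix_inv M) = axis l 1"
    using matrix_inv_mult(1)[OF assms]
    by (auto simp: vec_eq_iff matrix_vector_mult_def matrix_matrix_mult_def column_def mat_def axis_def)
  then have "column l (matrix_inv M) =
      (\<chi> k. det (\<chi> i j. if j = k then axis l 1 $ i else M $ i $ j) / det M)"
    using assms by (subst (asm) cramer) (simp_all add: invertible_det_nz)
  then show ?thesis
    by (simp add: vec_eq_iff column_def)
qed

lemma continuous_on_det:
  fixes f :: "'a::topological_space \<Rightarrow> complex^'n^'n"
  assumes "\<And>i j. continuous_on S (\<lambda>x. f x $ i $ j)"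
  shows "continuous_on S (\<lambda>x. det (f x))"
  unfolding det_def by (intro continuous_intros assms)

lemma continuous_on_matrix_inv [continuous_intros]:
  fixes f :: "'a::topological_space \<Rightarrow> complex^'n^'n"
  assumes f: "continuous_on S f" and inv: "\<And>x. x \<in> S \<Longrightarrow> invertible (f x)"
  shows "continuous_on S (\<lambda>x. matrix_inv (f x))"
proof -
  have c: "continuous_on S (\<lambda>x. f x $ i $ j)" for i j
    using f by (intro continuous_intros)
  have "continuous_on S (\<lambda>x. matrix_inv (f x) $ k $ l)" for k l
  proof -
    have "continuous_on S (\<lambda>x. (\<chi> i j. if j = k then axis l 1 $ i else f x $ i $ j) $ i $ j)"
      for i j using c by (cases "j = k") auto
    then have "continuous_on S
        (\<lambda>x. det (\<chi> i j. if j = k then axis l 1 $ i else f x $ i $ j) / det (f x))"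
      by (intro continuous_on_divide continuous_on_det c) (use inv in \<open>simp_all add: invertible_det_nz\<close>)
    then show ?thesis
      by (rule continuous_on_eq) (simp add: matrix_inv_cramer inv)
  qed
  then have "continuous_on S (\<lambda>x. \<chi> k l. matrix_inv (f x) $ k $ l)"
    by (intro continuous_on_vec_lambda)
  then show ?thesis by simp
qed

lemma holomorphic_on_det:
  fixes f :: "complex \<Rightarrow> complex^'n^'n"
  assumes "\<And>i j. (\<lambda>x. f x $ i $ j) holomorphic_on S"
  shows "(\<lambda>x. det (f x)) holomorphic_on S"
  unfolding det_def by (intro holomorphic_intros assms)

lemma holomorphic_on_matrix_inv:
  fixes f :: "complex \<Rightarrow> complex^'n^'n"
  assumes hol: "\<And>i j. (\<lambda>x. f x $ i $ j) holomorphic_on S"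
    and inv: "\<And>x. x \<in> S \<Longrightarrow> invertible (f x)"
  shows "(\<lambda>x. matrix_inv (f x) $ k $ l) holomorphic_on S"
proof -
  have "(\<lambda>x. (\<chi> i j. if j = k then axis l 1 $ i else f x $ i $ j) $ i $ j) holomorphic_on S"
    for i j using hol by (cases "j = k") auto
  then have "(\<lambda>x. det (\<chi> i j. if j = k then axis l 1 $ i else f x $ i $ j) / det (f x)) holomorphic_on S"
    by (intro holomorphic_on_divide holomorphic_on_det hol) (use inv in \<open>simp_all add: invertible_det_nz\<close>)
  then show ?thesis
    by (rule holomorphic_transform) (simp add: matrix_inv_cramer inv)
qed

section \<open>Means over the unit circle\<close>

lemma continuous_on_circle_param:
  "continuous_on (sphere 0 1) F \<Longrightarrow> continuous_on S (\<lambda>\<theta>. F (cis \<theta>))"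
  by (rule continuous_on_compose2[of "sphere 0 1" F]) (auto intro!: continuous_intros)

lemma circle_param_integrable:
  fixes F :: "complex \<Rightarrow> 'a::banach"
  shows "continuous_on (sphere 0 1) F \<Longrightarrow> (\<lambda>\<theta>. F (cis \<theta>)) integrable_on {0..2 * pi}"
  by (intro integrable_continuous_real) (rule continuous_on_circle_param)

lemma unit_mult_cnj: "z \<in> sphere 0 1 \<Longrightarrow> z * cnj z = 1"
  by (simp add: complex_norm_square[symmetric])

lemma sphere_cis_obtain:
  assumes "z \<in> sphere 0 1"
  obtains \<theta> where "0 \<le> \<theta>" "\<theta> \<le> 2 * pi" "z = cis \<theta>"
proof
  have "z = cis (Arg2pi z)"
    using Arg2pi_eq[of z] assms by (simp add: cis_conv_exp)
  then show "z = cis (Arg2pi z)" .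
qed (use Arg2pi_ge_0 Arg2pi_lt_2pi in \<open>auto intro: less_imp_le\<close>)

lemma circ_mean_add:
  assumes "continuous_on (sphere 0 1) F" "continuous_on (sphere 0 1) G"
  shows "circ_mean (\<lambda>z. F z + G z) = circ_mean F + circ_mean G"
  using assms by (simp add: circ_mean_def integral_add circle_param_integrable scaleR_add_right)

lemma circ_mean_diff:
  assumes "continuous_on (sphere 0 1) F" "continuous_on (sphere 0 1) G"
  shows "circ_mean (\<lambda>z. F z - G z) = circ_mean F - circ_mean G"
  using assms by (simp add: circ_mean_def integral_diff circle_param_integrable scaleR_diff_right)

lemma circ_mean_linear:
  assumes "bounded_linear h" "continuous_on (sphere 0 1) F"
  shows "circ_mean (\<lambda>z. h (F z)) = h (circ_mean F)"
  using integral_linear[OF circle_param_integrable[OF assms(2)] assms(1)]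
  by (simp add: circ_mean_def o_def linear_cmul[OF bounded_linear.linear[OF assms(1)]])

lemma circ_mean_cong:
  assumes "\<And>z. z \<in> sphere 0 1 \<Longrightarrow> F z = G z"
  shows "circ_mean F = circ_mean G"
  using assms by (simp add: circ_mean_def)

lemma circ_mean_const: "circ_mean (\<lambda>z. c) = c"
  by (simp add: circ_mean_def)

lemma norm_circ_mean_le:
  assumes "continuous_on (sphere 0 1) F" "\<And>z. z \<in> sphere 0 1 \<Longrightarrow> norm (F z) \<le> b"
  shows "norm (circ_mean F) \<le> b"
proof -
  have "norm (integral {0..2*pi} (\<lambda>\<theta>. F (cis \<theta>))) \<le> b * (2 * pi - 0)"
    by (rule integral_bound) (use assms in \<open>auto intro!: continuous_on_circle_param\<close>)
  then show ?thesis
    by (simp add: circ_mean_def divide_simps mult.commute)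
qed

lemma norm_circ_mean_le_mean:
  fixes F :: "complex \<Rightarrow> 'a::euclidean_space"
  assumes "continuous_on (sphere 0 1) F" "continuous_on (sphere 0 1) g"
    and "\<And>z. z \<in> sphere 0 1 \<Longrightarrow> norm (F z) \<le> g z"
  shows "norm (circ_mean F) \<le> circ_mean g"
proof -
  have "norm (integral {0..2*pi} (\<lambda>\<theta>. F (cis \<theta>))) \<le> integral {0..2*pi} (\<lambda>\<theta>. g (cis \<theta>))"
    by (rule integral_norm_bound_integral)
       (use assms in \<open>auto intro: circle_param_integrable\<close>)
  then show ?thesis by (simp add: circ_mean_def divide_right_mono)
qed

lemma circ_mean_mono:
  fixes F G :: "complex \<Rightarrow> real"
  assumes "continuous_on (sphere 0 1) F" "continuous_on (sphere 0 1) G"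
    and "\<And>z. z \<in> sphere 0 1 \<Longrightarrow> F z \<le> G z"
  shows "circ_mean F \<le> circ_mean G"
  unfolding circ_mean_def
  by (intro scaleR_left_mono integral_le circle_param_integrable) (use assms in auto)

lemma circ_mean_nonneg_eq_0:
  fixes F :: "complex \<Rightarrow> real"
  assumes c: "continuous_on (sphere 0 1) F" and nn: "\<And>z. z \<in> sphere 0 1 \<Longrightarrow> 0 \<le> F z"
    and 0: "circ_mean F = 0" and z: "z \<in> sphere 0 1"
  shows "F z = 0"
proof -
  obtain \<theta> where \<theta>: "0 \<le> \<theta>" "\<theta> \<le> 2 * pi" "z = cis \<theta>"
    using sphere_cis_obtain z by blast
  have "\<forall>x\<in>{0..2*pi}. F (cis x) = 0"
    using 0 nn by (subst integral_eq_0_iff[symmetric])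
      (auto simp: circ_mean_def intro!: continuous_on_circle_param c)
  with \<theta> show ?thesis by auto
qed

lemma continuous_on_circ_mean_param:
  fixes f :: "'a::topological_space \<Rightarrow> complex \<Rightarrow> 'b::banach"
  assumes "continuous_on (U \<times> sphere 0 1) (\<lambda>(x, z). f x z)"
  shows "continuous_on U (\<lambda>x. circ_mean (f x))"
proof -
  have "continuous_on (U \<times> cbox 0 (2 * pi)) (\<lambda>(x, \<theta>). f x (cis \<theta>))"
  proof -
    have "continuous_on (U \<times> cbox 0 (2 * pi)) (\<lambda>p. (\<lambda>(x, z). f x z) (fst p, cis (snd p)))"
      by (rule continuous_on_compose2[OF assms]) (auto intro!: continuous_intros)
    then show ?thesis by (simp add: case_prod_unfold)
  qed
  from integral_continuous_on_param[OF this] show ?thesis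
    unfolding circ_mean_def by (intro continuous_intros) simp
qed

text \<open>The functions of interest are analytic outside the unit disc, in the variable \<open>1 / z\<close>, which
  equals \<open>cnj z\<close> on the circle. Cauchy's formula at the centre gives the mean over \<open>z\<close>, and the substitution
  \<open>\<theta> \<mapsto> 2 \<pi> - \<theta>\<close> the mean over \<open>cnj z\<close>.\<close>

lemma circ_mean_mean_value:
  assumes c: "continuous_on (cball 0 1) f" and h: "f holomorphic_on ball 0 1"
  shows "circ_mean (\<lambda>z. f (cnj z)) = f 0"
proof -
  have "((\<lambda>u. f u / (u - 0)) has_contour_integral (2 * of_real pi * \<i> * f 0)) (circlepath 0 1)"
    by (rule Cauchy_integral_circlepath[OF c h]) simp
  then have "((\<lambda>t. f (cis t) / cis t * \<i> * cis t) has_integral (2 * of_real pi * \<i> * f 0)) {0..2*pi}"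
    unfolding circlepath_def
    by (subst (asm) has_contour_integral_part_circlepath_iff) simp_all
  then have "((\<lambda>t. f (cis t) / cis t * \<i> * cis t * (- \<i>)) has_integral
      (2 * of_real pi * \<i> * f 0 * (- \<i>))) {0..2*pi}"
    by (rule has_integral_mult_left)
  then have "((\<lambda>t. f (cis t)) has_integral (2 * of_real pi * f 0)) {0..2*pi}"
    by (rule has_integral_eq_rhs[OF has_integral_eq[rotated]]) (auto simp: field_simps)
  then have "((\<lambda>t. f (cis (- t))) has_integral (2 * of_real pi * f 0)) {-(2*pi)..-0}"
    by (subst has_integral_reflect_real) simp_all
  then have "((\<lambda>t. f (cis (- (t - 2*pi)))) has_integral (2 * of_real pi * f 0)) {0..2*pi}"
    by (drule_tac has_integral_shift_real_ivl[where c = "- (2 * pi)"]) simp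
  then have "integral {0..2*pi} (\<lambda>t. f (cnj (cis t))) = 2 * of_real pi * f 0"
    by (intro integral_unique) (simp add: cis_cnj cis_mult inverse_eq_divide flip: cis_divide cis_inverse)
  then show ?thesis
    by (simp add: circ_mean_def scaleR_conv_of_real)
qed

lemma circ_mean_nth:
  fixes F :: "complex \<Rightarrow> complex^'n^'m"
  assumes "continuous_on (sphere 0 1) F"
  shows "circ_mean F $ i $ j = circ_mean (\<lambda>z. F z $ i $ j)"
proof -
  have "bounded_linear (\<lambda>M::complex^'n^'m. M $ i $ j)"
    by (rule bounded_linear_compose[OF bounded_linear_vec_nth bounded_linear_vec_nth])
  from circ_mean_linear[OF this assms] show ?thesis by simp
qed

lemma continuous_on_circle_cnj:
  "continuous_on (cball 0 1) f \<Longrightarrow> continuous_on (sphere 0 1) (\<lambda>z. f (cnj z))"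
  by (rule continuous_on_compose2[of "cball 0 1" f]) (auto intro!: continuous_intros)

lemma circ_mean_mean_value_matrix:
  fixes f :: "complex \<Rightarrow> complex^'n^'m"
  assumes "continuous_on (cball 0 1) f" and "\<And>i j. (\<lambda>w. f w $ i $ j) holomorphic_on ball 0 1"
  shows "circ_mean (\<lambda>z. f (cnj z)) = f 0"
proof -
  have "circ_mean (\<lambda>z. f (cnj z)) $ i $ j = f 0 $ i $ j" for i j
  proof -
    have "circ_mean (\<lambda>z. f (cnj z)) $ i $ j = circ_mean (\<lambda>z. f (cnj z) $ i $ j)"
      by (rule circ_mean_nth[OF continuous_on_circle_cnj[OF assms(1)]])
    also have "\<dots> = f 0 $ i $ j"
      by (rule circ_mean_mean_value[of "\<lambda>w. f w $ i $ j"]) (intro continuous_intros assms)+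
    finally show ?thesis .
  qed
  then show ?thesis by (simp add: vec_eq_iff)
qed

lemma circ_mean_mult:
  fixes F :: "complex \<Rightarrow> complex^'k^'l" and M :: "complex^'l^'m" and N :: "complex^'j^'k"
  assumes "continuous_on (sphere 0 1) F"
  shows "circ_mean (\<lambda>z. M ** F z ** N) = M ** circ_mean F ** N"
  using circ_mean_linear[OF bounded_linear_compose[OF matrix_mult.bounded_linear_left
        matrix_mult.bounded_linear_right] assms, of M N] by simp

lemmas circ_mean_mult_left = circ_mean_mult[where N = "mat 1", simplified]
lemmas circ_mean_mult_right = circ_mean_mult[where M = "mat 1", simplified]

lemma unit_conj_cancel: "cmod w = 1 \<Longrightarrow> (mat w ** M) ** X ** adj (mat w ** N) = M ** X ** adj N"
  and unit_conj_cancel': "cmod w = 1 \<Longrightarrow> adj (mat w ** M') ** X ** (mat w ** N') = adj M' ** X ** N'"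
proof -
  assume "cmod w = 1"
  then have w: "w * cnj w = 1" "cnj w * w = 1"
    by (simp_all add: complex_norm_square[symmetric] mult.commute)
  have "(mat w ** M) ** X ** adj (mat w ** N) = mat w ** ((M ** X ** adj N) ** mat (cnj w))"
    by (simp add: adj_mult adj_mat matrix_mul_assoc)
  also have "(M ** X ** adj N) ** mat (cnj w) = mat (cnj w) ** (M ** X ** adj N)"
    by (rule mat_mult_commute[symmetric])
  finally show "(mat w ** M) ** X ** adj (mat w ** N) = M ** X ** adj N"
    using w by (simp add: mat_mult_mat matrix_mul_assoc)
  have "adj (mat w ** M') ** X ** (mat w ** N') = adj M' ** (mat (cnj w) ** (X ** (mat w ** N')))"
    by (simp add: adj_mult adj_mat matrix_mul_assoc)
  also have "X ** (mat w ** N') = mat w ** (X ** N')"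
    by (metis mat_mult_commute matrix_mul_assoc)
  finally show "adj (mat w ** M') ** X ** (mat w ** N') = adj M' ** X ** N'"
    using w by (simp add: mat_mult_mat matrix_mul_assoc)
qed

section \<open>Stable matrices and their resolvents\<close>

text \<open>Writing stability as nonvanishing of \<open>det (I - wK)\<close> on the closed disc makes it a condition on
  the resolvent at \<open>w = 1 / z\<close>, and an open condition, by compactness of the disc.\<close>

lemma schur_stable_iff:
  "schur_stable K \<longleftrightarrow> (\<forall>w. cmod w \<le> 1 \<longrightarrow> invertible (mat 1 - mat w ** K))"
proof (intro iffI allI impI)
  fix w assume K: "schur_stable K" and w: "cmod w \<le> 1"
  show "invertible (mat 1 - mat w ** K)"
    unfolding invertible_iff_ker
  proof (intro allI impI, rule ccontr)
    fix x assume x: "(mat 1 - mat w ** K) *v x = 0" "x \<noteq> 0"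
    then have eq: "x = w *s (K *v x)"
      by (simp add: matrix_vector_mult_diff_rdistrib mat_vec flip: matrix_vector_mul_assoc)
    with x have "w \<noteq> 0" by auto
    then have "K *v x = (1 / w) *s x"
      by (subst (2) eq) (simp add: vec.scale_scale)
    then have "cmod (1 / w) < 1"
      using K x unfolding schur_stable_def is_eigenvalue_def by blast
    then show False
      using w \<open>w \<noteq> 0\<close> by (simp add: norm_divide)
  qed
next
  assume inv: "\<forall>w. cmod w \<le> 1 \<longrightarrow> invertible (mat 1 - mat w ** K)"
  show "schur_stable K"
    unfolding schur_stable_def is_eigenvalue_def
  proof (intro allI impI, rule ccontr, elim exE conjE)
    fix \<mu> v assume \<mu>: "\<not> cmod \<mu> < 1" and v: "v \<noteq> 0" "K *v v = \<mu> *s v"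
    have nz: "\<mu> \<noteq> 0" using \<mu> by auto
    have "(mat 1 - mat (1/\<mu>) ** K) *v v = 0"
      using v nz by (simp add: matrix_vector_mult_diff_rdistrib mat_vec flip: matrix_vector_mul_assoc)
    moreover have "cmod (1 / \<mu>) \<le> 1"
      using \<mu> by (simp add: norm_divide divide_simps)
    ultimately show False
      using inv v(1) unfolding invertible_iff_ker by blast
  qed
qed

lemma schur_stable_adj: "schur_stable K \<Longrightarrow> schur_stable (adj K)"
proof -
  assume K: "schur_stable K"
  have "invertible (mat 1 - mat w ** adj K)" if "cmod w \<le> 1" for w
  proof -
    have "invertible (adj (mat 1 - mat (cnj w) ** K))"
      using K that by (intro invertible_adj) (simp add: schur_stable_iff)
    then show ?thesis
      by (simp add: adj_diff adj_mult adj_mat mat_mult_commute)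
  qed
  then show ?thesis by (simp add: schur_stable_iff)
qed

definition resolvent :: "complex^'n^'n \<Rightarrow> complex \<Rightarrow> complex^'n^'n" where
  "resolvent K w = matrix_inv (mat 1 - mat w ** K)"

lemma resolvent_zero [simp]: "resolvent K 0 = mat 1"
  unfolding resolvent_def by (rule matrix_inv_eqI) (simp add: vec_eq_iff mat_mult_nth matrix_ring)

context
  fixes K :: "complex^'n^'n"
  assumes K: "schur_stable K"
begin

lemma resolvent_left: "cmod w \<le> 1 \<Longrightarrow> mat w ** (K ** resolvent K w) = resolvent K w - mat 1"
  and resolvent_right: "cmod w \<le> 1 \<Longrightarrow> mat w ** (resolvent K w ** K) = resolvent K w - mat 1"
proof -
  assume "cmod w \<le> 1"
  then have inv: "invertible (mat 1 - mat w ** K)"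
    using K by (simp add: schur_stable_iff)
  show "mat w ** (K ** resolvent K w) = resolvent K w - mat 1"
    using matrix_inv_mult(1)[OF inv] by (simp add: resolvent_def matrix_ring algebra_simps)
  have "resolvent K w ** mat w ** K = resolvent K w - mat 1"
    using matrix_inv_mult(2)[OF inv] by (simp add: resolvent_def matrix_ring algebra_simps)
  then show "mat w ** (resolvent K w ** K) = resolvent K w - mat 1"
    by (simp add: mat_mult_commute matrix_mul_assoc)
qed

lemma continuous_on_resolvent: "continuous_on (cball 0 1) (resolvent K)"
  unfolding resolvent_def using K
  by (intro continuous_intros) (auto simp: schur_stable_iff)

lemma continuous_on_resolvent_circle [continuous_intros]:
  "continuous_on (sphere 0 1) (\<lambda>z. resolvent K (cnj z))"
  by (rule continuous_on_circle_cnj[OF continuous_on_resolvent])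

lemma holomorphic_resolvent: "(\<lambda>w. resolvent K w $ i $ j) holomorphic_on ball 0 1"
  unfolding resolvent_def
proof (rule holomorphic_on_matrix_inv)
  show "invertible (mat 1 - mat x ** K)" if "x \<in> ball 0 1" for x
    using that K by (simp add: schur_stable_iff)
qed (simp add: mat_mult_nth, intro holomorphic_intros)

lemma circ_mean_resolvent: "circ_mean (\<lambda>z. resolvent K (cnj z)) = mat 1"
  using circ_mean_mean_value_matrix[OF continuous_on_resolvent holomorphic_resolvent] by simp

lemma circ_mean_adj_resolvent: "circ_mean (\<lambda>z. adj (resolvent K (cnj z))) = mat 1"
  using circ_mean_linear[OF bounded_linear_adj continuous_on_resolvent_circle]
  by (simp add: circ_mean_resolvent)

text \<open>With \<open>R = (I - wK)\<^sup>-\<^sup>1\<close> one has \<open>wRK = R - I\<close>, and \<open>|w| = 1\<close>, so \<open>R K X K* R* = (R - I) X (R - I)*\<close>. The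
  integrand collapses to \<open>R X + X R* - X\<close>, whose mean is \<open>X\<close> because \<open>R\<close> has mean \<open>I\<close>. In particular
  a Lyapunov equation has at most one solution.\<close>

lemma lyapunov_reconstruct:
  "circ_mean (\<lambda>z. resolvent K (cnj z) ** (X - K ** X ** adj K) ** adj (resolvent K (cnj z))) = X"
proof -
  let ?R = "\<lambda>z. resolvent K (cnj z)"
  have eq: "?R z ** (X - K ** X ** adj K) ** adj (?R z) = ?R z ** X + X ** adj (?R z) - X"
    if z: "z \<in> sphere 0 1" for z
  proof -
    have "?R z ** (K ** X ** adj K) ** adj (?R z) = (?R z ** K) ** X ** adj (?R z ** K)"
      by (simp add: adj_mult matrix_mul_assoc)
    also have "\<dots> = (mat (cnj z) ** (?R z ** K)) ** X ** adj (mat (cnj z) ** (?R z ** K))"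
      using z by (subst unit_conj_cancel) auto
    also have "\<dots> = (?R z - mat 1) ** X ** adj (?R z - mat 1)"
      using z by (simp add: resolvent_right)
    finally show ?thesis
      by (simp add: matrix_ring adj_diff algebra_simps)
  qed
  have "circ_mean (\<lambda>z. ?R z ** (X - K ** X ** adj K) ** adj (?R z))
      = circ_mean (\<lambda>z. ?R z ** X + X ** adj (?R z) - X)"
    by (rule circ_mean_cong) (rule eq)
  also have "\<dots> = X"
    by (simp add: circ_mean_add circ_mean_diff continuous_intros circ_mean_const circ_mean_mult_left
        circ_mean_mult_right circ_mean_resolvent circ_mean_adj_resolvent)
  finally show ?thesis .
qed

text \<open>The dual computation, with \<open>wRK = R - I\<close> on both sides of \<open>R* X R\<close>: it produces a solution of the
  Lyapunov equation instead of recovering one.\<close>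

lemma lyapunov_solution:
  fixes X :: "complex^'n^'n"
  defines "P \<equiv> circ_mean (\<lambda>z. adj (resolvent K (cnj z)) ** X ** resolvent K (cnj z))"
  shows "P - adj K ** P ** K = X"
proof -
  let ?R = "\<lambda>z. resolvent K (cnj z)"
  have eq: "adj K ** (adj (?R z) ** X ** ?R z) ** K = adj (?R z) ** X ** ?R z - X ** ?R z - adj (?R z) ** X + X"
    if z: "z \<in> sphere 0 1" for z
  proof -
    have "adj K ** (adj (?R z) ** X ** ?R z) ** K = adj (?R z ** K) ** X ** (?R z ** K)"
      by (simp add: adj_mult matrix_mul_assoc)
    also have "\<dots> = adj (mat (cnj z) ** (?R z ** K)) ** X ** (mat (cnj z) ** (?R z ** K))"
      using z by (subst unit_conj_cancel') auto
    also have "\<dots> = adj (?R z - mat 1) ** X ** (?R z - mat 1)"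
      using z by (simp add: resolvent_right)
    finally show ?thesis
      by (simp add: matrix_ring adj_diff algebra_simps)
  qed
  have "adj K ** P ** K = circ_mean (\<lambda>z. adj K ** (adj (?R z) ** X ** ?R z) ** K)"
    unfolding P_def by (subst circ_mean_mult) (auto intro!: continuous_intros)
  also have "\<dots> = circ_mean (\<lambda>z. adj (?R z) ** X ** ?R z - X ** ?R z - adj (?R z) ** X + X)"
    by (rule circ_mean_cong) (rule eq)
  also have "\<dots> = P - X"
    by (simp add: circ_mean_add circ_mean_diff continuous_intros circ_mean_const circ_mean_mult_left
        circ_mean_mult_right circ_mean_resolvent circ_mean_adj_resolvent P_def)
  finally show ?thesis by simp
qed

end

lemma open_schur_stable: "open {K :: complex^'n^'n. schur_stable K}"
proof -
  have "closed {K :: complex^'n^'n. \<not> schur_stable K}"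
  proof (unfold closed_sequential_limits, intro allI impI, elim conjE)
    fix k :: "nat \<Rightarrow> complex^'n^'n" and l
    assume ns: "\<forall>n. k n \<in> {K. \<not> schur_stable K}" and lim: "k \<longlonglongrightarrow> l"
    have "\<forall>n. \<exists>w. w \<in> cball 0 1 \<and> det (mat 1 - mat w ** k n) = 0"
      using ns by (auto simp: schur_stable_iff invertible_det_nz)
    then obtain w where w: "\<And>n. w n \<in> cball 0 1" "\<And>n. det (mat 1 - mat (w n) ** k n) = 0"
      by metis
    obtain v r where v: "v \<in> cball 0 1" and r: "strict_mono (r :: nat \<Rightarrow> nat)"
      and lim': "(w \<circ> r) \<longlonglongrightarrow> v"
      using compact_cball[of "0::complex" 1] w(1) unfolding compact_def by metis
    have c: "continuous_on UNIV (\<lambda>p. det (mat 1 - mat (fst p) ** snd p :: complex^'n^'n))"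
      by (intro continuous_on_det continuous_intros)
    have "(\<lambda>n. (w (r n), k (r n))) \<longlonglongrightarrow> (v, l)"
      using lim' LIMSEQ_subseq_LIMSEQ[OF lim r] by (intro tendsto_Pair) (auto simp: o_def)
    from continuous_on_tendsto_compose[OF c this]
    have "(\<lambda>n. det (mat 1 - mat (w (r n)) ** k (r n))) \<longlonglongrightarrow> det (mat 1 - mat v ** l)"
      by simp
    then have "det (mat 1 - mat v ** l) = 0"
      using w(2) by (simp add: LIMSEQ_const_iff)
    with v show "l \<in> {K. \<not> schur_stable K}"
      by (auto simp: schur_stable_iff invertible_det_nz)
  qed
  then show ?thesis
    by (simp add: closed_def Collect_neg_eq)
qed

section \<open>Positive definite matrices\<close>

lemma inner_cvec: "inner x y = Re (\<Sum>i\<in>UNIV. cnj (x $ i) * y $ i)"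
  for x y :: "complex^'m"
  by (simp add: inner_vec_def inner_complex_def)

lemma inner_mat_vec: "inner x (M *v y) = inner (adj M *v x) y"
  for x :: "complex^'m" and M :: "complex^'n^'m"
proof -
  have "(\<Sum>i\<in>UNIV. cnj (x$i) * (M *v y)$i) = (\<Sum>i\<in>UNIV. \<Sum>j\<in>UNIV. cnj (x$i) * M$i$j * y$j)"
    by (simp add: matrix_vector_mult_def sum_distrib_left mult.assoc)
  also have "\<dots> = (\<Sum>j\<in>UNIV. \<Sum>i\<in>UNIV. cnj (x$i) * M$i$j * y$j)"
    by (rule sum.swap)
  also have "\<dots> = (\<Sum>j\<in>UNIV. cnj ((adj M *v x)$j) * y$j)"
    by (simp add: matrix_vector_mult_def adj_def sum_distrib_left sum_distrib_right
        mult.commute mult.left_commute)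
  finally show ?thesis
    unfolding inner_cvec by (rule arg_cong)
qed

lemma inner_scale: "inner (c *s x) (c *s y) = (cmod c)\<^sup>2 * inner x y"
  for x :: "complex^'m"
proof -
  have "inner (c * a) (c * b) = (cmod c)\<^sup>2 * inner a b" for a b
    unfolding cmod_power2 by (simp add: inner_complex_def power2_eq_square algebra_simps)
  then show ?thesis by (simp add: inner_vec_def sum_distrib_left)
qed

lemma bounded_linear_quad: "bounded_linear (\<lambda>M. inner w (M *v w))"
  for w :: "complex^'k"
  by (rule linear_conv_bounded_linear[THEN iffD1])
     (auto intro!: linearI simp: matrix_vector_mult_add_rdistrib inner_add_right scaleR_matrix_vector)

lemma pos_def_iff: "pos_def M \<longleftrightarrow> hermitian M \<and> (\<forall>x. x \<noteq> 0 \<longrightarrow> 0 < inner x (M *v x))"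
  by (simp add: pos_def_def inner_vec_def inner_complex_def)

lemma inner_gram: "inner x ((D ** adj D) *v x) = (norm (adj D *v x))\<^sup>2"
  by (simp add: inner_mat_vec adj_mult power2_norm_eq_inner flip: matrix_vector_mul_assoc)

lemma pos_def_invertible: "pos_def M \<Longrightarrow> invertible M"
  by (force simp: pos_def_iff invertible_iff_ker)

lemma hermitian_matrix_inv: "hermitian M \<Longrightarrow> invertible M \<Longrightarrow> hermitian (matrix_inv M)"
  by (metis hermitian_def matrix_inv_adj)

lemma pos_def_matrix_inv: "pos_def M \<Longrightarrow> pos_def (matrix_inv M)"
proof -
  assume M: "pos_def M"
  then have inv: "invertible M" by (rule pos_def_invertible)
  have "0 < inner x (matrix_inv M *v x)" if "x \<noteq> 0" for x
  proof -
    define y where "y = matrix_inv M *v x"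
    have x: "x = M *v y"
      by (simp add: y_def matrix_vector_mul_assoc matrix_inv_mult[OF inv])
    with that have "y \<noteq> 0" by auto
    with M have "0 < inner y (M *v y)" by (simp add: pos_def_iff)
    then show ?thesis by (metis x y_def inner_commute)
  qed
  with M inv show ?thesis
    by (simp add: pos_def_iff hermitian_matrix_inv)
qed

lemma pos_def_congruence:
  assumes "pos_def M" and "\<And>x. N *v x = 0 \<Longrightarrow> x = 0"
  shows "pos_def (adj N ** M ** N)"
proof -
  have "0 < inner x ((adj N ** M ** N) *v x)" if "x \<noteq> 0" for x
  proof -
    have "inner x ((adj N ** M ** N) *v x) = inner (N *v x) (M *v (N *v x))"
      by (simp add: inner_mat_vec flip: matrix_vector_mul_assoc)
    with assms that show ?thesis by (auto simp: pos_def_iff)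
  qed
  moreover have "hermitian (adj N ** M ** N)"
    using assms(1) by (simp add: pos_def_iff hermitian_def adj_mult matrix_mul_assoc)
  ultimately show ?thesis by (simp add: pos_def_iff)
qed

text \<open>Test the equation on a left eigenvector \<open>w\<close> of \<open>K\<close> with eigenvalue \<open>\<mu>\<close>: it gives
  \<open>|D* w|\<^sup>2 = (1 - |\<mu>|\<^sup>2) w* P w\<close>. If \<open>|\<mu>| \<ge> 1\<close>, then \<open>D* w = 0\<close>, and \<open>w\<close> is a left eigenvector of
  \<open>A = K + D Y\<close> too, contradicting stability of \<open>A\<close>. The lemma is used both for the initial
  parameter and for limits of solutions.\<close>

lemma schur_stable_of_lyapunov:
  assumes A: "schur_stable A" and P: "\<And>x. x \<noteq> 0 \<Longrightarrow> 0 < inner x (P *v x)"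
    and eq: "P = K ** P ** adj K + D ** adj D" and K: "K = A - D ** Y"
  shows "schur_stable K"
proof -
  have "schur_stable (adj K)"
    unfolding schur_stable_def is_eigenvalue_def
  proof (intro allI impI, elim exE conjE)
    fix \<mu> w assume w: "w \<noteq> 0" "adj K *v w = \<mu> *s w"
    show "cmod \<mu> < 1"
    proof (rule ccontr)
      assume "\<not> cmod \<mu> < 1"
      then have ge: "1 \<le> (cmod \<mu>)\<^sup>2" by simp
      have "inner w (P *v w) = inner w ((K ** P ** adj K) *v w) + inner w ((D ** adj D) *v w)"
        by (subst eq) (simp add: matrix_vector_mult_add_rdistrib inner_add_right)
      also have "inner w ((K ** P ** adj K) *v w) = inner (adj K *v w) (P *v (adj K *v w))"
        by (simp add: inner_mat_vec flip: matrix_vector_mul_assoc)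
      also have "\<dots> = (cmod \<mu>)\<^sup>2 * inner w (P *v w)"
        by (simp add: w vector_scalar_commute inner_scale)
      finally have "(norm (adj D *v w))\<^sup>2 = (1 - (cmod \<mu>)\<^sup>2) * inner w (P *v w)"
        by (simp add: inner_gram algebra_simps)
      also have "\<dots> \<le> 0"
        using ge P[OF w(1)] by (simp add: mult_nonpos_nonneg)
      finally have D: "adj D *v w = 0" by simp
      have "adj A *v w = adj K *v w + adj Y *v (adj D *v w)"
        by (simp add: K adj_diff adj_mult matrix_vector_mult_diff_rdistrib matrix_vector_mul_assoc)
      then have "adj A *v w = \<mu> *s w" by (simp add: D w)
      with schur_stable_adj[OF A] w(1) have "cmod \<mu> < 1"
        unfolding schur_stable_def is_eigenvalue_def by blast
      with \<open>\<not> cmod \<mu> < 1\<close> show False by simp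
    qed
  qed
  from schur_stable_adj[OF this] show ?thesis by simp
qed

section \<open>Triangular matrices\<close>

lemma lower_triangular_mult_diag:
  fixes X T :: "complex^'m::{finite,wellorder}^'m::_"
  assumes "lower_triangular X" "lower_triangular T"
  shows "(X ** T) $ i $ i = X $ i $ i * T $ i $ i"
proof -
  have "(X ** T) $ i $ i = (\<Sum>k\<in>UNIV. X $ i $ k * T $ k $ i)"
    by (simp add: matrix_matrix_mult_def)
  also have "\<dots> = (\<Sum>k\<in>{i}. X $ i $ k * T $ k $ i)"
    using assms by (intro sum.mono_neutral_right) (auto simp: lower_triangular_def neq_iff)
  finally show ?thesis by simp
qed

lemma lower_triangular_mult:
  fixes X T :: "complex^'m::{finite,wellorder}^'m::_"
  assumes "lower_triangular X" "lower_triangular T"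
  shows "lower_triangular (X ** T)"
  unfolding lower_triangular_def matrix_matrix_mult_def
proof (intro allI impI, simp, intro sum.neutral ballI)
  fix i j k :: 'm assume "i < j"
  then show "X $ i $ k * T $ k $ j = 0"
    using assms by (cases "i < k") (auto simp: lower_triangular_def not_less)
qed

text \<open>Within each row, the entries to the right of the diagonal vanish one after the other, from the last
  column backwards.\<close>

lemma lower_triangular_cancel:
  fixes X T :: "complex^'m::{finite,wellorder}^'m::_"
  assumes XT: "lower_triangular (X ** T)" and T: "lower_triangular T" and nz: "\<And>i. T $ i $ i \<noteq> 0"
  shows "lower_triangular X"
proof -
  have "X $ i $ j = 0" if "i < j" for i j
    using that
  proof (induction "card {k. j < k}" arbitrary: j rule: less_induct)
    case less
    have "X $ i $ k = 0" if k: "j < k" for k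
    proof (rule less.hyps)
      show "card {l. k < l} < card {l. j < l}"
        using k by (intro psubset_card_mono) auto
      show "i < k" using k less.prems by simp
    qed
    then have 0: "X $ i $ k * T $ k $ j = 0" if "k \<noteq> j" for k
      using that T by (cases "k < j") (auto simp: lower_triangular_def)
    have "0 = (X ** T) $ i $ j"
      using XT less.prems by (simp add: lower_triangular_def)
    also have "\<dots> = (\<Sum>k\<in>UNIV. X $ i $ k * T $ k $ j)"
      by (simp add: matrix_matrix_mult_def)
    also have "\<dots> = (\<Sum>k\<in>{j}. X $ i $ k * T $ k $ j)"
      using 0 by (intro sum.mono_neutral_right) auto
    finally show ?case using nz by simp
  qed
  then show ?thesis by (simp add: lower_triangular_def)
qed

lemma pos_diag_nz: "pos_diag T \<Longrightarrow> T $ i $ i \<noteq> 0"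
  unfolding pos_diag_def by (metis less_irrefl zero_complex.sel(1))

lemma invertible_lower_triangular:
  fixes T :: "complex^'m::{finite,wellorder}^'m::_"
  assumes "lower_triangular T"
  shows "invertible T \<longleftrightarrow> (\<forall>i. T $ i $ i \<noteq> 0)"
  using assms by (simp add: invertible_det_nz det_lowerdiagonal lower_triangular_def)

text \<open>This is where the normalisation of \<open>C B\<close> enters: triangularity and a real diagonal remove the freedom
  of multiplying \<open>C\<close> by a unitary matrix on the left, which the moment map does not see.\<close>

lemma lower_triangular_skew_eq_0:
  fixes S T :: "complex^'m::{finite,wellorder}^'m::_"
  assumes ST: "lower_triangular (S ** T)" "real_diag (S ** T)"
    and T: "lower_triangular T" "pos_diag T" and skew: "S + adj S = 0"
  shows "S = 0"
proof -
  have low: "lower_triangular S"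
    using lower_triangular_cancel[OF ST(1) T(1)] pos_diag_nz[OF T(2)] by blast
  have sk: "S $ i $ j = - cnj (S $ j $ i)" for i j
    using skew by (simp add: vec_eq_iff adj_def eq_neg_iff_add_eq_0)
  have "S $ i $ j = 0" for i j
  proof (cases i j rule: linorder_cases)
    case less then show ?thesis using low by (simp add: lower_triangular_def)
  next
    case greater then show ?thesis using low sk[of i j] by (simp add: lower_triangular_def)
  next
    case equal
    have "S $ i $ i * T $ i $ i \<in> \<real>"
      using ST(2) by (simp add: real_diag_def flip: lower_triangular_mult_diag[OF low T(1)])
    moreover have "T $ i $ i \<in> \<real>" "T $ i $ i \<noteq> 0"
      using T(2) pos_diag_nz by (auto simp: pos_diag_def)
    ultimately have "S $ i $ i * T $ i $ i / T $ i $ i \<in> \<real>"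
      using Reals_divide by blast
    then have "S $ i $ i \<in> \<real>" using \<open>T $ i $ i \<noteq> 0\<close> by simp
    then have "cnj (S $ i $ i) = S $ i $ i" by (simp add: Reals_cnj_iff)
    with sk[of i i] have "S $ i $ i = 0" by simp
    then show ?thesis using equal by simp
  qed
  then show ?thesis by (simp add: vec_eq_iff)
qed

text \<open>The quotient of two factors is unitary and, together with its adjoint, lower triangular: it is diagonal
  with positive entries of modulus one.\<close>

lemma is_LL_factor_unique:
  fixes M L1 L2 :: "complex^'m::{finite,wellorder}^'m::_"
  assumes "is_LL_factor M L1" "is_LL_factor M L2"
  shows "L1 = L2"
proof -
  have L: "lower_triangular L1" "pos_diag L1" "lower_triangular L2" "pos_diag L2"
    and eq: "adj L1 ** L1 = adj L2 ** L2"
    using assms by (auto simp: is_LL_factor_def)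
  have inv: "invertible L1" "invertible L2"
    using L invertible_lower_triangular pos_diag_nz by blast+
  define X where "X = L1 ** matrix_inv L2"
  have X2: "X ** L2 = L1"
    by (simp add: X_def matrix_inv_mult inv flip: matrix_mul_assoc)
  have adjX: "adj X = L2 ** matrix_inv L1"
  proof -
    have "adj X = adj (matrix_inv L2) ** (adj L1 ** L1) ** matrix_inv L1"
      by (simp add: X_def adj_mult matrix_inv_mult inv flip: matrix_mul_assoc)
    also have "\<dots> = (adj (matrix_inv L2) ** adj L2) ** (L2 ** matrix_inv L1)"
      by (simp add: eq matrix_mul_assoc)
    also have "adj (matrix_inv L2) ** adj L2 = mat 1"
      by (simp add: matrix_inv_mult inv flip: adj_mult)
    finally show ?thesis by simp
  qed
  have "adj X ** L1 = L2"
    by (simp add: adjX matrix_inv_mult inv flip: matrix_mul_assoc)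
  then have lowX': "lower_triangular (adj X)"
    using lower_triangular_cancel[of "adj X" L1] L pos_diag_nz by metis
  have lowX: "lower_triangular X"
    using lower_triangular_cancel[of X L2] X2 L pos_diag_nz by metis
  have "X $ i $ j = mat 1 $ i $ j" for i j
  proof (cases i j rule: linorder_cases)
    case less then show ?thesis using lowX by (simp add: lower_triangular_def mat_def)
  next
    case greater
    then have "adj X $ j $ i = 0" using lowX' by (simp add: lower_triangular_def)
    with greater show ?thesis by (simp add: adj_def mat_def)
  next
    case equal
    have "adj X ** X = mat 1"
      by (metis X_def \<open>adj X ** L1 = L2\<close> inv(2) matrix_inv_mult(1) matrix_mul_assoc)
    then have 1: "cnj (X $ i $ i) * X $ i $ i = 1"
      using lower_triangular_mult_diag[OF lowX' lowX, of i] by (simp add: adj_def mat_def)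
    have d: "X $ i $ i * L2 $ i $ i = L1 $ i $ i"
      using lower_triangular_mult_diag[OF lowX L(3), of i] X2 by simp
    obtain a b where ab: "L2 $ i $ i = of_real a" "L1 $ i $ i = of_real b" "0 < a" "0 < b"
      using L by (metis Re_complex_of_real Reals_cases pos_diag_def)
    then have x: "X $ i $ i = of_real (b / a)"
      using d by (simp add: field_simps)
    then have "(b / a) * (b / a) = 1"
      using 1 by (metis complex_cnj_complex_of_real of_real_eq_1_iff of_real_mult)
    then have "b / a = 1"
      using ab by (metis divide_pos_pos abs_of_pos real_sqrt_abs2 real_sqrt_one)
    then show ?thesis using x equal by (simp add: mat_def)
  qed
  then have "X = mat 1" by (simp add: vec_eq_iff)
  with X2 show ?thesis by simp
qed

text \<open>Cholesky elimination by Schur complements. A factor \<open>L* L\<close> with \<open>L\<close> lower triangular has to be built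
  starting from the last index, so the induction is over subsets of indices on which the matrix lives,
  each new index being above all the earlier ones; its row is split off first.\<close>

lemma is_LL_factor_exists_on:
  fixes M :: "complex^'m::{finite,wellorder}^'m::_"
  assumes "finite S" "hermitian M" "\<And>i j. i \<notin> S \<or> j \<notin> S \<Longrightarrow> M $ i $ j = 0"
    and "\<And>x. x \<noteq> 0 \<Longrightarrow> (\<And>i. i \<notin> S \<Longrightarrow> x $ i = 0) \<Longrightarrow> 0 < inner x (M *v x)"
  shows "\<exists>L. lower_triangular L \<and> (\<forall>i\<in>S. L $ i $ i \<in> \<real> \<and> 0 < Re (L $ i $ i)) \<and>
    (\<forall>i j. i \<notin> S \<or> j \<notin> S \<longrightarrow> L $ i $ j = 0) \<and> M = adj L ** L"
  using assms
proof (induction S arbitrary: M rule: finite_linorder_max_induct)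
  case empty
  then have "M = 0" by (simp add: vec_eq_iff)
  then show ?case by (intro exI[of _ 0]) (auto simp: lower_triangular_def)
next
  case (insert b S)
  have herm: "cnj (M $ j $ i) = M $ i $ j" for i j
    using \<open>hermitian M\<close> unfolding hermitian_def adj_def by (metis vec_lambda_beta)
  have "0 < inner (axis b 1) (M *v axis b 1)"
    by (rule insert.prems(3)) (auto simp: axis_def vec_eq_iff)
  have "(M *v axis b 1) $ b = M $ b $ b"
    by (simp add: matrix_vector_mult_def axis_def if_distrib cong: if_cong)
  then have "inner (axis b 1) (M *v axis b 1) = Re (M $ b $ b)"
    by (simp add: inner_axis' inner_complex_def)
  with \<open>0 < inner (axis b 1) (M *v axis b 1)\<close> have Mbb: "0 < Re (M $ b $ b)" by simp
  define c where "c = sqrt (Re (M $ b $ b))"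
  have c: "0 < c" "M $ b $ b = of_real c * of_real c"
    using Mbb herm[of b b] by (auto simp: c_def complex_eq_iff simp flip: of_real_mult)
  define r where "r = (\<lambda>j. M $ b $ j / of_real c)"
  have rb: "r b = of_real c" using c by (simp add: r_def)
  have r0: "r j = 0" if "j \<notin> insert b S" for j
    using insert.prems(2)[of b j] that by (simp add: r_def)
  define M' where "M' = (\<chi> i j. M $ i $ j - cnj (r i) * r j)"
  have M'b: "M' $ b $ j = 0" "M' $ j $ b = 0" for j
  proof -
    show "M' $ b $ j = 0" using c by (simp add: M'_def rb) (simp add: r_def)
    show "M' $ j $ b = 0" using c by (simp add: M'_def rb) (simp add: r_def herm)
  qed
  have quad: "inner y (M *v y) = inner y (M' *v y) + (cmod (\<Sum>j\<in>UNIV. r j * y $ j))\<^sup>2" for y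
  proof -
    define s where "s = (\<Sum>j\<in>UNIV. r j * y $ j)"
    have "(M *v y) $ i = (M' *v y) $ i + cnj (r i) * s" for i
      by (simp add: matrix_vector_mult_def M'_def s_def sum_distrib_left algebra_simps sum_subtractf)
    then have "inner y (M *v y) = inner y (M' *v y) + (\<Sum>i\<in>UNIV. inner (y $ i) (cnj (r i) * s))"
      by (simp add: inner_vec_def inner_add_right sum.distrib)
    also have "(\<Sum>i\<in>UNIV. inner (y $ i) (cnj (r i) * s)) = (\<Sum>i\<in>UNIV. inner (r i * y $ i) s)"
      by (simp add: inner_complex_def algebra_simps)
    also have "\<dots> = inner s s" by (simp add: s_def inner_sum_left)
    finally show ?thesis by (simp add: s_def power2_norm_eq_inner)
  qed
  have "\<exists>L. lower_triangular L \<and> (\<forall>i\<in>S. L $ i $ i \<in> \<real> \<and> 0 < Re (L $ i $ i)) \<and>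
    (\<forall>i j. i \<notin> S \<or> j \<notin> S \<longrightarrow> L $ i $ j = 0) \<and> M' = adj L ** L"
  proof (rule insert.IH)
    show "hermitian M'"
      by (simp add: hermitian_def adj_def M'_def vec_eq_iff herm mult.commute)
    show "M' $ i $ j = 0" if "i \<notin> S \<or> j \<notin> S" for i j
    proof (cases "i = b \<or> j = b")
      case True then show ?thesis using M'b by auto
    next
      case False
      then have "M $ i $ j = 0" "r i = 0 \<or> r j = 0"
        using that insert.prems(2)[of i j] r0 by auto
      then show ?thesis by (auto simp: M'_def)
    qed
    fix x :: "complex^'m::_" assume x: "x \<noteq> 0" "\<And>i. i \<notin> S \<Longrightarrow> x $ i = 0"
    have bS: "b \<notin> S" using insert.hyps by auto
    \<comment> \<open>The extension of \<open>x\<close> to the new index that is annihilated by the row \<open>r\<close>.\<close>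
    define \<alpha> where "\<alpha> = - (\<Sum>j\<in>UNIV. r j * x $ j) / of_real c"
    define y where "y = (\<chi> i. if i = b then \<alpha> else x $ i)"
    have yx: "y $ i = x $ i + (if i = b then \<alpha> else 0)" for i
      using x(2)[OF bS] by (simp add: y_def)
    have "r j * y $ j = r j * x $ j + (if j = b then r b * \<alpha> else 0)" for j
      by (simp add: yx distrib_left)
    then have "(\<Sum>j\<in>UNIV. r j * y $ j) = (\<Sum>j\<in>UNIV. r j * x $ j) + r b * \<alpha>"
      by (simp add: sum.distrib)
    also have "\<dots> = 0"
      using c by (simp add: rb \<alpha>_def)
    finally have "(\<Sum>j\<in>UNIV. r j * y $ j) = 0" .
    moreover have "inner y (M' *v y) = inner x (M' *v x)"
    proof -
      have "(M' *v y) $ i = (M' *v x) $ i" for i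
        unfolding matrix_vector_mult_def
        by (simp, rule sum.cong) (auto simp: yx M'b)
      moreover have "(M' *v x) $ b = 0"
        by (simp add: matrix_vector_mult_def M'b)
      ultimately show ?thesis
        unfolding inner_vec_def by (intro sum.cong) (auto simp: yx)
    qed
    moreover have "0 < inner y (M *v y)"
    proof (rule insert.prems(3))
      obtain i where "x $ i \<noteq> 0" using x(1) by (auto simp: vec_eq_iff)
      then have "y $ i \<noteq> 0" using x(2) bS by (auto simp: y_def)
      then show "y \<noteq> 0" by auto
      show "y $ i = 0" if "i \<notin> insert b S" for i using that x(2) by (simp add: y_def)
    qed
    ultimately show "0 < inner x (M' *v x)" using quad[of y] by simp
  qed
  then obtain L' where L': "lower_triangular L'" "\<And>i. i \<in> S \<Longrightarrow> L' $ i $ i \<in> \<real> \<and> 0 < Re (L' $ i $ i)"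
    "\<And>i j. i \<notin> S \<or> j \<notin> S \<Longrightarrow> L' $ i $ j = 0" "M' = adj L' ** L'"
    by blast
  define L where "L = (\<chi> i j. if i = b then r j else L' $ i $ j)"
  have bS: "b \<notin> S" using insert.hyps by auto
  have "M $ i $ j = (adj L ** L) $ i $ j" for i j
  proof -
    have "M $ i $ j = cnj (r i) * r j + (\<Sum>k\<in>UNIV. cnj (L' $ k $ i) * L' $ k $ j)"
      using arg_cong[OF L'(4), of "\<lambda>M. M $ i $ j"]
      by (simp add: M'_def matrix_matrix_mult_def adj_def algebra_simps)
    also have "(\<Sum>k\<in>UNIV. cnj (L' $ k $ i) * L' $ k $ j) = (\<Sum>k\<in>UNIV-{b}. cnj (L $ k $ i) * L $ k $ j)"
      using L'(3) bS by (intro sum.mono_neutral_cong_right) (auto simp: L_def)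
    also have "cnj (r i) * r j + \<dots> = (\<Sum>k\<in>UNIV. cnj (L $ k $ i) * L $ k $ j)"
      by (simp add: sum.remove[of UNIV b] L_def)
    finally show ?thesis by (simp add: matrix_matrix_mult_def adj_def)
  qed
  then have "M = adj L ** L" by (simp add: vec_eq_iff)
  moreover have "lower_triangular L"
    using L'(1) r0 insert.hyps by (fastforce simp: lower_triangular_def L_def)
  moreover have "\<forall>i\<in>insert b S. L $ i $ i \<in> \<real> \<and> 0 < Re (L $ i $ i)"
    using L'(2) c bS by (auto simp: L_def rb)
  moreover have "\<forall>i j. i \<notin> insert b S \<or> j \<notin> insert b S \<longrightarrow> L $ i $ j = 0"
    using L'(3) r0 by (auto simp: L_def)
  ultimately show ?case by blast
qed

lemma is_LL_factor_ex1:
  fixes M :: "complex^'m::{finite,wellorder}^'m::_"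
  assumes "pos_def M"
  shows "\<exists>!L. is_LL_factor M L"
proof -
  have "\<exists>L. is_LL_factor M L"
    using is_LL_factor_exists_on[of UNIV M] assms
    by (auto simp: pos_def_iff is_LL_factor_def pos_diag_def)
  then show ?thesis using is_LL_factor_unique by blast
qed

section \<open>The transfer function\<close>

locale stable_pair =
  fixes A :: "complex^'n^'n" and B :: "complex^'m::{finite,wellorder}^'n"
  assumes stable: "schur_stable A" and B_inj: "B *v x = 0 \<Longrightarrow> x = 0"
begin

abbreviation G where "G \<equiv> Gfun A B"

lemma
  assumes z: "z \<in> sphere 0 1"
  shows invertible_shift: "invertible (mat z - A)"
    and G_resolvent: "G z = mat (cnj z) ** (resolvent A (cnj z) ** B)"
proof -
  have "(mat z - A) ** (mat (cnj z) ** resolvent A (cnj z))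
      = mat (z * cnj z) ** resolvent A (cnj z) - mat (cnj z) ** (A ** resolvent A (cnj z))"
    unfolding matrix_mult.diff_left mult_mat_left_commute[of A]
    by (simp add: matrix_mul_assoc mat_mult_mat)
  also have "\<dots> = mat 1"
    using z resolvent_left[OF stable, of "cnj z"] by (simp add: unit_mult_cnj)
  finally have *: "(mat z - A) ** (mat (cnj z) ** resolvent A (cnj z)) = mat 1" .
  from matrix_inv_eqI[OF this] show "invertible (mat z - A)" 
    "G z = mat (cnj z) ** (resolvent A (cnj z) ** B)"
    by (simp_all add: Gfun_def matrix_mul_assoc)
qed

text \<open>All facts about \<open>G\<close> are drawn from this state equation.\<close>

lemma G_recurrence: "z \<in> sphere 0 1 \<Longrightarrow> mat z ** G z = A ** G z + B"
proof -
  assume z: "z \<in> sphere 0 1"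
  have "(mat z - A) ** G z = B"
    using matrix_inv_mult(1)[OF invertible_shift[OF z]] by (simp add: Gfun_def matrix_mul_assoc)
  then show ?thesis by (simp add: matrix_ring algebra_simps)
qed

lemma continuous_on_G [continuous_intros]: "continuous_on (sphere 0 1) G"
  unfolding Gfun_def by (intro continuous_intros invertible_shift)

lemma continuous_on_G_compose [continuous_intros]:
  "continuous_on S f \<Longrightarrow> (\<And>x. x \<in> S \<Longrightarrow> f x \<in> sphere 0 1) \<Longrightarrow> continuous_on S (\<lambda>x. G (f x))"
  by (rule continuous_on_compose2[OF continuous_on_G]) auto

lemma G_inj: "z \<in> sphere 0 1 \<Longrightarrow> G z *v x = 0 \<Longrightarrow> x = 0"
proof -
  assume z: "z \<in> sphere 0 1" and x: "G z *v x = 0"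
  have "B *v x = (mat z - A) ** matrix_inv (mat z - A) *v (B *v x)"
    using matrix_inv_mult(1)[OF invertible_shift[OF z]] by simp
  also have "\<dots> = (mat z - A) *v (G z *v x)"
    by (simp add: Gfun_def matrix_vector_mul_assoc matrix_mul_assoc)
  finally have "B *v x = 0" using x by simp
  then show "x = 0" by (rule B_inj)
qed

section \<open>The closed-loop system of a parameter\<close>

text \<open>\<open>gain C\<close> is \<open>D\<close> and \<open>closed_loop C\<close> is \<open>K\<close> in the notation of the introduction; \<open>H C\<close> is
  \<open>G (CG)\<^sup>-\<^sup>1\<close>, in the form that shows its analyticity outside the disc.\<close>

definition gain where
  "gain C = B ** matrix_inv (C ** B)"

definition closed_loop where
  "closed_loop C = A - gain C ** C ** A"

definition H where
  "H C z = resolvent (closed_loop C) (cnj z) ** gain C"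

lemma C_plus_iff: "C \<in> C_plus A B \<longleftrightarrow>
    lower_triangular (C ** B) \<and> pos_diag (C ** B) \<and> schur_stable (closed_loop C)"
  by (simp add: C_plus_def closed_loop_def gain_def)

lemma C_plus_subset_C_space: "C_plus A B \<subseteq> C_space B"
  by (auto simp: C_plus_def C_space_def real_diag_def pos_diag_def)

context
  fixes C assumes C: "C \<in> C_plus A B"
begin

lemma invertible_CB: "invertible (C ** B)"
  using C invertible_lower_triangular pos_diag_nz unfolding C_plus_iff by blast

lemma gain_CB: "gain C ** (C ** B) = B"
  using invertible_CB by (simp add: gain_def matrix_inv_mult flip: matrix_mul_assoc)

lemma C_gain: "C ** gain C = mat 1"
  using invertible_CB by (simp add: gain_def matrix_inv_mult matrix_mul_assoc)

lemma C_closed_loop: "C ** closed_loop C = 0"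
  by (simp add: closed_loop_def matrix_ring C_gain)

lemma stable_closed_loop: "schur_stable (closed_loop C)"
  using C by (simp add: C_plus_iff)

lemma continuous_on_H [continuous_intros]: "continuous_on (sphere 0 1) (H C)"
  unfolding H_def by (intro continuous_intros continuous_on_resolvent_circle stable_closed_loop)

lemma H_recurrence: "z \<in> sphere 0 1 \<Longrightarrow> mat (cnj z) ** (closed_loop C ** H C z) = H C z - gain C"
  using resolvent_left[OF stable_closed_loop, of "cnj z"]
  by (simp add: H_def matrix_mul_assoc) (metis matrix_mul_assoc matrix_mul_lid matrix_mult.diff_left)

lemma C_H: "z \<in> sphere 0 1 \<Longrightarrow> C ** H C z = mat 1"
proof -
  assume "z \<in> sphere 0 1"
  then have "C ** H C z = C ** (gain C + mat (cnj z) ** (closed_loop C ** H C z))"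
    by (simp add: H_recurrence)
  also have "\<dots> = mat 1 + mat (cnj z) ** ((C ** closed_loop C) ** H C z)"
    by (simp add: matrix_ring C_gain) (metis mat_mult_commute)
  finally show ?thesis by (simp add: C_closed_loop)
qed

lemma
  assumes z: "z \<in> sphere 0 1"
  shows invertible_CG: "invertible (C ** G z)" and H_CG: "H C z ** (C ** G z) = G z"
proof -
  let ?Q = "C ** G z" and ?R = "resolvent (closed_loop C) (cnj z)"
  have "mat z ** (gain C ** ?Q) = gain C ** C ** (mat z ** G z)"
    by (metis mat_mult_commute matrix_mul_assoc)
  also have "\<dots> = gain C ** C ** A ** G z + B"
    by (simp add: G_recurrence[OF z] matrix_mult.add_right matrix_mul_assoc)
      (simp add: gain_CB flip: matrix_mul_assoc)
  finally have "mat z ** G z - closed_loop C ** G z = mat z ** (gain C ** ?Q)"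
    by (simp add: G_recurrence[OF z] closed_loop_def matrix_ring)
  then have "mat (cnj z) ** (mat z ** G z - closed_loop C ** G z) = mat (cnj z) ** (mat z ** (gain C ** ?Q))"
    by simp
  then have *: "(mat 1 - mat (cnj z) ** closed_loop C) ** G z = gain C ** ?Q"
    using unit_mult_cnj[OF z] by (simp add: matrix_ring mat_mult_mat mult.commute)
  have "invertible (mat 1 - mat (cnj z) ** closed_loop C)"
    using stable_closed_loop z by (simp add: schur_stable_iff)
  then have "?R ** (mat 1 - mat (cnj z) ** closed_loop C) = mat 1"
    by (simp add: resolvent_def matrix_inv_mult)
  then have "G z = ?R ** ((mat 1 - mat (cnj z) ** closed_loop C) ** G z)"
    by (simp add: matrix_mul_assoc)
  also have "\<dots> = H C z ** ?Q"
    by (simp add: * H_def matrix_mul_assoc)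
  finally show "H C z ** (C ** G z) = G z" by simp
  then show "invertible (C ** G z)"
    unfolding invertible_iff_ker
    by (metis G_inj z matrix_vector_mul_assoc matrix_vector_mult_0_right)
qed

lemma
  assumes z: "z \<in> sphere 0 1"
  shows invertible_gram: "invertible (adj (G z) ** adj C ** C ** G z)"
    and Winv_eq: "Winv A B C z = matrix_inv (C ** G z) ** adj (matrix_inv (C ** G z))"
    and Winv_hermitian: "adj (Winv A B C z) = Winv A B C z"
    and G_Winv_G: "G z ** Winv A B C z ** adj (G z) = H C z ** adj (H C z)"
proof -
  let ?Q = "C ** G z"
  note inv = invertible_CG[OF z]
  have gram: "adj (G z) ** adj C ** C ** G z = adj ?Q ** ?Q"
    by (simp add: adj_mult matrix_mul_assoc)
  show "invertible (adj (G z) ** adj C ** C ** G z)"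
    unfolding gram by (intro invertible_mult invertible_adj inv)
  show W: "Winv A B C z = matrix_inv ?Q ** adj (matrix_inv ?Q)"
    unfolding Winv_def gram by (simp add: matrix_inv_matrix_mult matrix_inv_adj invertible_adj inv)
  show "adj (Winv A B C z) = Winv A B C z"
    by (simp add: W adj_mult)
  have "G z ** matrix_inv ?Q = H C z"
    by (metis H_CG z inv matrix_inv_mult(1) matrix_mul_assoc matrix_mul_rid)
  then show "G z ** Winv A B C z ** adj (G z) = H C z ** adj (H C z)"
    by (metis W adj_mult matrix_mul_assoc)
qed

lemma moment_H: "moment A B \<psi> C = circ_mean (\<lambda>z. \<psi> z *\<^sub>R (H C z ** adj (H C z)))"
  unfolding moment_def by (rule circ_mean_cong) (simp add: G_Winv_G)

lemma moment_d2_H: "moment_d2 A B \<psi> C V = - circ_mean (\<lambda>z. \<psi> z *\<^sub>R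
    (H C z ** (adj (H C z) ** (adj V ** C + adj C ** V) ** H C z) ** adj (H C z)))"
proof -
  have "G z ** Winv A B C z ** adj (G z) ** X ** G z ** Winv A B C z ** adj (G z)
      = H C z ** (adj (H C z) ** X ** H C z) ** adj (H C z)" if "z \<in> sphere 0 1" for z X
  proof -
    have "G z ** Winv A B C z ** adj (G z) ** X ** G z ** Winv A B C z ** adj (G z)
        = (G z ** Winv A B C z ** adj (G z)) ** X ** (G z ** Winv A B C z ** adj (G z))"
      by (simp add: matrix_mul_assoc)
    also have "\<dots> = H C z ** (adj (H C z) ** X ** H C z) ** adj (H C z)"
      unfolding G_Winv_G[OF that] by (simp add: matrix_mul_assoc)
    finally show ?thesis .
  qed
  then show ?thesis
    unfolding moment_d2_def by (intro arg_cong[where f=uminus] circ_mean_cong) simp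
qed

end

text \<open>Joint continuity in the parameter and the point of the circle, as needed for compactness arguments.\<close>

lemma continuous_on_Winv:
  "continuous_on (C_plus A B \<times> sphere 0 1) (\<lambda>p. Winv A B (fst p) (snd p))"
  unfolding Winv_def by (intro continuous_intros invertible_gram) auto

lemma continuous_on_Winv_compose [continuous_intros]:
  assumes "continuous_on S f" "continuous_on S g"
    "\<And>x. x \<in> S \<Longrightarrow> f x \<in> C_plus A B" "\<And>x. x \<in> S \<Longrightarrow> g x \<in> sphere 0 1"
  shows "continuous_on S (\<lambda>x. Winv A B (f x) (g x))"
  using continuous_on_compose2[OF continuous_on_Winv continuous_on_Pair[OF assms(1,2)]] assms(3,4)
  by (simp add: image_subset_iff)

section \<open>The range of the moment operator\<close>

lemma Gamma_integrand_continuous: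
  "\<Phi> \<in> C_herm \<Longrightarrow> continuous_on (sphere 0 1) (\<lambda>z. G z ** \<Phi> z ** adj (G z))"
  by (auto simp: C_herm_def intro!: continuous_intros)

lemma subspace_range_Gamma: "subspace (range_Gamma A B)"
proof (rule subspaceI)
  have "Gamma_map A B (\<lambda>z. 0) = 0"
    by (simp add: Gamma_map_def circ_mean_const)
  moreover have "(\<lambda>z. 0) \<in> C_herm" by (simp add: C_herm_def hermitian_def)
  ultimately show "0 \<in> range_Gamma A B"
    unfolding range_Gamma_def by (metis imageI)
next
  fix x y assume "x \<in> range_Gamma A B" "y \<in> range_Gamma A B"
  then obtain \<Phi> \<Xi> where *: "\<Phi> \<in> C_herm" "x = Gamma_map A B \<Phi>" "\<Xi> \<in> C_herm" "y = Gamma_map A B \<Xi>"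
    unfolding range_Gamma_def by blast
  then have "x + y = Gamma_map A B (\<lambda>z. \<Phi> z + \<Xi> z)"
    using circ_mean_add[OF Gamma_integrand_continuous Gamma_integrand_continuous, of \<Phi> \<Xi>]
    by (simp add: Gamma_map_def matrix_ring)
  moreover have "(\<lambda>z. \<Phi> z + \<Xi> z) \<in> C_herm"
    using * by (auto simp: C_herm_def hermitian_def adj_add intro!: continuous_intros)
  ultimately show "x + y \<in> range_Gamma A B"
    unfolding range_Gamma_def by blast
next
  fix c x assume "x \<in> range_Gamma A B"
  then obtain \<Phi> where *: "\<Phi> \<in> C_herm" "x = Gamma_map A B \<Phi>"
    unfolding range_Gamma_def by blast
  then have "c *\<^sub>R x = Gamma_map A B (\<lambda>z. c *\<^sub>R \<Phi> z)"
    using circ_mean_linear[OF bounded_linear_scaleR_right Gamma_integrand_continuous, of \<Phi> c]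
    by (simp add: Gamma_map_def matrix_ring)
  moreover have "(\<lambda>z. c *\<^sub>R \<Phi> z) \<in> C_herm"
    using * by (auto simp: C_herm_def hermitian_def adj_scaleR intro!: continuous_intros)
  ultimately show "c *\<^sub>R x \<in> range_Gamma A B"
    unfolding range_Gamma_def by blast
qed

lemma range_Gamma_hermitian: "X \<in> range_Gamma A B \<Longrightarrow> adj X = X"
proof -
  assume "X \<in> range_Gamma A B"
  then obtain \<Phi> where \<Phi>: "\<Phi> \<in> C_herm" "X = Gamma_map A B \<Phi>"
    unfolding range_Gamma_def by blast
  have "adj X = circ_mean (\<lambda>z. adj (G z ** \<Phi> z ** adj (G z)))"
    unfolding \<Phi>(2) Gamma_map_def
    by (rule circ_mean_linear[OF bounded_linear_adj Gamma_integrand_continuous[OF \<Phi>(1)], symmetric])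
  also have "\<dots> = X"
    unfolding \<Phi>(2) Gamma_map_def using \<Phi>(1)
    by (intro circ_mean_cong) (simp add: adj_mult matrix_mul_assoc C_herm_def hermitian_def)
  finally show ?thesis .
qed

lemma subspace_C_space: "subspace (C_space B)"
  by (rule subspaceI)
     (auto simp: C_space_def lower_triangular_def real_diag_def matrix_ring scaleR_conv_of_real[where 'a=complex])

lemma weighted_Winv_in_range:
  assumes "continuous_on (sphere 0 1) \<xi>" "C \<in> C_plus A B"
  shows "circ_mean (\<lambda>z. \<xi> z *\<^sub>R (G z ** Winv A B C z ** adj (G z))) \<in> range_Gamma A B"
proof -
  have "(\<lambda>z. \<xi> z *\<^sub>R Winv A B C z) \<in> C_herm"
    using assms by (auto simp: C_herm_def hermitian_def adj_scaleR Winv_hermitian intro!: continuous_intros)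
  then have "Gamma_map A B (\<lambda>z. \<xi> z *\<^sub>R Winv A B C z) \<in> range_Gamma A B"
    unfolding range_Gamma_def by blast
  then show ?thesis by (simp add: Gamma_map_def matrix_ring)
qed

lemma moment_in_range:
  "continuous_on (sphere 0 1) \<psi> \<Longrightarrow> C \<in> C_plus A B \<Longrightarrow> moment A B \<psi> C \<in> range_Gamma A B"
  unfolding moment_def by (rule weighted_Winv_in_range)

lemma moment_d1_in_range:
  "continuous_on (sphere 0 1) \<xi> \<Longrightarrow> C \<in> C_plus A B \<Longrightarrow> moment_d1 A B \<psi> C \<xi> \<in> range_Gamma A B"
  unfolding moment_d1_def by (rule weighted_Winv_in_range)

lemma moment_d2_in_range:
  assumes "continuous_on (sphere 0 1) \<psi>" "C \<in> C_plus A B"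
  shows "moment_d2 A B \<psi> C V \<in> range_Gamma A B"
proof -
  let ?\<Phi> = "\<lambda>z. \<psi> z *\<^sub>R (Winv A B C z ** adj (G z) ** (adj V ** C + adj C ** V) ** G z ** Winv A B C z)"
  have "?\<Phi> \<in> C_herm"
    using assms by (auto simp: C_herm_def hermitian_def adj_scaleR adj_mult adj_add Winv_hermitian
        matrix_mul_assoc add.commute intro!: continuous_intros)
  then have "Gamma_map A B ?\<Phi> \<in> range_Gamma A B"
    unfolding range_Gamma_def by blast
  also have "Gamma_map A B ?\<Phi> = - moment_d2 A B \<psi> C V"
    by (simp add: Gamma_map_def moment_d2_def matrix_mult.scaleR_left matrix_mult.scaleR_right matrix_mul_assoc)
  finally show ?thesis
    using subspace_neg[OF subspace_range_Gamma] by force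
qed

section \<open>Invertibility of the partial derivative\<close>

lemma linear_moment_d2:
  assumes "continuous_on (sphere 0 1) \<psi>" "C \<in> C_plus A B"
  shows "linear (moment_d2 A B \<psi> C)"
proof -
  have c: "continuous_on (sphere 0 1) (\<lambda>z. \<psi> z *\<^sub>R
         (G z ** Winv A B C z ** adj (G z) ** (adj V ** C + adj C ** V) **
          G z ** Winv A B C z ** adj (G z)))" for V
    using assms by (auto intro!: continuous_intros)
  show ?thesis
  proof (rule linearI)
    show "moment_d2 A B \<psi> C (V + V') = moment_d2 A B \<psi> C V + moment_d2 A B \<psi> C V'" for V V'
      unfolding moment_d2_def minus_add_distrib[symmetric] circ_mean_add[OF c c, symmetric]
      by (intro arg_cong[where f=uminus] circ_mean_cong)
        (simp only: adj_add matrix_mult.add_left matrix_mult.add_right scaleR_add_right add_ac)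
    show "moment_d2 A B \<psi> C (r *\<^sub>R V) = r *\<^sub>R moment_d2 A B \<psi> C V" for r V
      unfolding moment_d2_def scaleR_minus_right
        circ_mean_linear[OF bounded_linear_scaleR_right c, symmetric]
      by (simp add: adj_scaleR matrix_ring scaleR_add_right[symmetric] mult.commute)
  qed
qed

lemma inner_moment_d2:
  assumes "continuous_on (sphere 0 1) \<psi>" "C \<in> C_plus A B"
  shows "inner \<Lambda> (moment_d2 A B \<psi> C V) = - circ_mean (\<lambda>z. \<psi> z *
    inner (adj (H C z) ** \<Lambda> ** H C z) (adj (H C z) ** (adj V ** C + adj C ** V) ** H C z))"
proof -
  have "continuous_on (sphere 0 1) (\<lambda>z. \<psi> z *\<^sub>R
    (H C z ** (adj (H C z) ** (adj V ** C + adj C ** V) ** H C z) ** adj (H C z)))"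
    using assms by (auto intro!: continuous_intros)
  from circ_mean_linear[OF bounded_linear_inner_right this, of \<Lambda>] show ?thesis
    using assms(2) by (simp add: moment_d2_H inner_sandwich)
qed

text \<open>The derivative is a weighted Gram operator in the sandwiches by \<open>H\<close>. Only the values of
  \<open>H* (V* C + C* V) H\<close> on the circle matter, so \<open>\<Lambda>\<close> may be any matrix with the same sandwich.\<close>

lemma definite_moment_d2:
  assumes \<psi>: "\<psi> \<in> C_pos" and C: "C \<in> C_plus A B" and 0: "inner \<Lambda> (moment_d2 A B \<psi> C V) = 0"
    and eq: "\<And>z. z \<in> sphere 0 1 \<Longrightarrow>
      adj (H C z) ** (adj V ** C + adj C ** V) ** H C z = adj (H C z) ** \<Lambda> ** H C z"
    and z: "z \<in> sphere 0 1"
  shows "adj (H C z) ** \<Lambda> ** H C z = 0"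
proof -
  let ?F = "\<lambda>z. \<psi> z * inner (adj (H C z) ** \<Lambda> ** H C z) (adj (H C z) ** \<Lambda> ** H C z)"
  have \<psi>c: "continuous_on (sphere 0 1) \<psi>" and \<psi>p: "\<And>z. z \<in> sphere 0 1 \<Longrightarrow> 0 < \<psi> z"
    using \<psi> by (auto simp: C_pos_def)
  have "circ_mean ?F = circ_mean (\<lambda>z. \<psi> z *
    inner (adj (H C z) ** \<Lambda> ** H C z) (adj (H C z) ** (adj V ** C + adj C ** V) ** H C z))"
    by (rule circ_mean_cong) (simp add: eq)
  also have "\<dots> = 0"
    using 0 inner_moment_d2[OF \<psi>c C, of \<Lambda> V] by simp
  finally have "?F z = 0"
    using z \<psi>p
    by (intro circ_mean_nonneg_eq_0[of ?F]) (auto intro!: continuous_intros \<psi>c C simp: less_imp_le)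
  then show ?thesis using \<psi>p[OF z] by simp
qed

lemma sandwich_derivative:
  assumes "C \<in> C_plus A B" "z \<in> sphere 0 1"
  shows "adj (H C z) ** (adj V ** C + adj C ** V) ** H C z = V ** H C z + adj (V ** H C z)"
proof -
  have "adj (H C z) ** (adj V ** C + adj C ** V) ** H C z
      = adj (V ** H C z) ** (C ** H C z) + adj (C ** H C z) ** (V ** H C z)"
    by (simp add: adj_mult matrix_ring)
  then show ?thesis unfolding C_H[OF assms] by (simp add: add.commute)
qed

end

text \<open>By the mean value property applied to \<open>f\<close> and to \<open>trace (f f)\<close>, and by skewness, the mean of \<open>|f|\<^sup>2\<close> is
  \<open>|f(0)|\<^sup>2\<close> and the mean of \<open>f\<close> is \<open>f(0)\<close>. So \<open>f - f(0)\<close> has mean square zero.\<close>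

lemma analytic_skew_const:
  fixes f :: "complex \<Rightarrow> complex^'m^'m"
  assumes c: "continuous_on (cball 0 1) f" and h: "\<And>i j. (\<lambda>w. f w $ i $ j) holomorphic_on ball 0 1"
    and skew: "\<And>z. z \<in> sphere 0 1 \<Longrightarrow> f (cnj z) + adj (f (cnj z)) = 0"
  shows "f 0 + adj (f 0) = 0" "z \<in> sphere 0 1 \<Longrightarrow> f (cnj z) = f 0"
proof -
  note cc = continuous_on_circle_cnj[OF c]
  have mean: "circ_mean (\<lambda>z. f (cnj z)) = f 0"
    by (rule circ_mean_mean_value_matrix[OF c h])
  have "0 = circ_mean (\<lambda>z. f (cnj z) + adj (f (cnj z)))"
    using skew by (subst circ_mean_cong[of _ "\<lambda>z. 0"]) (simp_all add: circ_mean_const)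
  also have "\<dots> = f 0 + adj (f 0)"
    using circ_mean_linear[OF bounded_linear_adj cc]
    by (simp add: circ_mean_add cc continuous_intros mean)
  finally show skew0: "f 0 + adj (f 0) = 0" by simp
  define q where "q = (\<lambda>w. \<Sum>i\<in>UNIV. \<Sum>j\<in>UNIV. f w $ i $ j * f w $ j $ i)"
  have self: "inner X X = - Re (\<Sum>i\<in>UNIV. \<Sum>j\<in>UNIV. X $ i $ j * X $ j $ i)"
    if "X + adj X = 0" for X :: "complex^'m^'m"
  proof -
    have "cnj (X $ i $ j) = - X $ j $ i" for i j
      using that by (simp add: vec_eq_iff adj_def eq_neg_iff_add_eq_0 add.commute)
    then have "inner X X = Re (\<Sum>i\<in>UNIV. \<Sum>j\<in>UNIV. - (X $ i $ j * X $ j $ i))"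
      unfolding inner_matrix by (simp add: mult.commute)
    then show ?thesis by (simp only: sum_negf uminus_complex.sel)
  qed
  have "circ_mean (\<lambda>z. q (cnj z)) = q 0"
    unfolding q_def
    by (rule circ_mean_mean_value) (intro continuous_intros holomorphic_intros c h)+
  moreover have qc: "continuous_on (sphere 0 1) (\<lambda>z. q (cnj z))"
    unfolding q_def by (intro continuous_intros cc)
  ultimately have qmean: "circ_mean (\<lambda>z. - Re (q (cnj z))) = - Re (q 0)"
    using circ_mean_linear[OF bounded_linear_minus[OF bounded_linear_Re] qc] by simp
  have "circ_mean (\<lambda>z. inner (f (cnj z)) (f (cnj z))) = circ_mean (\<lambda>z. - Re (q (cnj z)))"
    by (rule circ_mean_cong) (simp add: self[OF skew] q_def)
  moreover have "inner (f 0) (f 0) = - Re (q 0)"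
    unfolding q_def by (rule self[OF skew0])
  ultimately have m1: "circ_mean (\<lambda>z. inner (f (cnj z)) (f (cnj z))) = inner (f 0) (f 0)"
    by (simp only: qmean)
  have m2: "circ_mean (\<lambda>z. 2 * inner (f 0) (f (cnj z))) = 2 * inner (f 0) (f 0)"
    using circ_mean_linear[OF bounded_linear_inner_right cc, of "2 *\<^sub>R f 0"] mean by simp
  let ?F = "\<lambda>z. inner (f (cnj z)) (f (cnj z)) - 2 * inner (f 0) (f (cnj z)) + inner (f 0) (f 0)"
  have F: "?F z = (norm (f (cnj z) - f 0))\<^sup>2" for z
    by (simp add: power2_norm_eq_inner inner_diff inner_commute)
  assume z: "z \<in> sphere 0 1"
  have "?F z = 0"
  proof (rule circ_mean_nonneg_eq_0[of ?F, OF _ _ _ z])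
    show "continuous_on (sphere 0 1) ?F" by (intro continuous_intros cc)
    show "0 \<le> ?F z" for z unfolding F by simp
    show "circ_mean ?F = 0"
      by (simp add: circ_mean_add circ_mean_diff continuous_intros cc m1 m2 circ_mean_const)
  qed
  then show "f (cnj z) = f 0" unfolding F by simp
qed

locale reachable_pair = stable_pair A B
  for A :: "complex^'n^'n" and B :: "complex^'m::{finite,wellorder}^'n" +
  assumes reach: "reachable A B"
begin

text \<open>Up to the unimodular factor \<open>z\<close>, \<open>G\<close> is \<open>(I - A/z)\<^sup>-\<^sup>1 B\<close>, whose mean is \<open>B\<close>.\<close>

lemma annihilator_B:
  fixes V :: "complex^'n^'k"
  assumes V: "\<And>z. z \<in> sphere 0 1 \<Longrightarrow> V ** G z = 0"
  shows "V ** B = 0"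
proof -
  have "V ** resolvent A (cnj z) ** B = 0" if z: "z \<in> sphere 0 1" for z
  proof -
    have "V ** G z = mat (cnj z) ** (V ** resolvent A (cnj z) ** B)"
      unfolding G_resolvent[OF z] by (metis mat_mult_commute matrix_mul_assoc)
    then have "mat z ** (mat (cnj z) ** (V ** resolvent A (cnj z) ** B)) = 0"
      using V z by simp
    then show ?thesis
      using unit_mult_cnj[OF z] by (simp add: matrix_mul_assoc mat_mult_mat)
  qed
  then have "circ_mean (\<lambda>z. V ** resolvent A (cnj z) ** B) = circ_mean (\<lambda>z. 0)"
    by (rule circ_mean_cong)
  then show ?thesis
    by (simp add: circ_mean_const circ_mean_resolvent[OF stable]
        circ_mean_mult[OF continuous_on_resolvent_circle[OF stable]])
qed

text \<open>If \<open>V G = 0\<close> on the circle, the state equation gives \<open>V A G = - V B\<close>, which vanishes as well; so \<open>V A\<close>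
  inherits the hypothesis.\<close>

lemma annihilator_powers:
  fixes V :: "complex^'n^'k"
  assumes V: "\<And>z. z \<in> sphere 0 1 \<Longrightarrow> V ** G z = 0"
  shows "V ** (((**) A) ^^ k) B = 0"
  using V
proof (induction k arbitrary: V)
  case 0
  show ?case by simp (rule annihilator_B, rule 0)
next
  case (Suc k)
  have "V ** A ** G z = 0" if z: "z \<in> sphere 0 1" for z
  proof -
    have "V ** A ** G z = mat z ** (V ** G z) - V ** B"
      unfolding mult_mat_left_commute[symmetric] G_recurrence[OF z]
      by (simp add: matrix_mult.add_right matrix_mul_assoc)
    then show ?thesis using Suc.prems[OF z] annihilator_B[OF Suc.prems] by simp
  qed
  from Suc.IH[OF this] show ?case by (simp add: matrix_mul_assoc)
qed

lemma annihilator_G: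
  fixes V :: "complex^'n^'k"
  assumes V: "\<And>z. z \<in> sphere 0 1 \<Longrightarrow> V ** G z = 0"
  shows "V = 0"
proof -
  have "x \<in> {x. V *v x = 0}" for x
  proof -
    have "vec.span (\<Union>k<CARD('n). columns ((((**) A) ^^ k) B)) \<subseteq> {x. V *v x = 0}"
    proof (rule vec.span_minimal)
      show "vec.subspace {x. V *v x = 0}"
        by (rule vec.subspaceI) (simp_all add: vec.add vec.scale matrix_vector_right_distrib vector_scalar_commute)
      have "V *v column j M = column j (V ** M)" for j and M :: "complex^'m::_^'n"
        by (simp add: vec_eq_iff matrix_vector_mult_def matrix_matrix_mult_def column_def)
      then show "(\<Union>k<CARD('n). columns ((((**) A) ^^ k) B)) \<subseteq> {x. V *v x = 0}"
        using annihilator_powers[OF V] by (auto simp: columns_def) (simp add: column_def vec_eq_iff)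
    qed
    then show ?thesis using reach unfolding reachable_def by blast
  qed
  then show ?thesis by (simp add: matrix_eq)
qed

lemma inj_moment_d2:
  assumes \<psi>: "\<psi> \<in> C_pos" and C: "C \<in> C_plus A B" and V: "V \<in> C_space B"
    and 0: "moment_d2 A B \<psi> C V = 0"
  shows "V = 0"
proof -
  let ?N = "adj V ** C + adj C ** V"
  define f where "f = (\<lambda>w. V ** resolvent (closed_loop C) w ** gain C)"
  have f: "f (cnj z) = V ** H C z" for z
    by (simp add: f_def H_def matrix_mul_assoc)
  have f0: "f 0 = V ** gain C" by (simp add: f_def)
  note K = stable_closed_loop[OF C]
  have cont: "continuous_on (cball 0 1) f"
    unfolding f_def by (intro continuous_intros continuous_on_resolvent K)
  have hol: "(\<lambda>w. f w $ i $ j) holomorphic_on ball 0 1" for i j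
    unfolding f_def matrix_matrix_mult_def
    by simp (intro holomorphic_intros holomorphic_resolvent K)
  have skew: "f (cnj z) + adj (f (cnj z)) = 0" if z: "z \<in> sphere 0 1" for z
  proof -
    have "adj (H C z) ** ?N ** H C z = 0"
      by (rule definite_moment_d2[OF \<psi> C _ _ z]) (simp_all add: 0)
    then show ?thesis using C z by (simp add: f sandwich_derivative)
  qed
  have const: "f 0 + adj (f 0) = 0" "z \<in> sphere 0 1 \<Longrightarrow> f (cnj z) = f 0" for z
    by (rule analytic_skew_const[OF cont hol skew], assumption+)+
  have "V ** gain C ** (C ** B) = V ** B"
    by (metis gain_CB[OF C] matrix_mul_assoc)
  then have "V ** gain C = 0"
    using const(1) V C
    by (intro lower_triangular_skew_eq_0[of "V ** gain C" "C ** B"])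
       (simp_all add: f0 C_space_def C_plus_iff)
  then have "V ** H C z = 0" if "z \<in> sphere 0 1" for z
    using const(2)[OF that] by (simp add: f f0)
  then have "V ** G z = 0" if "z \<in> sphere 0 1" for z
    by (metis C H_CG matrix_mul_assoc matrix_mult.zero_left that)
  then show "V = 0" by (rule annihilator_G)
qed

end

context stable_pair
begin

text \<open>An additive spectral factorisation, in closed form. Let \<open>P\<close> solve \<open>P - K* P K = \<Lambda>\<close>. Since
  \<open>(1/z) K H = H - D\<close>, the terms in \<open>H* P H\<close> cancel in \<open>H* \<Lambda> H\<close> and leave \<open>D* P H + H* P D - D* P D\<close>. The
  constant \<open>D* P D\<close> is split as \<open>E + E*\<close>, and \<open>C H = I\<close> absorbs \<open>E*\<close> into \<open>V = D* P - E* C\<close>. Taking \<open>E\<close>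
  lower triangular with real diagonal is what places \<open>V\<close> in the parameter space, because \<open>V B = E C B\<close>.\<close>

lemma hermitian_sandwich_factor:
  assumes C: "C \<in> C_plus A B" and \<Lambda>: "adj \<Lambda> = \<Lambda>"
  obtains V where "V \<in> C_space B"
    "\<And>z. z \<in> sphere 0 1 \<Longrightarrow> adj (H C z) ** \<Lambda> ** H C z = V ** H C z + adj (V ** H C z)"
proof -
  let ?K = "closed_loop C" and ?D = "gain C"
  note K = stable_closed_loop[OF C]
  define P where "P = circ_mean (\<lambda>z. adj (resolvent ?K (cnj z)) ** \<Lambda> ** resolvent ?K (cnj z))"
  have lyap: "P - adj ?K ** P ** ?K = \<Lambda>"
    unfolding P_def by (rule lyapunov_solution[OF K])
  have P: "adj P = P"
    unfolding P_def
    by (subst circ_mean_linear[OF bounded_linear_adj, symmetric])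
       (auto intro!: continuous_intros continuous_on_resolvent_circle[OF K] simp: adj_mult \<Lambda> matrix_mul_assoc)
  define F where "F = adj ?D ** P ** ?D"
  have F: "cnj (F $ j $ i) = F $ i $ j" for i j
  proof -
    have "adj F = F" by (simp add: F_def adj_mult P matrix_mul_assoc)
    from arg_cong[OF this, of "\<lambda>M. M $ i $ j"] show ?thesis by (simp add: adj_def)
  qed
  define E where "E = (\<chi> i j. if j < i then F $ i $ j else if i = j then F $ i $ i / 2 else 0)"
  have E: "lower_triangular E" "real_diag E"
    using F by (auto simp: lower_triangular_def real_diag_def E_def Reals_cnj_iff)
  have EF: "E + adj E = F"
    by (auto simp: vec_eq_iff E_def adj_def F not_less)
  define V where "V = adj ?D ** P - adj E ** C"
  show ?thesis
  proof (rule that[of V])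
    have "V ** B = adj ?D ** P ** (?D ** (C ** B)) - adj E ** (C ** B)"
      unfolding gain_CB[OF C] by (simp add: V_def matrix_ring)
    also have "\<dots> = (F - adj E) ** (C ** B)"
      by (simp add: F_def matrix_ring)
    also have "F - adj E = E" by (simp flip: EF)
    finally have VB: "V ** B = E ** (C ** B)" .
    have CB: "lower_triangular (C ** B)" "pos_diag (C ** B)"
      using C by (auto simp: C_plus_iff)
    show "V \<in> C_space B"
      unfolding C_space_def mem_Collect_eq VB
      using E CB by (auto simp: lower_triangular_mult real_diag_def lower_triangular_mult_diag pos_diag_def)
    fix z :: complex assume z: "z \<in> sphere 0 1"
    have "adj (H C z) ** \<Lambda> ** H C z = adj (H C z) ** P ** H C z - adj (?K ** H C z) ** P ** (?K ** H C z)"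
      by (simp add: lyap[symmetric] matrix_ring adj_mult)
    also have "adj (?K ** H C z) ** P ** (?K ** H C z)
        = adj (mat (cnj z) ** (?K ** H C z)) ** P ** (mat (cnj z) ** (?K ** H C z))"
      using z by (subst unit_conj_cancel') auto
    also have "\<dots> = adj (H C z - ?D) ** P ** (H C z - ?D)"
      by (simp add: H_recurrence[OF C z])
    finally have "adj (H C z) ** \<Lambda> ** H C z = adj ?D ** P ** H C z + adj (H C z) ** P ** ?D - F"
      by (simp add: matrix_ring adj_diff F_def algebra_simps)
    moreover have "V ** H C z = adj ?D ** P ** H C z - adj E"
      using C_H[OF C z] by (simp add: V_def matrix_mult.diff_left flip: matrix_mul_assoc)
    then have "adj (V ** H C z) = adj (H C z) ** P ** ?D - E"
      by (simp add: adj_diff adj_mult P matrix_mul_assoc)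
    ultimately show "adj (H C z) ** \<Lambda> ** H C z = V ** H C z + adj (V ** H C z)"
      using \<open>V ** H C z = adj ?D ** P ** H C z - adj E\<close> by (simp flip: EF)
  qed
qed

text \<open>A \<open>\<Lambda>\<close> with vanishing sandwich by \<open>H\<close>, hence by \<open>G\<close>, is orthogonal to the range, to which it belongs.\<close>

lemma range_Gamma_orthogonal:
  assumes C: "C \<in> C_plus A B" and \<Lambda>: "\<Lambda> \<in> range_Gamma A B"
    and 0: "\<And>z. z \<in> sphere 0 1 \<Longrightarrow> adj (H C z) ** \<Lambda> ** H C z = 0"
  shows "\<Lambda> = 0"
proof -
  obtain \<Phi> where \<Phi>: "\<Phi> \<in> C_herm" "\<Lambda> = Gamma_map A B \<Phi>"
    using \<Lambda> unfolding range_Gamma_def by blast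
  have "inner \<Lambda> (G z ** \<Phi> z ** adj (G z)) = 0" if z: "z \<in> sphere 0 1" for z
  proof -
    have "adj (G z) ** \<Lambda> ** G z = adj (C ** G z) ** (adj (H C z) ** \<Lambda> ** H C z) ** (C ** G z)"
      using H_CG[OF C z] by (metis adj_mult matrix_mul_assoc)
    then show ?thesis by (simp add: inner_sandwich 0[OF z])
  qed
  then have "circ_mean (\<lambda>z. inner \<Lambda> (G z ** \<Phi> z ** adj (G z))) = circ_mean (\<lambda>z. 0)"
    by (intro circ_mean_cong) simp
  then have "inner \<Lambda> (Gamma_map A B \<Phi>) = 0"
    using circ_mean_linear[OF bounded_linear_inner_right Gamma_integrand_continuous[OF \<Phi>(1)], of \<Lambda>]
    by (simp add: Gamma_map_def circ_mean_const)
  then show ?thesis using \<Phi>(2) by simp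
qed

text \<open>The image is a subspace of the range. An element of the range orthogonal to it would, through the \<open>V\<close>
  of the factorisation above, have a vanishing sandwich, and so be zero.\<close>

lemma surj_moment_d2:
  assumes \<psi>: "\<psi> \<in> C_pos" and C: "C \<in> C_plus A B"
  shows "moment_d2 A B \<psi> C ` C_space B = range_Gamma A B"
proof -
  let ?J = "moment_d2 A B \<psi> C"
  have \<psi>c: "continuous_on (sphere 0 1) \<psi>" using \<psi> by (simp add: C_pos_def)
  have sub: "subspace (?J ` C_space B)"
    by (intro linear_subspace_image linear_moment_d2 \<psi>c C subspace_C_space)
  have le: "?J ` C_space B \<subseteq> range_Gamma A B"
    using moment_d2_in_range[OF \<psi>c C] by blast
  show ?thesis
  proof (rule ccontr)
    assume "?J ` C_space B \<noteq> range_Gamma A B"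
    then have "span (?J ` C_space B) \<subset> span (range_Gamma A B)"
      using le sub subspace_range_Gamma by (simp add: span_eq_iff[THEN iffD2] psubset_eq)
    then obtain \<Lambda> where \<Lambda>: "\<Lambda> \<noteq> 0" "\<Lambda> \<in> span (range_Gamma A B)"
      "\<And>y. y \<in> span (?J ` C_space B) \<Longrightarrow> orthogonal \<Lambda> y"
      using orthogonal_to_subspace_exists_gen by metis
    have \<Lambda>r: "\<Lambda> \<in> range_Gamma A B"
      using \<Lambda>(2) subspace_range_Gamma by (metis span_eq_iff)
    obtain V where V: "V \<in> C_space B"
      "\<And>z. z \<in> sphere 0 1 \<Longrightarrow> adj (H C z) ** \<Lambda> ** H C z = V ** H C z + adj (V ** H C z)"
      using hermitian_sandwich_factor[OF C range_Gamma_hermitian[OF \<Lambda>r]] by blast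
    have "inner \<Lambda> (?J V) = 0"
      using \<Lambda>(3)[of "?J V"] V(1) by (simp add: orthogonal_def span_base)
    then have "adj (H C z) ** \<Lambda> ** H C z = 0" if "z \<in> sphere 0 1" for z
      using definite_moment_d2[OF \<psi> C, of \<Lambda> V z] that V(2) sandwich_derivative[OF C] by metis
    then have "\<Lambda> = 0" by (rule range_Gamma_orthogonal[OF C \<Lambda>r])
    with \<Lambda>(1) show False ..
  qed
qed

end

lemma (in reachable_pair) moment_d2_invertible:
  assumes \<psi>: "\<psi> \<in> C_pos" and C: "C \<in> C_plus A B"
  shows "d2_invertible A B \<psi> C"
  unfolding d2_invertible_def bij_betw_def
proof
  have \<psi>c: "continuous_on (sphere 0 1) \<psi>" using \<psi> by (simp add: C_pos_def)
  show "inj_on (moment_d2 A B \<psi> C) (C_space B)"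
    using linear_inj_on_iff_eq_0[OF linear_moment_d2[OF \<psi>c C] subspace_C_space]
      inj_moment_d2[OF \<psi> C] by blast
qed (rule surj_moment_d2[OF \<psi> C])

context stable_pair
begin

section \<open>The central solution\<close>

text \<open>The moment for the constant weight, which is the solution of the closed-loop Lyapunov equation.\<close>

definition gramian where "gramian C = circ_mean (\<lambda>z. H C z ** adj (H C z))"

lemma gramian_unique:
  assumes C: "C \<in> C_plus A B" and X: "X = closed_loop C ** X ** adj (closed_loop C) + gain C ** adj (gain C)"
  shows "gramian C = X"
proof -
  have "X - closed_loop C ** X ** adj (closed_loop C) = gain C ** adj (gain C)"
    using X by (metis add_diff_cancel_left')
  with lyapunov_reconstruct[OF stable_closed_loop[OF C], of X] show ?thesis
    by (simp add: gramian_def H_def adj_mult matrix_mul_assoc)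
qed

lemma gramian_lyapunov:
  assumes C: "C \<in> C_plus A B"
  shows "gramian C = closed_loop C ** gramian C ** adj (closed_loop C) + gain C ** adj (gain C)"
proof -
  obtain X where "X - closed_loop C ** X ** adj (closed_loop C) = gain C ** adj (gain C)"
    using lyapunov_solution[OF schur_stable_adj[OF stable_closed_loop[OF C]], unfolded adj_adj] ..
  then have X: "X = closed_loop C ** X ** adj (closed_loop C) + gain C ** adj (gain C)"
    by (simp add: algebra_simps)
  with gramian_unique[OF C X] show ?thesis by simp
qed

lemma moment_one: "C \<in> C_plus A B \<Longrightarrow> moment A B (\<lambda>z. 1) C = gramian C"
  by (simp add: moment_H gramian_def)

text \<open>If \<open>N B = 0\<close>, the state equation reads \<open>z N G = N A G\<close> on the circle, and \<open>|z| = 1\<close>. This is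
  how membership in the range of \<open>\<Gamma>\<close> enters.\<close>

lemma range_Gamma_displacement:
  assumes X: "X \<in> range_Gamma A B" and N: "N ** B = 0"
  shows "N ** X ** adj N = (N ** A) ** X ** adj (N ** A)"
proof -
  obtain \<Phi> where \<Phi>: "\<Phi> \<in> C_herm" "X = Gamma_map A B \<Phi>"
    using X unfolding range_Gamma_def by blast
  let ?F = "\<lambda>z. G z ** \<Phi> z ** adj (G z)"
  have eq: "N ** ?F z ** adj N = (N ** A) ** ?F z ** adj (N ** A)" if z: "z \<in> sphere 0 1" for z
  proof -
    have "mat z ** (N ** G z) = N ** A ** G z"
      unfolding mult_mat_left_commute[symmetric] G_recurrence[OF z] using N
      by (simp add: matrix_mult.add_right matrix_mul_assoc)
    moreover have "N ** ?F z ** adj N = (mat z ** (N ** G z)) ** \<Phi> z ** adj (mat z ** (N ** G z))"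
      using z by (subst unit_conj_cancel) (auto simp: adj_mult matrix_mul_assoc)
    ultimately show ?thesis by (simp add: adj_mult matrix_mul_assoc)
  qed
  note c = Gamma_integrand_continuous[OF \<Phi>(1)]
  have "N ** X ** adj N = circ_mean (\<lambda>z. N ** ?F z ** adj N)"
    unfolding \<Phi>(2) Gamma_map_def by (rule circ_mean_mult[OF c, symmetric])
  also have "\<dots> = circ_mean (\<lambda>z. (N ** A) ** ?F z ** adj (N ** A))"
    by (rule circ_mean_cong) (rule eq)
  also have "\<dots> = (N ** A) ** X ** adj (N ** A)"
    unfolding \<Phi>(2) Gamma_map_def by (rule circ_mean_mult[OF c])
  finally show ?thesis .
qed

text \<open>The initial parameter satisfies \<open>C B = L\<close> and \<open>C \<Sigma> = D*\<close>. So \<open>N = I - D C\<close> is the projection along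
  the columns of \<open>B\<close> that is self-adjoint with respect to \<open>\<Sigma>\<close>, and \<open>N \<Sigma> N* = \<Sigma> - D D*\<close>. On the other
  hand, the displacement identity gives \<open>N \<Sigma> N* = K \<Sigma> K*\<close>. Together these are the closed-loop
  Lyapunov equation for \<open>\<Sigma>\<close>, from which both stability and the value of the moment follow.\<close>

lemma
  assumes \<Sigma>: "\<Sigma> \<in> range_Gamma_pos A B"
  shows LL_factor_init: "\<exists>!L. is_LL_factor (adj B ** matrix_inv \<Sigma> ** B) L"
    and C_init_in_C_plus: "C_init B \<Sigma> \<in> C_plus A B"
    and moment_C_init: "moment A B (\<lambda>z. 1) (C_init B \<Sigma>) = \<Sigma>"
proof -
  have pd: "pos_def \<Sigma>" and range: "\<Sigma> \<in> range_Gamma A B"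
    using \<Sigma> by (auto simp: range_Gamma_pos_def)
  have inv: "invertible \<Sigma>" by (rule pos_def_invertible[OF pd])
  let ?M = "adj B ** matrix_inv \<Sigma> ** B"
  show ex1: "\<exists>!L. is_LL_factor ?M L"
    by (intro is_LL_factor_ex1 pos_def_congruence pos_def_matrix_inv pd B_inj)
  define L where "L = (THE L. is_LL_factor ?M L)"
  have "is_LL_factor ?M L"
    unfolding L_def by (rule theI'[OF ex1])
  then have L: "lower_triangular L" "pos_diag L" "?M = adj L ** L"
    by (auto simp: is_LL_factor_def)
  have invL: "invertible L"
    using L invertible_lower_triangular pos_diag_nz by blast
  let ?C = "C_init B \<Sigma>"
  have C: "?C = adj (matrix_inv L) ** adj B ** matrix_inv \<Sigma>"
    by (simp add: C_init_def L_def)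
  have CB: "?C ** B = L"
  proof -
    have "?C ** B = adj (matrix_inv L) ** (adj L ** L)"
      by (simp add: C matrix_mul_assoc flip: L(3))
    also have "\<dots> = adj (L ** matrix_inv L) ** L"
      by (simp add: adj_mult matrix_mul_assoc)
    finally show ?thesis using invL by (simp add: matrix_inv_mult)
  qed
  let ?D = "gain ?C"
  have D: "?D = B ** matrix_inv L" by (simp add: gain_def CB)
  have CD: "?C ** ?D = mat 1"
    using invL by (simp add: D CB matrix_mul_assoc matrix_inv_mult)
  have DB: "?D ** L = B"
    using invL by (simp add: D matrix_inv_mult flip: matrix_mul_assoc)
  have "adj ?D = adj (matrix_inv L) ** adj B" by (simp add: D adj_mult)
  then have CS: "?C ** \<Sigma> = adj ?D"
    using inv by simp (simp add: C matrix_inv_mult flip: matrix_mul_assoc)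
  have "adj \<Sigma> = \<Sigma>" using pd by (simp add: pos_def_iff hermitian_def)
  then have SC: "\<Sigma> ** adj ?C = ?D"
    by (metis CS adj_adj adj_mult)
  define N where "N = mat 1 - ?D ** ?C"
  have "N ** B = 0"
    by (simp add: N_def matrix_mult.diff_left CB DB flip: matrix_mul_assoc)
  from range_Gamma_displacement[OF range this]
  have disp: "N ** \<Sigma> ** adj N = closed_loop ?C ** \<Sigma> ** adj (closed_loop ?C)"
    by (simp add: N_def closed_loop_def matrix_mult.diff_left)
  have "N ** \<Sigma> = \<Sigma> - ?D ** adj ?D"
    by (simp add: N_def matrix_mult.diff_left CS flip: matrix_mul_assoc)
  then have "N ** \<Sigma> ** adj N = (\<Sigma> - ?D ** adj ?D) ** (mat 1 - adj ?C ** adj ?D)"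
    by (simp add: N_def adj_diff adj_mult)
  also have "\<dots> = \<Sigma> - ?D ** adj ?D - (\<Sigma> ** adj ?C) ** adj ?D + ?D ** adj (?C ** ?D) ** adj ?D"
    by (simp add: matrix_ring adj_mult algebra_simps)
  also have "\<dots> = \<Sigma> - ?D ** adj ?D"
    by (simp add: SC CD)
  finally have lyap: "\<Sigma> = closed_loop ?C ** \<Sigma> ** adj (closed_loop ?C) + ?D ** adj ?D"
    by (simp add: disp algebra_simps)
  have "schur_stable (closed_loop ?C)"
    by (rule schur_stable_of_lyapunov[OF stable _ lyap, where Y = "?C ** A"])
       (use pd in \<open>auto simp: pos_def_iff closed_loop_def matrix_mul_assoc\<close>)
  then show Cp: "?C \<in> C_plus A B"
    using L by (simp add: C_plus_iff CB)
  show "moment A B (\<lambda>z. 1) ?C = \<Sigma>"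
    using gramian_unique[OF Cp lyap] by (simp add: moment_one[OF Cp])
qed

section \<open>Compactness of the solution set\<close>

lemma continuous_on_weight [continuous_intros]:
  assumes "continuous_on (sphere 0 1) \<psi>" "continuous_on S f" "continuous_on S g"
    "\<And>x. x \<in> S \<Longrightarrow> g x \<in> sphere 0 1"
  shows "continuous_on S (\<lambda>x. psi_path \<psi> (f x) (g x))"
  unfolding psi_path_def
  by (intro continuous_intros assms continuous_on_compose2[OF assms(1,3)]) (use assms(4) in auto)

lemma psi_path_in_C_pos:
  assumes "\<psi> \<in> C_pos" "0 \<le> t" "t \<le> 1"
  shows "psi_path \<psi> t \<in> C_pos"
proof -
  have "continuous_on (sphere 0 1) \<psi>" using assms by (simp add: C_pos_def)
  moreover have "0 < (1 - t) * 1 + t * \<psi> z" if "z \<in> sphere 0 1" for z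
  proof (cases "t = 0")
    case False
    then have "0 < t * \<psi> z" using assms that by (simp add: C_pos_def)
    then show ?thesis using assms by simp
  qed simp
  ultimately show ?thesis
    by (auto simp: C_pos_def psi_path_def intro!: continuous_intros)
qed

lemma psi_path_bounds:
  assumes "\<psi> \<in> C_pos"
  obtains a b where "0 < a" "0 < b"
    "\<And>t z. 0 \<le> t \<Longrightarrow> t \<le> 1 \<Longrightarrow> z \<in> sphere 0 1 \<Longrightarrow> a \<le> psi_path \<psi> t z \<and> psi_path \<psi> t z \<le> b"
proof -
  have c: "continuous_on ({0..1} \<times> sphere 0 1) (\<lambda>x. psi_path \<psi> (fst x) (snd x))"
    using assms by (intro continuous_intros) (auto simp: C_pos_def)
  have k: "compact ({0..1::real} \<times> sphere (0::complex) 1)"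
    by (intro compact_Times) auto
  have ne: "{0..1::real} \<times> sphere (0::complex) 1 \<noteq> {}" by auto
  obtain p where p: "p \<in> {0..1} \<times> sphere 0 1"
    "\<And>x. x \<in> {0..1} \<times> sphere 0 1 \<Longrightarrow> psi_path \<psi> (fst p) (snd p) \<le> psi_path \<psi> (fst x) (snd x)"
    using continuous_attains_inf[OF k ne c] by blast
  obtain q where q: "q \<in> {0..1} \<times> sphere 0 1"
    "\<And>x. x \<in> {0..1} \<times> sphere 0 1 \<Longrightarrow> psi_path \<psi> (fst x) (snd x) \<le> psi_path \<psi> (fst q) (snd q)"
    using continuous_attains_sup[OF k ne c] by blast
  have pos: "0 < psi_path \<psi> (fst x) (snd x)" if "x \<in> {0..1} \<times> sphere 0 1" for x
    using psi_path_in_C_pos[OF assms, of "fst x"] that by (auto simp: C_pos_def)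
  show thesis
    using that[OF pos[OF p(1)] pos[OF q(1)]] p(2)[of "(_, _)"] q(2)[of "(_, _)"] by auto
qed

definition solutions where
  "solutions \<psi> \<Sigma> = {(t, C). t \<in> {0..1} \<and> C \<in> C_plus A B \<and> moment A B (psi_path \<psi> t) C = \<Sigma>}"

lemma continuous_on_moment:
  assumes "continuous_on (sphere 0 1) \<psi>"
  shows "continuous_on (UNIV \<times> C_plus A B) (\<lambda>p. moment A B (psi_path \<psi> (fst p)) (snd p))"
  unfolding moment_def
proof (rule continuous_on_circ_mean_param)
  show "continuous_on ((UNIV \<times> C_plus A B) \<times> sphere 0 1) (\<lambda>(p, z). psi_path \<psi> (fst p) z *\<^sub>R
      (G z ** Winv A B (snd p) z ** adj (G z)))"
    unfolding case_prod_unfold by (intro continuous_intros assms) auto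
qed

lemma continuous_on_moment_compose:
  assumes "continuous_on (sphere 0 1) \<psi>" "continuous_on S f" "continuous_on S g"
    "\<And>x. x \<in> S \<Longrightarrow> g x \<in> C_plus A B"
  shows "continuous_on S (\<lambda>x. moment A B (psi_path \<psi> (f x)) (g x))"
  using continuous_on_compose2[OF continuous_on_moment[OF assms(1)] continuous_on_Pair[OF assms(2,3)]] assms(4)
  by (simp add: image_subset_iff)

context
  fixes \<psi> :: "complex \<Rightarrow> real" and \<Sigma> a b C
  assumes \<psi>: "continuous_on (sphere 0 1) \<psi>" and \<Sigma>: "invertible \<Sigma>"
    and C: "C \<in> C_plus A B" and sol: "moment A B \<psi> C = \<Sigma>"
    and a: "0 < a" "\<And>z. z \<in> sphere 0 1 \<Longrightarrow> a \<le> \<psi> z" and b: "\<And>z. z \<in> sphere 0 1 \<Longrightarrow> \<psi> z \<le> b"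
begin

text \<open>The trace of the moment is the mean of \<open>\<psi> |H|\<^sup>2\<close>; this estimate controls all the others.\<close>

lemma mean_norm_H_square_le: "circ_mean (\<lambda>z. (norm (H C z))\<^sup>2) \<le> inner (mat 1) \<Sigma> / a"
proof -
  have i: "inner (mat 1) (X ** adj X) = (norm X)\<^sup>2" for X :: "complex^'x^'n"
    by (simp add: inner_mult_right power2_norm_eq_inner)
  note cH = continuous_on_H[OF C]
  have "a * circ_mean (\<lambda>z. (norm (H C z))\<^sup>2) = circ_mean (\<lambda>z. a * (norm (H C z))\<^sup>2)"
    by (rule circ_mean_linear[OF bounded_linear_mult_right, symmetric]) (intro continuous_intros cH)
  also have "\<dots> \<le> circ_mean (\<lambda>z. \<psi> z * (norm (H C z))\<^sup>2)"
    by (intro circ_mean_mono continuous_intros cH \<psi> mult_right_mono a) auto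
  also have "\<dots> = circ_mean (\<lambda>z. inner (mat 1) (\<psi> z *\<^sub>R (H C z ** adj (H C z))))"
    by (simp add: i)
  also have "\<dots> = inner (mat 1) \<Sigma>"
    unfolding sol[symmetric] moment_H[OF C]
    by (rule circ_mean_linear[OF bounded_linear_inner_right]) (intro continuous_intros \<psi> cH)
  finally show ?thesis using a(1) by (simp add: field_simps)
qed

lemma mean_norm_H_le: "circ_mean (\<lambda>z. norm (H C z)) \<le> (1 + inner (mat 1) \<Sigma> / a) / 2"
proof -
  note cH = continuous_on_H[OF C]
  have "circ_mean (\<lambda>z. norm (H C z)) \<le> circ_mean (\<lambda>z. 1 / 2 + (norm (H C z))\<^sup>2 / 2)"
  proof (intro circ_mean_mono continuous_intros cH)
    show "norm (H C z) \<le> 1 / 2 + (norm (H C z))\<^sup>2 / 2" for z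
      using sum_squares_bound[of "norm (H C z)" 1] by simp
  qed (auto simp: C)
  also have "\<dots> = 1 / 2 + circ_mean (\<lambda>z. (norm (H C z))\<^sup>2 / 2)"
    by (subst circ_mean_add) (auto simp: circ_mean_const intro!: continuous_intros cH)
  also have "circ_mean (\<lambda>z. (norm (H C z))\<^sup>2 / 2) = circ_mean (\<lambda>z. (norm (H C z))\<^sup>2) / 2"
    by (rule circ_mean_linear[OF bounded_linear_divide]) (intro continuous_intros cH)
  finally show ?thesis using mean_norm_H_square_le by simp
qed

text \<open>\<open>D\<close> is the mean of \<open>H\<close>.\<close>

lemma norm_gain_le: "norm (gain C) \<le> (1 + inner (mat 1) \<Sigma> / a) / 2"
proof -
  note K = stable_closed_loop[OF C] note cH = continuous_on_H[OF C]
  have "gain C = circ_mean (\<lambda>z. H C z)"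
    unfolding H_def
    using circ_mean_mult_right[OF continuous_on_resolvent_circle[OF K], of "gain C"]
    by (simp add: circ_mean_resolvent[OF K])
  also have "norm \<dots> \<le> circ_mean (\<lambda>z. norm (H C z))"
    by (rule norm_circ_mean_le_mean) (auto intro!: continuous_intros cH)
  finally show ?thesis using mean_norm_H_le by simp
qed

lemma norm_gramian_le: "norm (gramian C) \<le> inner (mat 1) \<Sigma> / a"
proof -
  have "norm (gramian C) \<le> circ_mean (\<lambda>z. (norm (H C z))\<^sup>2)"
    unfolding gramian_def
  proof (rule norm_circ_mean_le_mean)
    show "norm (H C z ** adj (H C z)) \<le> (norm (H C z))\<^sup>2" for z
      using norm_matrix_mult_le[of "H C z" "adj (H C z)"] by (simp add: power2_eq_square)
  qed (intro continuous_on_matrix_mult continuous_on_adj continuous_on_power continuous_on_norm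
    continuous_on_H[OF C])+
  then show ?thesis using mean_norm_H_square_le by simp
qed

text \<open>Multiplying the moment by \<open>C\<close> on the left and using \<open>C H = I\<close> gives \<open>C \<Sigma>\<close> as the mean of \<open>\<psi> H*\<close>,
  and \<open>\<Sigma>\<close> is invertible.\<close>

lemma norm_parameter_le:
  "norm C \<le> b * ((1 + inner (mat 1) \<Sigma> / a) / 2) * norm (matrix_inv \<Sigma>)"
proof -
  note cH = continuous_on_H[OF C]
  have pos: "0 < \<psi> z" if "z \<in> sphere 0 1" for z using a that by force
  have "C ** \<Sigma> = circ_mean (\<lambda>z. C ** (\<psi> z *\<^sub>R (H C z ** adj (H C z))))"
    unfolding sol[symmetric] moment_H[OF C]
    by (rule circ_mean_mult_left[symmetric]) (intro continuous_intros \<psi> cH)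
  also have "\<dots> = circ_mean (\<lambda>z. \<psi> z *\<^sub>R adj (H C z))"
    by (rule circ_mean_cong) (simp add: matrix_mult.scaleR_right matrix_mul_assoc C_H[OF C])
  finally have "norm (C ** \<Sigma>) \<le> circ_mean (\<lambda>z. b * norm (H C z))"
    using pos b
    by (simp, intro norm_circ_mean_le_mean)
       (auto intro!: continuous_intros cH \<psi> mult_right_mono simp: abs_of_pos)
  also have "\<dots> = b * circ_mean (\<lambda>z. norm (H C z))"
    by (rule circ_mean_linear[OF bounded_linear_mult_right]) (intro continuous_intros cH)
  also have "\<dots> \<le> b * ((1 + inner (mat 1) \<Sigma> / a) / 2)"
    using mean_norm_H_le a(1) a(2)[of 1] b[of 1] by (intro mult_left_mono) auto
  finally have "norm (C ** \<Sigma>) \<le> b * ((1 + inner (mat 1) \<Sigma> / a) / 2)" .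
  then have "norm (C ** \<Sigma>) * norm (matrix_inv \<Sigma>)
      \<le> b * ((1 + inner (mat 1) \<Sigma> / a) / 2) * norm (matrix_inv \<Sigma>)"
    by (rule mult_right_mono) simp
  moreover have "norm C \<le> norm (C ** \<Sigma>) * norm (matrix_inv \<Sigma>)"
    using norm_matrix_mult_le[of "C ** \<Sigma>" "matrix_inv \<Sigma>"] \<Sigma>
    by (simp add: matrix_inv_mult flip: matrix_mul_assoc)
  ultimately show ?thesis by linarith
qed

lemma moment_le_gramian: "inner w (\<Sigma> *v w) \<le> b * inner w (gramian C *v w)"
proof -
  note cH = continuous_on_H[OF C]
  note q = bounded_linear_quad[of w]
  have nn: "0 \<le> inner w ((H C z ** adj (H C z)) *v w)" for z
    by (simp add: inner_gram)
  have c: "continuous_on (sphere 0 1) (\<lambda>z. inner w ((H C z ** adj (H C z)) *v w))"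
    by (intro bounded_linear.continuous_on[OF q] continuous_intros cH)
  have "inner w (\<Sigma> *v w) = circ_mean (\<lambda>z. inner w ((\<psi> z *\<^sub>R (H C z ** adj (H C z))) *v w))"
    unfolding sol[symmetric] moment_H[OF C]
    by (rule circ_mean_linear[OF q, symmetric]) (intro continuous_intros \<psi> cH)
  also have "\<dots> = circ_mean (\<lambda>z. \<psi> z * inner w ((H C z ** adj (H C z)) *v w))"
    by (simp add: scaleR_matrix_vector)
  also have "\<dots> \<le> circ_mean (\<lambda>z. b * inner w ((H C z ** adj (H C z)) *v w))"
    by (intro circ_mean_mono continuous_intros c \<psi> mult_right_mono b nn)
  also have "\<dots> = b * circ_mean (\<lambda>z. inner w ((H C z ** adj (H C z)) *v w))"
    by (rule circ_mean_linear[OF bounded_linear_mult_right c])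
  also have "circ_mean (\<lambda>z. inner w ((H C z ** adj (H C z)) *v w)) = inner w (gramian C *v w)"
    unfolding gramian_def by (rule circ_mean_linear[OF q]) (intro continuous_intros cH)
  finally show ?thesis .
qed

end

text \<open>The limit of a sequence of solutions must again have an invertible \<open>C B\<close> and a stable closed loop.
  Neither is a closed condition on \<open>C\<close>. They become closed after adjoining \<open>D\<close> and the Gramian \<open>P\<close> as
  variables: \<open>D (C B) = B\<close> keeps \<open>C B\<close> injective, and the Lyapunov equation for \<open>P\<close> with the lower bound
  \<open>\<Sigma> \<le> b P\<close> forces stability. All four variables are bounded, so the enlarged set is compact, and the
  solutions are its image under a projection.\<close>

lemma compact_solutions:
  assumes \<psi>: "\<psi> \<in> C_pos" and \<Sigma>: "\<Sigma> \<in> range_Gamma_pos A B"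
  shows "compact (solutions \<psi> \<Sigma>)"
proof -
  have pd: "pos_def \<Sigma>" using \<Sigma> by (simp add: range_Gamma_pos_def)
  have inv: "invertible \<Sigma>" by (rule pos_def_invertible[OF pd])
  have \<psi>c: "continuous_on (sphere 0 1) \<psi>" using \<psi> by (simp add: C_pos_def)
  obtain a b where ab: "0 < a" "0 < b"
    "\<And>t z. 0 \<le> t \<Longrightarrow> t \<le> 1 \<Longrightarrow> z \<in> sphere 0 1 \<Longrightarrow> a \<le> psi_path \<psi> t z \<and> psi_path \<psi> t z \<le> b"
    using psi_path_bounds[OF \<psi>] by metis
  define \<kappa> where "\<kappa> = inner (mat 1) \<Sigma> / a"
  define \<rho> where "\<rho> = b * ((1 + \<kappa>) / 2) * norm (matrix_inv \<Sigma>)"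
  let ?K = "\<lambda>C D. A - D ** C ** A"
  define Z where "Z = {(t :: real, C, D, P). C \<in> C_space B \<and> (\<forall>i. 0 \<le> Re ((C ** B) $ i $ i)) \<and>
      D ** (C ** B) = B \<and> P = ?K C D ** P ** adj (?K C D) + D ** adj D \<and>
      (\<forall>w. inner w (\<Sigma> *v w) \<le> b * inner w (P *v w))}"
  have Zeq: "Z = {p. fst (snd p) \<in> C_space B} \<inter> {p. \<forall>i. 0 \<le> Re ((fst (snd p) ** B) $ i $ i)} \<inter>
      {p. fst (snd (snd p)) ** (fst (snd p) ** B) = B} \<inter>
      {p. snd (snd (snd p)) = ?K (fst (snd p)) (fst (snd (snd p))) ** snd (snd (snd p)) **
         adj (?K (fst (snd p)) (fst (snd (snd p)))) + fst (snd (snd p)) ** adj (fst (snd (snd p)))} \<inter>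
      {p. \<forall>w. inner w (\<Sigma> *v w) \<le> b * inner w (snd (snd (snd p)) *v w)}"
    unfolding Z_def by auto
  have "closed Z"
    unfolding Zeq
  proof (intro closed_Int)
    have "closed ((\<lambda>p. fst (snd p)) -` C_space B)"
      by (intro closed_vimage continuous_intros closed_subspace subspace_C_space)
    then show "closed {p. fst (snd p) \<in> C_space B}" by (simp add: vimage_def)
  next
    show "closed {p. \<forall>i. 0 \<le> Re ((fst (snd p) ** B) $ i $ i)}"
      by (intro closed_Collect_all closed_Collect_le continuous_intros)
  next
    show "closed {p. \<forall>w. inner w (\<Sigma> *v w) \<le> b * inner w (snd (snd (snd p)) *v w)}"
      by (intro closed_Collect_all closed_Collect_le continuous_intros)
  qed (intro closed_Collect_eq continuous_intros)+
  then have "compact (({0..1} \<times> cball 0 \<rho> \<times> cball 0 ((1 + \<kappa>) / 2) \<times> cball 0 \<kappa>) \<inter> Z)" (is "compact ?Zb")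
    by (intro compact_Int_closed compact_Times compact_cball compact_Icc)
  have ZC: "C \<in> C_plus A B \<and> D = gain C" if "(t, C, D, P) \<in> Z" for t C D P
  proof -
    have z: "lower_triangular (C ** B)" "real_diag (C ** B)" "\<And>i. 0 \<le> Re ((C ** B) $ i $ i)"
      "D ** (C ** B) = B" "P = ?K C D ** P ** adj (?K C D) + D ** adj D"
      "\<And>w. inner w (\<Sigma> *v w) \<le> b * inner w (P *v w)"
      using that by (auto simp: Z_def C_space_def)
    have CBinv: "invertible (C ** B)"
      unfolding invertible_iff_ker using z(4) B_inj
      by (metis matrix_vector_mul_assoc matrix_vector_mult_0_right)
    have D: "D = gain C"
      unfolding gain_def using z(4) CBinv
      by (metis matrix_inv_mult(1) matrix_mul_assoc matrix_mul_rid)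
    have "0 < Re ((C ** B) $ i $ i)" for i
    proof -
      have "(C ** B) $ i $ i \<noteq> 0"
        using CBinv invertible_lower_triangular[OF z(1)] by blast
      moreover have "Im ((C ** B) $ i $ i) = 0"
        using z(2) by (simp add: real_diag_def complex_is_Real_iff)
      ultimately show ?thesis using z(3)[of i] by (auto simp: complex_eq_iff less_le)
    qed
    then have pos: "pos_diag (C ** B)" using z(2) by (simp add: pos_diag_def real_diag_def)
    have "schur_stable (?K C D)"
    proof (rule schur_stable_of_lyapunov[OF stable _ z(5)])
      show "0 < inner x (P *v x)" if "x \<noteq> 0" for x
      proof -
        have "0 < b * inner x (P *v x)"
          using z(6)[of x] pd that by (force simp: pos_def_iff)
        then show ?thesis using ab(2) by (simp add: zero_less_mult_iff)
      qed
      show "?K C D = A - D ** (C ** A)" by (simp add: matrix_mul_assoc)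
    qed
    then show ?thesis using z(1) pos D by (simp add: C_plus_iff closed_loop_def)
  qed
  let ?m = "\<lambda>p. moment A B (psi_path \<psi> (fst p)) (fst (snd p))"
  have "continuous_on ?Zb ?m"
    by (intro continuous_on_moment_compose \<psi>c continuous_intros) (use ZC in auto)
  then have "closed (?Zb \<inter> ?m -` {\<Sigma>})"
    using \<open>compact ?Zb\<close> by (intro continuous_closed_preimage compact_imp_closed closed_singleton)
  then have "compact (?Zb \<inter> (?Zb \<inter> ?m -` {\<Sigma>}))"
    using \<open>compact ?Zb\<close> compact_Int_closed by blast
  then have "compact ((\<lambda>p. (fst p, fst (snd p))) ` (?Zb \<inter> (?Zb \<inter> ?m -` {\<Sigma>})))"
    by (rule compact_continuous_image[rotated]) (intro continuous_intros)
  also have "(\<lambda>p. (fst p, fst (snd p))) ` (?Zb \<inter> (?Zb \<inter> ?m -` {\<Sigma>})) = solutions \<psi> \<Sigma>"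
  proof (intro equalityI subsetI)
    fix x assume "x \<in> (\<lambda>p. (fst p, fst (snd p))) ` (?Zb \<inter> (?Zb \<inter> ?m -` {\<Sigma>}))"
    then show "x \<in> solutions \<psi> \<Sigma>"
      using ZC by (auto simp: solutions_def)
  next
    fix x assume "x \<in> solutions \<psi> \<Sigma>"
    then obtain t C where x: "x = (t, C)" "0 \<le> t" "t \<le> 1" "C \<in> C_plus A B"
      "moment A B (psi_path \<psi> t) C = \<Sigma>"
      by (auto simp: solutions_def)
    have pc: "continuous_on (sphere 0 1) (psi_path \<psi> t)"
      using psi_path_in_C_pos[OF \<psi> x(2,3)] by (simp add: C_pos_def)
    note est = pc inv x(4,5) ab(1) ab(3)[OF x(2,3), THEN conjunct1] ab(3)[OF x(2,3), THEN conjunct2]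
    have "(t, C, gain C, gramian C) \<in> Z"
      unfolding Z_def
      using x(4) C_plus_subset_C_space gain_CB[OF x(4)] gramian_lyapunov[OF x(4)]
        moment_le_gramian[OF est]
      by (auto simp: closed_loop_def C_plus_iff pos_diag_def less_imp_le)
    moreover have "norm C \<le> \<rho>" "norm (gain C) \<le> (1 + \<kappa>) / 2" "norm (gramian C) \<le> \<kappa>"
      using norm_parameter_le[OF est] norm_gain_le[OF est] norm_gramian_le[OF est]
      by (simp_all add: \<rho>_def \<kappa>_def)
    ultimately have "(t, C, gain C, gramian C) \<in> ?Zb \<inter> (?Zb \<inter> ?m -` {\<Sigma>})"
      using x by auto
    then show "x \<in> (\<lambda>p. (fst p, fst (snd p))) ` (?Zb \<inter> (?Zb \<inter> ?m -` {\<Sigma>}))"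
      unfolding x(1) by (rule rev_image_eqI) simp
  qed
  finally show ?thesis .
qed

end

lemma compact_positive_lower_bound:
  fixes f :: "'a::topological_space \<Rightarrow> real"
  assumes "compact S" "continuous_on S f" "\<And>x. x \<in> S \<Longrightarrow> 0 < f x"
  obtains c where "0 < c" "\<And>x. x \<in> S \<Longrightarrow> c \<le> f x"
proof (cases "S = {}")
  case True
  show ?thesis by (rule that[of 1]) (simp_all add: True)
next
  case False
  then obtain x where "x \<in> S" "\<And>y. y \<in> S \<Longrightarrow> f x \<le> f y"
    using continuous_attains_inf[OF assms(1) False assms(2)] by blast
  then show ?thesis using that[of "f x"] assms(3) by blast
qed

lemma compact_norm_upper_bound:
  fixes f :: "'a::topological_space \<Rightarrow> 'b::real_normed_vector"
  assumes "compact S" "continuous_on S f"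
  obtains c where "0 < c" "\<And>x. x \<in> S \<Longrightarrow> norm (f x) \<le> c"
  using compact_imp_bounded[OF compact_continuous_image[OF assms(2,1)]]
  by (auto simp: bounded_pos)

section \<open>Uniform convergence of Newton's method\<close>

text \<open>A Newton-Kantorovich statement in which the steps \<open>s\<close> and residuals \<open>F\<close> only satisfy the two
  inequalities that are used. If the first residual is \<open>\<eta>\<close>, the residuals at least halve in each step, so
  the total path length is at most \<open>2 \<eta> / c\<close>, at most half the radius. Every constant is independent of the
  starting point, which is what uniformity along the homotopy requires.\<close>

lemma newton_convergence:
  fixes Y :: "nat \<Rightarrow> 'a::banach" and F :: "'a \<Rightarrow> 'b::real_normed_vector"
  assumes V: "subspace V" "closed V" and C: "C \<in> V"
    and N: "\<And>X. X \<in> V \<Longrightarrow> dist C X \<le> r \<Longrightarrow> X \<in> N"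
    and s: "\<And>X. X \<in> N \<Longrightarrow> s X \<in> V" "\<And>X. X \<in> N \<Longrightarrow> c * norm (s X) \<le> norm (F X)"
    and quad: "\<And>X. X \<in> N \<Longrightarrow> X - s X \<in> N \<Longrightarrow> norm (F (X - s X)) \<le> M * (norm (s X))\<^sup>2"
    and c: "0 < c" and M: "0 \<le> M"
    and Y: "Y 0 \<in> V" "\<And>j. Y (Suc j) = Y j - s (Y j)"
    and start: "dist C (Y 0) \<le> r / 2" "4 * norm (F (Y 0)) \<le> c * r" "2 * M * norm (F (Y 0)) \<le> c\<^sup>2"
  shows "Y j \<in> N" "convergent Y" "lim Y \<in> N" "(\<lambda>j. F (Y j)) \<longlonglongrightarrow> 0"
proof -
  define \<eta> where "\<eta> = norm (F (Y 0))"
  define h where "h = (\<lambda>j. (1 / 2 :: real) ^ j)"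
  have h: "0 < h j" "h j \<le> 1" "h (Suc j) = h j / 2" for j
    by (simp_all add: h_def power_le_one)
  have \<eta>0: "0 \<le> \<eta>" by (simp add: \<eta>_def)
  have \<eta>r: "2 * \<eta> / c \<le> r / 2"
    using start(2) c by (simp add: \<eta>_def field_simps)
  have in_N: "X \<in> N" if "X \<in> V" "dist C X \<le> r / 2 + 2 * \<eta> / c * (1 - h j)" for X j
  proof (rule N[OF that(1)])
    have "2 * \<eta> / c * (1 - h j) \<le> 2 * \<eta> / c * 1"
      using \<eta>0 c h[of j] by (intro mult_left_mono) auto
    then show "dist C X \<le> r" using that(2) \<eta>r by simp
  qed
  have inv: "Y j \<in> V \<and> dist C (Y j) \<le> r / 2 + 2 * \<eta> / c * (1 - h j) \<and> norm (F (Y j)) \<le> \<eta> * h j" for j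
  proof (induction j)
    case 0
    then show ?case using Y(1) start(1) by (simp add: \<eta>_def h_def)
  next
    case (Suc j)
    then have YN: "Y j \<in> N" using in_N by blast
    have sn: "norm (s (Y j)) \<le> \<eta> / c * h j"
    proof -
      have "c * norm (s (Y j)) \<le> \<eta> * h j" using s(2)[OF YN] Suc by linarith
      then show ?thesis using c by (simp add: field_simps)
    qed
    have YV: "Y (Suc j) \<in> V"
      using Suc s(1)[OF YN] by (simp add: Y(2) subspace_diff[OF V(1)])
    have "dist C (Y (Suc j)) \<le> dist C (Y j) + norm (s (Y j))"
      using dist_triangle[of C "Y (Suc j)" "Y j"] by (simp add: Y(2) dist_norm)
    also have "\<dots> \<le> r / 2 + 2 * \<eta> / c * (1 - h (Suc j))"
      using Suc sn by (simp add: h(3) right_diff_distrib)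
    finally have d: "dist C (Y (Suc j)) \<le> r / 2 + 2 * \<eta> / c * (1 - h (Suc j))" .
    have "norm (F (Y (Suc j))) \<le> M * (norm (s (Y j)))\<^sup>2"
      using quad[OF YN] in_N[OF YV d] by (simp add: Y(2))
    also have "\<dots> \<le> M * (\<eta> / c * h j)\<^sup>2"
      by (intro mult_left_mono power_mono sn M) simp
    also have "\<dots> = (2 * M * \<eta>) / c\<^sup>2 * (\<eta> * h (Suc j)) * h j"
      by (simp add: h(3) power2_eq_square)
    also have "\<dots> \<le> 1 * (\<eta> * h (Suc j)) * 1"
      using start(3) c h[of j] h(1)[of "Suc j"] \<eta>0 M
      by (intro mult_mono) (auto simp: \<eta>_def)
    finally show ?case using YV d by simp
  qed
  then show YN: "Y j \<in> N" for j using in_N by blast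
  have sn: "norm (Y (Suc j) - Y j) \<le> \<eta> / c * (1 / 2) ^ j" for j
  proof -
    have "c * norm (s (Y j)) \<le> \<eta> * h j" using s(2)[OF YN[of j]] inv[of j] by linarith
    then show ?thesis using c by (simp add: field_simps Y(2) h_def)
  qed
  have "summable (\<lambda>j. Y (Suc j) - Y j)"
    by (rule summable_comparison_test'[OF _ sn]) (intro summable_mult summable_geometric, simp)
  then have "convergent (\<lambda>n. (\<Sum>j<n. Y (Suc j) - Y j))"
    by (simp add: summable_iff_convergent)
  then have "convergent (\<lambda>n. Y n - Y 0)" by (simp add: sum_lessThan_telescope)
  then have "convergent (\<lambda>n. (Y n - Y 0) + Y 0)"
    by (rule convergent_add) (rule convergent_const)
  then show conv: "convergent Y" by simp
  then have lim: "Y \<longlonglongrightarrow> lim Y" by (simp add: convergent_LIMSEQ_iff)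
  have "lim Y \<in> V"
    using closed_sequentially[OF V(2) _ lim] inv by blast
  moreover have "dist C (lim Y) \<le> r"
  proof (rule Lim_bounded[OF tendsto_dist[OF tendsto_const lim], of 0], intro allI impI)
    fix j
    have "2 * \<eta> / c * (1 - h j) \<le> 2 * \<eta> / c * 1"
      using \<eta>0 c h[of j] by (intro mult_left_mono) auto
    then show "dist C (Y j) \<le> r" using inv[of j] \<eta>r by simp
  qed
  ultimately show "lim Y \<in> N" by (rule N)
  show "(\<lambda>j. F (Y j)) \<longlonglongrightarrow> 0"
  proof (rule Lim_null_comparison)
    show "\<forall>\<^sub>F j in sequentially. norm (F (Y j)) \<le> \<eta> * (1 / 2) ^ j"
      using inv by (simp add: h_def)
    show "(\<lambda>j. \<eta> * (1 / 2) ^ j) \<longlonglongrightarrow> 0"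
      by (intro tendsto_mult_right_zero LIMSEQ_power_zero) simp
  qed
qed

context stable_pair
begin

text \<open>Within the parameter space, triangularity is automatic and the remaining conditions are open.\<close>

lemma C_plus_open_in_C_space:
  obtains U where "open U" "C_plus A B = C_space B \<inter> U"
proof -
  define U1 where "U1 = {Y :: complex^'n^'m::_. det (Y ** B) \<noteq> 0}"
  have "open U1"
    unfolding U1_def
    by (intro open_Collect_neq continuous_on_det continuous_intros)
  have "continuous_on U1 closed_loop"
    unfolding closed_loop_def gain_def U1_def
    by (intro continuous_intros) (auto simp: invertible_det_nz)
  then have "open (U1 \<inter> closed_loop -` {K. schur_stable K})"
    by (intro continuous_open_preimage \<open>open U1\<close> open_schur_stable)
  moreover have "open {Y :: complex^'n^'m::_. \<forall>i. 0 < Re ((Y ** B) $ i $ i)}"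
  proof -
    have "{Y :: complex^'n^'m::_. \<forall>i. 0 < Re ((Y ** B) $ i $ i)} = (\<Inter>i. {Y. 0 < Re ((Y ** B) $ i $ i)})"
      by auto
    then show ?thesis
      by (simp, intro open_INT ballI open_Collect_less continuous_intros) auto
  qed
  ultimately have op: "open ((U1 \<inter> closed_loop -` {K. schur_stable K}) \<inter> {Y. \<forall>i. 0 < Re ((Y ** B) $ i $ i)})"
    by (rule open_Int)
  show thesis
  proof (rule that[OF op])
    show "C_plus A B = C_space B \<inter> ((U1 \<inter> closed_loop -` {K. schur_stable K}) \<inter> {Y. \<forall>i. 0 < Re ((Y ** B) $ i $ i)})"
      using invertible_CB by (auto simp: C_plus_iff C_space_def U1_def pos_diag_def real_diag_def invertible_det_nz)
  qed
qed

lemma compact_neighbourhood_in_C_plus: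
  assumes "compact S" "S \<subseteq> C_plus A B"
  obtains r where "0 < r" "compact (C_space B \<inter> (\<Union>C\<in>S. cball C r))"
    "C_space B \<inter> (\<Union>C\<in>S. cball C r) \<subseteq> C_plus A B"
proof -
  obtain U where U: "open U" "C_plus A B = C_space B \<inter> U"
    by (rule C_plus_open_in_C_space)
  then obtain r where r: "0 < r" "(\<Union>C\<in>S. cball C r) \<subseteq> U"
    using compact_subset_open_imp_cball_epsilon_subset[OF assms(1), of U] assms(2) by auto
  have "(\<Union>C\<in>S. cball C r) = {x + y |x y. x \<in> S \<and> y \<in> cball 0 r}"
  proof (intro equalityI subsetI)
    fix Y assume "Y \<in> (\<Union>C\<in>S. cball C r)"
    then obtain C where "C \<in> S" "dist C Y \<le> r" by auto
    then have "Y = C + (Y - C) \<and> C \<in> S \<and> Y - C \<in> cball 0 r"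
      by (simp add: dist_norm norm_minus_commute)
    then show "Y \<in> {x + y |x y. x \<in> S \<and> y \<in> cball 0 r}" by blast
  next
    fix Y assume "Y \<in> {x + y |x y. x \<in> S \<and> y \<in> cball 0 r}"
    then show "Y \<in> (\<Union>C\<in>S. cball C r)"
      by (auto simp: dist_norm) (metis add.commute add_diff_cancel_right' norm_minus_commute diff_minus_eq_add
          minus_diff_eq add_diff_cancel_left')
  qed
  then have "compact (\<Union>C\<in>S. cball C r)"
    by (simp only: compact_sums[OF assms(1) compact_cball])
  then have "compact (C_space B \<inter> (\<Union>C\<in>S. cball C r))"
    by (intro closed_Int_compact closed_subspace subspace_C_space)
  then show thesis using that r U by blast
qed

section \<open>Uniform estimates for the moment map\<close>

lemma continuous_on_moment_d2:
  assumes "continuous_on (sphere 0 1) \<psi>"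
  shows "continuous_on (UNIV \<times> C_plus A B \<times> UNIV)
    (\<lambda>p. moment_d2 A B (psi_path \<psi> (fst p)) (fst (snd p)) (snd (snd p)))"
  unfolding moment_d2_def
proof (intro continuous_on_minus continuous_on_circ_mean_param)
  show "continuous_on ((UNIV \<times> C_plus A B \<times> UNIV) \<times> sphere 0 1) (\<lambda>(p, z). psi_path \<psi> (fst p) z *\<^sub>R
      (G z ** Winv A B (fst (snd p)) z ** adj (G z) **
       (adj (snd (snd p)) ** fst (snd p) + adj (fst (snd p)) ** snd (snd p)) **
       G z ** Winv A B (fst (snd p)) z ** adj (G z)))"
    unfolding case_prod_unfold by (intro continuous_intros assms) auto
qed

lemma continuous_on_moment_d1:
  assumes "continuous_on (sphere 0 1) \<xi>"
  shows "continuous_on (C_plus A B) (\<lambda>C. moment_d1 A B \<phi> C \<xi>)"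
  unfolding moment_d1_def
proof (intro continuous_on_circ_mean_param)
  show "continuous_on (C_plus A B \<times> sphere 0 1) (\<lambda>(C, z). \<xi> z *\<^sub>R (G z ** Winv A B C z ** adj (G z)))"
    unfolding case_prod_unfold
    by (intro continuous_intros continuous_on_compose2[OF assms]) auto
qed

text \<open>The integrand's error is given exactly by \<open>inverse_remainder\<close>, and compactness bounds every factor in
  it.\<close>

lemma moment_remainder:
  assumes \<psi>: "\<psi> \<in> C_pos" and N: "compact N" "N \<subseteq> C_plus A B"
  obtains M where "0 \<le> M" "\<And>t C Y. t \<in> {0..1} \<Longrightarrow> C \<in> N \<Longrightarrow> Y \<in> N \<Longrightarrow>
    norm (moment A B (psi_path \<psi> t) Y - moment A B (psi_path \<psi> t) C
      - moment_d2 A B (psi_path \<psi> t) C (Y - C)) \<le> M * (norm (Y - C))\<^sup>2"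
proof -
  have \<psi>c: "continuous_on (sphere 0 1) \<psi>" using \<psi> by (simp add: C_pos_def)
  have "compact (N \<times> sphere (0::complex) 1)" by (intro compact_Times N compact_sphere)
  moreover have "continuous_on (N \<times> sphere 0 1) (\<lambda>p. Winv A B (fst p) (snd p))"
    by (rule continuous_on_subset[OF continuous_on_Winv]) (use N in auto)
  ultimately obtain w where w: "0 < w"
    "\<And>p. p \<in> N \<times> sphere 0 1 \<Longrightarrow> norm (Winv A B (fst p) (snd p)) \<le> w"
    by (rule compact_norm_upper_bound) blast
  have w': "norm (Winv A B C z) \<le> w" if "C \<in> N" "z \<in> sphere 0 1" for C z
    using w(2)[of "(C, z)"] that by simp
  obtain \<gamma> where \<gamma>: "0 < \<gamma>" "\<And>z. z \<in> sphere 0 1 \<Longrightarrow> norm (G z) \<le> \<gamma>"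
    by (rule compact_norm_upper_bound[OF compact_sphere continuous_on_G]) blast
  obtain \<rho> where \<rho>: "0 < \<rho>" "\<And>C. C \<in> N \<Longrightarrow> norm C \<le> \<rho>"
    by (rule compact_norm_upper_bound[OF N(1) continuous_on_id]) blast
  obtain a b where ab: "0 < a" "0 < b"
    "\<And>t z. 0 \<le> t \<Longrightarrow> t \<le> 1 \<Longrightarrow> z \<in> sphere 0 1 \<Longrightarrow> a \<le> psi_path \<psi> t z \<and> psi_path \<psi> t z \<le> b"
    using psi_path_bounds[OF \<psi>] by metis
  \<comment> \<open>\<open>w\<close>, \<open>\<gamma>\<close>, \<open>\<rho>\<close> and \<open>b\<close> bound the inverse, \<open>G\<close>, the parameter and the weight; \<open>k\<close> bounds the remainder of the inverse.\<close>
  define k where "k = w * (\<gamma> * (2 * \<rho>) * \<gamma>) * w * (\<gamma> * (2 * \<rho>) * \<gamma>) * w + w * (\<gamma> * \<gamma>) * w"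
  define M where "M = b * (\<gamma> * k * \<gamma>)"
  have k0: "0 \<le> k" using w \<gamma> \<rho> by (simp add: k_def)
  have M0: "0 \<le> M" using ab k0 \<gamma> by (simp add: M_def)
  have bound: "norm (moment A B (psi_path \<psi> t) Y - moment A B (psi_path \<psi> t) C
      - moment_d2 A B (psi_path \<psi> t) C (Y - C)) \<le> M * (norm (Y - C))\<^sup>2"
    if t: "t \<in> {0..1}" and C: "C \<in> N" and Y: "Y \<in> N" for t C Y
  proof -
    have Cp: "C \<in> C_plus A B" "Y \<in> C_plus A B" using C Y N by auto
    let ?\<phi> = "psi_path \<psi> t" and ?V = "Y - C"
    let ?W = "Winv A B C" and ?W' = "Winv A B Y"
    define \<delta>1 where "\<delta>1 = (\<lambda>z. adj (G z) ** (adj ?V ** C + adj C ** ?V) ** G z)"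
    define \<delta>2 where "\<delta>2 = (\<lambda>z. adj (G z) ** (adj ?V ** ?V) ** G z)"
    define \<delta> where "\<delta> = (\<lambda>z. adj (G z) ** (adj Y ** ?V + adj ?V ** C) ** G z)"
    define Rm where "Rm = (\<lambda>z. ?W z ** \<delta> z ** ?W z ** \<delta> z ** ?W' z - ?W z ** \<delta>2 z ** ?W z)"
    have \<phi>c: "continuous_on (sphere 0 1) ?\<phi>"
      by (intro continuous_intros \<psi>c) auto
    have rem: "?W' z - ?W z + ?W z ** \<delta>1 z ** ?W z = Rm z" if z: "z \<in> sphere 0 1" for z
    proof -
      let ?N = "\<lambda>C. adj (G z) ** adj C ** C ** G z"
      have \<delta>: "?N Y - ?N C = \<delta> z"
        by (simp add: \<delta>_def matrix_ring adj_diff)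
      have 12: "?N Y - ?N C = \<delta>1 z + \<delta>2 z"
      proof -
        have "?N (C + V) - ?N C = adj (G z) ** (adj V ** C + adj C ** V) ** G z
            + adj (G z) ** (adj V ** V) ** G z" for V
          by (simp add: matrix_ring adj_add)
        from this[of ?V] show ?thesis by (simp add: \<delta>1_def \<delta>2_def)
      qed
      note inv = invertible_gram[OF Cp(1) z] invertible_gram[OF Cp(2) z]
      show ?thesis
        using inverse_remainder[of "?W z" "?N C" "?N Y" "?W' z" "\<delta>1 z" "\<delta>2 z"]
        using inv 12 unfolding \<delta> Rm_def by (simp add: Winv_def matrix_inv_mult)
    qed
    have GW: "continuous_on (sphere 0 1) (\<lambda>z. G z ** Winv A B X z ** adj (G z))" if "X \<in> C_plus A B" for X
      by (intro continuous_intros) (use that in auto)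
    have "moment A B ?\<phi> Y - moment A B ?\<phi> C - moment_d2 A B ?\<phi> C ?V
        = circ_mean (\<lambda>z. ?\<phi> z *\<^sub>R (G z ** ?W' z ** adj (G z)) - ?\<phi> z *\<^sub>R (G z ** ?W z ** adj (G z))
          + ?\<phi> z *\<^sub>R (G z ** ?W z ** adj (G z) ** (adj ?V ** C + adj C ** ?V) ** G z ** ?W z ** adj (G z)))"
      unfolding moment_def moment_d2_def
      by (subst circ_mean_add circ_mean_diff, (intro continuous_intros \<phi>c; use Cp in simp)+)+ simp
    also have "\<dots> = circ_mean (\<lambda>z. ?\<phi> z *\<^sub>R (G z ** Rm z ** adj (G z)))"
    proof (rule circ_mean_cong)
      fix z :: complex assume z: "z \<in> sphere 0 1"
      show "?\<phi> z *\<^sub>R (G z ** ?W' z ** adj (G z)) - ?\<phi> z *\<^sub>R (G z ** ?W z ** adj (G z))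
          + ?\<phi> z *\<^sub>R (G z ** ?W z ** adj (G z) ** (adj ?V ** C + adj C ** ?V) ** G z ** ?W z ** adj (G z))
          = ?\<phi> z *\<^sub>R (G z ** Rm z ** adj (G z))"
        unfolding rem[OF z, symmetric] \<delta>1_def scaleR_diff_right[symmetric] scaleR_add_right[symmetric]
        by (simp add: matrix_mult.add_left matrix_mult.add_right matrix_mult.diff_left
            matrix_mult.diff_right matrix_mul_assoc)
    qed
    also have "norm \<dots> \<le> M * (norm ?V)\<^sup>2"
    proof (rule norm_circ_mean_le)
      show "continuous_on (sphere 0 1) (\<lambda>z. ?\<phi> z *\<^sub>R (G z ** Rm z ** adj (G z)))"
        unfolding Rm_def \<delta>_def \<delta>2_def by (intro continuous_intros \<phi>c; use Cp in simp)
      fix z :: complex assume z: "z \<in> sphere 0 1"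
      note wz = w'[OF C z] w'[OF Y z]
      have "norm (adj Y ** ?V + adj ?V ** C) \<le> norm Y * norm ?V + norm ?V * norm C"
        using norm_matrix_mult_le[of "adj Y" ?V] norm_matrix_mult_le[of "adj ?V" C]
        by (intro norm_triangle_le) simp
      also have "\<dots> \<le> \<rho> * norm ?V + norm ?V * \<rho>"
        using \<rho>(1) \<rho>(2)[OF C] \<rho>(2)[OF Y] by (intro add_mono mult_mono) auto
      finally have dV: "norm (adj Y ** ?V + adj ?V ** C) \<le> 2 * \<rho> * norm ?V" by simp
      have "norm (\<delta> z) \<le> norm (adj (G z)) * norm (adj Y ** ?V + adj ?V ** C) * norm (G z)"
        unfolding \<delta>_def by (rule norm_mult3_le)
      also have "\<dots> \<le> \<gamma> * (2 * \<rho> * norm ?V) * \<gamma>"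
        using \<gamma>(2)[OF z] \<gamma>(1) \<rho>(1) dV by (intro mult_mono) auto
      finally have d: "norm (\<delta> z) \<le> \<gamma> * (2 * \<rho>) * \<gamma> * norm ?V" by (simp only: mult_ac)
      have "norm (\<delta>2 z) \<le> norm (adj (G z)) * norm (adj ?V ** ?V) * norm (G z)"
        unfolding \<delta>2_def by (rule norm_mult3_le)
      also have "\<dots> \<le> \<gamma> * (norm ?V * norm ?V) * \<gamma>"
        using \<gamma>(2)[OF z] \<gamma>(1) norm_matrix_mult_le[of "adj ?V" ?V] by (intro mult_mono) auto
      finally have d2: "norm (\<delta>2 z) \<le> \<gamma> * \<gamma> * (norm ?V)\<^sup>2" by (simp only: power2_eq_square mult_ac)
      let ?d = "\<gamma> * (2 * \<rho>) * \<gamma> * norm ?V"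
      have "norm (Rm z) \<le> norm (?W z ** \<delta> z ** ?W z ** \<delta> z ** ?W' z) + norm (?W z ** \<delta>2 z ** ?W z)"
        unfolding Rm_def by (rule norm_triangle_ineq4)
      also have "\<dots> \<le> norm (?W z ** \<delta> z ** ?W z) * norm (\<delta> z) * norm (?W' z) + norm (?W z) * norm (\<delta>2 z) * norm (?W z)"
        by (intro add_mono norm_mult3_le)
      also have "\<dots> \<le> (norm (?W z) * norm (\<delta> z) * norm (?W z)) * norm (\<delta> z) * norm (?W' z)
          + norm (?W z) * norm (\<delta>2 z) * norm (?W z)"
        by (intro add_mono mult_right_mono norm_mult3_le order_refl) auto
      also have "\<dots> \<le> (w * ?d * w) * ?d * w + w * (\<gamma> * \<gamma> * (norm ?V)\<^sup>2) * w"
        using wz w(1) d d2 \<gamma>(1) \<rho>(1)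
        by (intro add_mono mult_mono) (auto intro!: mult_nonneg_nonneg)
      also have "\<dots> = k * (norm ?V)\<^sup>2"
        by (simp add: k_def power2_eq_square algebra_simps)
      finally have Rk: "norm (Rm z) \<le> k * (norm ?V)\<^sup>2" .
      have "norm (G z ** Rm z ** adj (G z)) \<le> norm (G z) * norm (Rm z) * norm (adj (G z))"
        by (rule norm_mult3_le)
      also have "\<dots> \<le> \<gamma> * (k * (norm ?V)\<^sup>2) * \<gamma>"
        using \<gamma>(2)[OF z] \<gamma>(1) k0 Rk by (intro mult_mono) auto
      finally have "norm (G z ** Rm z ** adj (G z)) \<le> \<gamma> * (k * (norm ?V)\<^sup>2) * \<gamma>" .
      moreover have "0 \<le> ?\<phi> z" "?\<phi> z \<le> b"
        using ab(3)[of t z] ab(1) t z by auto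
      ultimately have "\<bar>?\<phi> z\<bar> * norm (G z ** Rm z ** adj (G z)) \<le> b * (\<gamma> * (k * (norm ?V)\<^sup>2) * \<gamma>)"
        by (intro mult_mono) (auto simp: k0 intro: mult_nonneg_nonneg)
      then show "norm (?\<phi> z *\<^sub>R (G z ** Rm z ** adj (G z))) \<le> M * (norm ?V)\<^sup>2"
        by (simp add: M_def mult_ac)
    qed
    finally show ?thesis .
  qed
  show thesis by (rule that[OF M0 bound])
qed

text \<open>The moment map is affine in the weight along the homotopy, and its derivative in the weight does
  not involve the weight, whence the free \<open>\<phi>\<close>.\<close>

lemma moment_psi_path_diff:
  assumes "continuous_on (sphere 0 1) \<psi>" "C \<in> C_plus A B"
  shows "moment A B (psi_path \<psi> t') C - moment A B (psi_path \<psi> t) C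
    = (t' - t) *\<^sub>R moment_d1 A B \<phi> C (\<lambda>z. \<psi> z - 1)"
proof -
  let ?E = "\<lambda>z. G z ** Winv A B C z ** adj (G z)"
  have c: "continuous_on (sphere 0 1) ?E"
    by (intro continuous_intros) (use assms in auto)
  have p: "continuous_on (sphere 0 1) (psi_path \<psi> s)" for s
    by (intro continuous_intros assms) auto
  have "moment A B (psi_path \<psi> t') C - moment A B (psi_path \<psi> t) C
      = circ_mean (\<lambda>z. psi_path \<psi> t' z *\<^sub>R ?E z - psi_path \<psi> t z *\<^sub>R ?E z)"
    unfolding moment_def by (rule circ_mean_diff[symmetric]) (intro continuous_on_scaleR c p)+
  also have "\<dots> = circ_mean (\<lambda>z. (t' - t) *\<^sub>R ((\<psi> z - 1) *\<^sub>R ?E z))"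
    by (simp add: psi_path_def algebra_simps)
  also have "\<dots> = (t' - t) *\<^sub>R moment_d1 A B \<phi> C (\<lambda>z. \<psi> z - 1)"
    unfolding moment_d1_def
    by (rule circ_mean_linear[OF bounded_linear_scaleR_right]) (intro continuous_on_scaleR c continuous_intros assms)
  finally show ?thesis .
qed

end

section \<open>One predictor-corrector step\<close>

context reachable_pair
begin

lemma d2_inv:
  assumes "\<phi> \<in> C_pos" "C \<in> C_plus A B" "X \<in> range_Gamma A B"
  shows "d2_inv A B \<phi> C X \<in> C_space B" "moment_d2 A B \<phi> C (d2_inv A B \<phi> C X) = X"
proof -
  have "X \<in> moment_d2 A B \<phi> C ` C_space B"
    using surj_moment_d2[OF assms(1,2)] assms(3) by simp
  then show "d2_inv A B \<phi> C X \<in> C_space B" "moment_d2 A B \<phi> C (d2_inv A B \<phi> C X) = X"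
    unfolding d2_inv_def by (rule inv_into_into, rule f_inv_into_f)
qed

lemma moment_d2_uniform_bounds:
  assumes \<psi>: "\<psi> \<in> C_pos" and N: "compact N" "N \<subseteq> C_plus A B"
  obtains c L where "0 < c" "0 < L" "\<And>t C V. t \<in> {0..1} \<Longrightarrow> C \<in> N \<Longrightarrow> V \<in> C_space B \<Longrightarrow>
    c * norm V \<le> norm (moment_d2 A B (psi_path \<psi> t) C V) \<and>
    norm (moment_d2 A B (psi_path \<psi> t) C V) \<le> L * norm V"
proof -
  have \<psi>c: "continuous_on (sphere 0 1) \<psi>" using \<psi> by (simp add: C_pos_def)
  let ?J = "\<lambda>p. moment_d2 A B (psi_path \<psi> (fst p)) (fst (snd p)) (snd (snd p))"
  let ?S = "{0..1::real} \<times> N \<times> (C_space B \<inter> sphere 0 1)"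
  have S: "compact ?S"
    by (intro compact_Times compact_Icc N closed_Int_compact closed_subspace subspace_C_space compact_sphere)
  have J: "continuous_on ?S ?J"
    by (rule continuous_on_subset[OF continuous_on_moment_d2[OF \<psi>c]]) (use N in auto)
  have pos: "0 < norm (?J p)" if "p \<in> ?S" for p
  proof -
    have "snd (snd p) \<noteq> 0" using that by auto
    moreover have "psi_path \<psi> (fst p) \<in> C_pos" "fst (snd p) \<in> C_plus A B" "snd (snd p) \<in> C_space B"
      using that N by (auto intro: psi_path_in_C_pos[OF \<psi>])
    ultimately show ?thesis using inj_moment_d2 by auto
  qed
  obtain c where c: "0 < c" "\<And>p. p \<in> ?S \<Longrightarrow> c \<le> norm (?J p)"
    by (rule compact_positive_lower_bound[OF S continuous_on_norm[OF J] pos]) blast+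
  obtain L where L: "0 < L" "\<And>p. p \<in> ?S \<Longrightarrow> norm (?J p) \<le> L"
    by (rule compact_norm_upper_bound[OF S J]) blast
  have "c * norm V \<le> norm (moment_d2 A B (psi_path \<psi> t) C V) \<and>
      norm (moment_d2 A B (psi_path \<psi> t) C V) \<le> L * norm V"
    if t: "t \<in> {0..1}" and C: "C \<in> N" and V: "V \<in> C_space B" for t C V
  proof -
    have "continuous_on (sphere 0 1) (psi_path \<psi> t)" "C \<in> C_plus A B"
      using psi_path_in_C_pos[OF \<psi>, of t] t C N by (auto simp: C_pos_def)
    note lin = linear_moment_d2[OF this]
    show ?thesis
    proof (cases "V = 0")
      case False
      let ?U = "(1 / norm V) *\<^sub>R V"
      have "(t, C, ?U) \<in> ?S"
        using t C V False by (simp add: subspace_scale[OF subspace_C_space])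
      from c(2)[OF this] L(2)[OF this] show ?thesis
        using False by (simp add: linear_cmul[OF lin] field_simps)
    next
      case True
      then show ?thesis using linear_0[OF lin] by simp
    qed
  qed
  with c(1) L(1) show thesis by (rule that)
qed

text \<open>All constants come from the compact neighbourhood \<open>N\<close> of the set \<open>S\<close> of solutions, never from the
  current iterate. The velocity of the predictor is at most \<open>L / c\<close>. Hence after a step of length at most
  \<open>\<delta>\<close> the residual is at most \<open>\<delta> Q\<close>: the part \<open>L\<close> comes from the change of the weight, the rest
  from the change of the parameter.\<close>

lemma uniform_step_length:
  assumes \<psi>: "\<psi> \<in> C_pos" and \<Sigma>: "\<Sigma> \<in> range_Gamma_pos A B"
  obtains \<delta>0 where "0 < \<delta>0" "\<And>\<delta> s. 0 < \<delta> \<Longrightarrow> \<delta> \<le> \<delta>0 \<Longrightarrow> s \<in> solutions \<psi> \<Sigma> \<Longrightarrow>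
    predictor_well_defined A B \<psi> s \<and> corrector_well_defined A B \<psi> \<Sigma> \<delta> s \<and>
    pc_step A B \<psi> \<Sigma> \<delta> s \<in> solutions \<psi> \<Sigma>"
proof -
  have \<psi>c: "continuous_on (sphere 0 1) \<psi>" using \<psi> by (simp add: C_pos_def)
  have \<Sigma>r: "\<Sigma> \<in> range_Gamma A B" using \<Sigma> by (simp add: range_Gamma_pos_def)
  define S where "S = snd ` solutions \<psi> \<Sigma>"
  have S: "compact S" "S \<subseteq> C_plus A B"
    unfolding S_def
    by (intro compact_continuous_image compact_solutions[OF \<psi> \<Sigma>] continuous_intros)
       (auto simp: solutions_def)
  obtain r where r: "0 < r" "compact (C_space B \<inter> (\<Union>C\<in>S. cball C r))"
    "C_space B \<inter> (\<Union>C\<in>S. cball C r) \<subseteq> C_plus A B"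
    by (rule compact_neighbourhood_in_C_plus[OF S])
  define N where "N = C_space B \<inter> (\<Union>C\<in>S. cball C r)"
  have N: "compact N" "N \<subseteq> C_plus A B" using r by (simp_all add: N_def)
  have SN: "S \<subseteq> N"
    using S(2) C_plus_subset_C_space r(1) by (auto simp: N_def)
  obtain c L2 where cL: "0 < c" "0 < L2" "\<And>t C V. t \<in> {0..1} \<Longrightarrow> C \<in> N \<Longrightarrow> V \<in> C_space B \<Longrightarrow>
    c * norm V \<le> norm (moment_d2 A B (psi_path \<psi> t) C V) \<and>
    norm (moment_d2 A B (psi_path \<psi> t) C V) \<le> L2 * norm V"
    using moment_d2_uniform_bounds[OF \<psi> N] by metis
  obtain M where M: "0 \<le> M" "\<And>t C Y. t \<in> {0..1} \<Longrightarrow> C \<in> N \<Longrightarrow> Y \<in> N \<Longrightarrow>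
    norm (moment A B (psi_path \<psi> t) Y - moment A B (psi_path \<psi> t) C
      - moment_d2 A B (psi_path \<psi> t) C (Y - C)) \<le> M * (norm (Y - C))\<^sup>2"
    using moment_remainder[OF \<psi> N] by metis
  have \<xi>c: "continuous_on (sphere 0 1) (\<lambda>z. \<psi> z - 1)" by (intro continuous_intros \<psi>c)
  have "continuous_on N (\<lambda>C. moment_d1 A B \<psi> C (\<lambda>z. \<psi> z - 1))"
    by (rule continuous_on_subset[OF continuous_on_moment_d1[OF \<xi>c] N(2)])
  then obtain L where "0 < L" "\<And>C. C \<in> N \<Longrightarrow> norm (moment_d1 A B \<psi> C (\<lambda>z. \<psi> z - 1)) \<le> L"
    using compact_norm_upper_bound[OF N(1)] by metis
  then have L: "0 < L" "\<And>C \<phi>. C \<in> N \<Longrightarrow> norm (moment_d1 A B \<phi> C (\<lambda>z. \<psi> z - 1)) \<le> L"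
    by (auto simp: moment_d1_def)
  define Q where "Q = L2 * (L / c) + M * (L / c)\<^sup>2 + L"
  have Q: "0 < Q" using cL L M by (simp add: Q_def add_nonneg_pos)
  \<comment> \<open>In this order: \<open>\<delta>\<^sup>2 \<le> \<delta>\<close>, the predictor stays within half the radius, and the two conditions on the first residual in Newton's method.\<close>
  define \<delta>0 where "\<delta>0 = Min {1, r / 2 / (L / c), c * r / (4 * Q), c\<^sup>2 / (2 * (M + 1) * Q)}"
  have \<delta>0: "0 < \<delta>0" "\<delta>0 \<le> 1" "\<delta>0 \<le> r / 2 / (L / c)" "\<delta>0 \<le> c * r / (4 * Q)" "\<delta>0 \<le> c\<^sup>2 / (2 * (M + 1) * Q)"
    using cL L M Q r(1) by (simp_all add: \<delta>0_def)
  have step: "predictor_well_defined A B \<psi> (t, C) \<and> corrector_well_defined A B \<psi> \<Sigma> \<delta> (t, C) \<and>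
      pc_step A B \<psi> \<Sigma> \<delta> (t, C) \<in> solutions \<psi> \<Sigma>"
    if \<delta>: "0 < \<delta>" "\<delta> \<le> \<delta>0" and sol: "(t, C) \<in> solutions \<psi> \<Sigma>" for \<delta> t C
  proof -
    have t: "t \<in> {0..1}" and C: "C \<in> C_plus A B" and eq: "moment A B (psi_path \<psi> t) C = \<Sigma>"
      using sol by (auto simp: solutions_def)
    have CS: "C \<in> S" using sol unfolding S_def by force
    then have CN: "C \<in> N" using SN by blast
    have CV: "C \<in> C_space B" using C C_plus_subset_C_space by blast
    have pos: "psi_path \<psi> t \<in> C_pos" using psi_path_in_C_pos[OF \<psi>] t by simp
    let ?d1 = "moment_d1 A B (psi_path \<psi> t) C (\<lambda>z. \<psi> z - 1)"
    have d1r: "?d1 \<in> range_Gamma A B" by (rule moment_d1_in_range[OF \<xi>c C])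
    have pw: "predictor_well_defined A B \<psi> (t, C)"
      unfolding predictor_well_defined_def using C moment_d2_invertible[OF pos C] d1r by simp
    define v where "v = - d2_inv A B (psi_path \<psi> t) C ?d1"
    have v: "v \<in> C_space B"
      using d2_inv[OF pos C d1r] by (simp add: v_def subspace_neg[OF subspace_C_space])
    have "c * norm v \<le> L"
    proof -
      have "c * norm v \<le> norm (moment_d2 A B (psi_path \<psi> t) C (d2_inv A B (psi_path \<psi> t) C ?d1))"
        using cL(3)[OF t CN d2_inv(1)[OF pos C d1r]] by (simp add: v_def)
      then show ?thesis using d2_inv(2)[OF pos C d1r] L(2)[OF CN, of "psi_path \<psi> t"] by simp
    qed
    then have vL: "norm v \<le> L / c" using cL(1) by (simp add: field_simps)
    define t' where "t' = next_t \<delta> t"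
    have t': "t' \<in> {0..1}" "0 \<le> t' - t" "t' - t \<le> \<delta>"
      using t \<delta> by (auto simp: t'_def next_t_def)
    define X where "X = C + (t' - t) *\<^sub>R v"
    have X: "predictor A B \<psi> \<delta> (t, C) = X"
      by (simp add: predictor_def X_def v_def t'_def)
    have XV: "X \<in> C_space B"
      unfolding X_def by (intro subspace_add subspace_scale subspace_C_space CV v)
    have "dist C X = (t' - t) * norm v"
      using t' by (simp add: X_def dist_norm)
    also have "\<dots> \<le> \<delta> * (L / c)"
      using t' vL \<delta> by (intro mult_mono) auto
    finally have dX: "dist C X \<le> \<delta> * (L / c)" .
    also have "\<dots> \<le> r / 2"
    proof -
      have "\<delta> \<le> r / 2 / (L / c)" using \<delta> \<delta>0(3) by simp
      then show ?thesis using cL(1) L(1) by (simp add: field_simps)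
    qed
    finally have dr: "dist C X \<le> r / 2" .
    have inN: "Y \<in> N" if "Y \<in> C_space B" "dist C Y \<le> r" for Y
      using that CS by (auto simp: N_def)
    have XN: "X \<in> N" using inN[OF XV] dr r(1) by simp
    let ?\<phi> = "psi_path \<psi> t'"
    define F where "F = (\<lambda>Y. moment A B ?\<phi> Y - \<Sigma>)"
    define s where "s = (\<lambda>Y. d2_inv A B ?\<phi> Y (F Y))"
    have \<phi>p: "?\<phi> \<in> C_pos" using psi_path_in_C_pos[OF \<psi>] t' by simp
    then have \<phi>c: "continuous_on (sphere 0 1) ?\<phi>" by (simp add: C_pos_def)
    have Fr: "F Y \<in> range_Gamma A B" if "Y \<in> N" for Y
      unfolding F_def using that N(2)
      by (intro subspace_diff[OF subspace_range_Gamma] moment_in_range \<phi>c \<Sigma>r) auto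
    have s: "s Y \<in> C_space B" "moment_d2 A B ?\<phi> Y (s Y) = F Y" if "Y \<in> N" for Y
      unfolding s_def using d2_inv[OF \<phi>p _ Fr[OF that]] that N(2) by auto
    have sn: "c * norm (s Y) \<le> norm (F Y)" if "Y \<in> N" for Y
      using cL(3)[OF t'(1) that s(1)[OF that]] s(2)[OF that] by simp
    have quad: "norm (F (Y - s Y)) \<le> M * (norm (s Y))\<^sup>2" if Y: "Y \<in> N" "Y - s Y \<in> N" for Y
    proof -
      have "linear (moment_d2 A B ?\<phi> Y)" using linear_moment_d2[OF \<phi>c] Y(1) N(2) by blast
      then have "moment_d2 A B ?\<phi> Y (- s Y) = - F Y"
        by (simp add: linear_neg s(2)[OF Y(1)])
      then show ?thesis
        using M(2)[OF t'(1) Y] by (simp add: F_def)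
    qed
    define Y where "Y = newton A B ?\<phi> \<Sigma> X"
    have Y0: "Y 0 = X" by (simp add: Y_def)
    have YSuc: "Y (Suc j) = Y j - s (Y j)" for j
      by (simp add: Y_def s_def F_def Let_def)
    have "norm (F X) \<le> \<delta> * Q"
    proof -
      let ?g = "\<lambda>Y. moment A B ?\<phi> Y" and ?J = "moment_d2 A B ?\<phi> C"
      define e1 e2 e3 where e: "e1 = ?g X - ?g C - ?J (X - C)" "e2 = ?J (X - C)"
        "e3 = ?g C - moment A B (psi_path \<psi> t) C"
      have "F X = e1 + e2 + e3"
        by (simp add: F_def eq e)
      then have "norm (F X) \<le> norm e1 + norm e2 + norm e3"
        using norm_triangle_ineq[of "e1 + e2" e3] norm_triangle_ineq[of e1 e2] by simp
      also have "\<dots> \<le> M * (norm (X - C))\<^sup>2 + L2 * norm (X - C) + \<delta> * L"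
      proof (intro add_mono)
        show "norm e1 \<le> M * (norm (X - C))\<^sup>2" unfolding e by (rule M(2)[OF t'(1) CN XN])
        show "norm e2 \<le> L2 * norm (X - C)"
          unfolding e using cL(3)[OF t'(1) CN subspace_diff[OF subspace_C_space XV CV]] by simp
        have "e3 = (t' - t) *\<^sub>R moment_d1 A B \<psi> C (\<lambda>z. \<psi> z - 1)"
          unfolding e by (rule moment_psi_path_diff[OF \<psi>c C])
        then have "norm e3 = (t' - t) * norm (moment_d1 A B \<psi> C (\<lambda>z. \<psi> z - 1))"
          using t'(2) by simp
        also have "\<dots> \<le> \<delta> * L"
          using t' L(2)[OF CN, of \<psi>] \<delta>(1) by (intro mult_mono) auto
        finally show "norm e3 \<le> \<delta> * L" .
      qed
      also have "\<dots> \<le> M * (\<delta> * (L / c))\<^sup>2 + L2 * (\<delta> * (L / c)) + \<delta> * L"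
        using dX M(1) cL(2) \<delta>(1)
        by (intro add_mono mult_left_mono power_mono) (auto simp: dist_norm norm_minus_commute)
      also have "\<dots> \<le> \<delta> * Q"
      proof -
        have "\<delta> * \<delta> \<le> \<delta>"
          using \<delta> \<delta>0(2) by simp
        then have "M * (L / c)\<^sup>2 * (\<delta> * \<delta>) \<le> M * (L / c)\<^sup>2 * \<delta>"
          using M(1) by (intro mult_left_mono) auto
        then show ?thesis by (simp add: Q_def algebra_simps power2_eq_square)
      qed
      finally show ?thesis .
    qed
    then have FX: "norm (F (Y 0)) \<le> \<delta> * Q" by (simp add: Y0)
    have st2: "4 * norm (F (Y 0)) \<le> c * r"
    proof -
      have "\<delta> \<le> c * r / (4 * Q)" using \<delta> \<delta>0(4) by simp
      then have "4 * (\<delta> * Q) \<le> c * r" using Q by (simp add: field_simps)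
      then show ?thesis using FX by linarith
    qed
    have st3: "2 * M * norm (F (Y 0)) \<le> c\<^sup>2"
    proof -
      have "\<delta> \<le> c\<^sup>2 / (2 * (M + 1) * Q)" using \<delta> \<delta>0(5) by simp
      moreover have "0 < 2 * (M + 1) * Q" using Q M(1) by simp
      ultimately have "\<delta> * (2 * (M + 1) * Q) \<le> c\<^sup>2" by (simp only: pos_le_divide_eq)
      then have "2 * (M + 1) * (\<delta> * Q) \<le> c\<^sup>2" by (simp only: mult_ac)
      moreover have "2 * M * norm (F (Y 0)) \<le> 2 * (M + 1) * (\<delta> * Q)"
        using FX M(1) by (intro mult_mono) auto
      ultimately show ?thesis by linarith
    qed
    have conv: "Y j \<in> N" "convergent Y" "lim Y \<in> N" "(\<lambda>j. F (Y j)) \<longlonglongrightarrow> 0" for j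
    proof -
      have Y0': "Y 0 \<in> C_space B" "dist C (Y 0) \<le> r / 2" using XV dr by (simp_all add: Y0)
      note newton = newton_convergence[where V = "C_space B" and C = C and N = N and r = r and s = s
          and F = F and c = c and M = M and Y = Y, OF subspace_C_space
          closed_subspace[OF subspace_C_space] CV inN s(1) sn quad cL(1) M(1) Y0'(1) YSuc Y0'(2) st2 st3]
      show "Y j \<in> N" by (rule newton(1))
      show "convergent Y" by (rule newton(2))
      show "lim Y \<in> N" by (rule newton(3))
      show "(\<lambda>j. F (Y j)) \<longlonglongrightarrow> 0" by (rule newton(4))
    qed
    have cw: "corrector_well_defined A B \<psi> \<Sigma> \<delta> (t, C)"
      unfolding corrector_well_defined_def Let_def fst_conv X t'_def[symmetric] Y_def[symmetric]
      using conv N(2) moment_d2_invertible[OF \<phi>p] Fr by (auto simp: F_def)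
    have limC: "lim Y \<in> C_plus A B" using conv(3) N(2) by blast
    have "continuous_on (C_plus A B) F"
      unfolding F_def by (intro continuous_intros continuous_on_moment_compose \<psi>c) 
    moreover have "Y \<longlonglongrightarrow> lim Y" using conv(2) by (simp add: convergent_LIMSEQ_iff)
    moreover have "\<forall>j. Y j \<in> C_plus A B" using conv(1) N(2) by blast
    ultimately have "(\<lambda>j. F (Y j)) \<longlonglongrightarrow> F (lim Y)"
      using limC by (intro continuous_on_tendsto_compose[of "C_plus A B" F]) auto
    then have "F (lim Y) = 0" using conv(4) LIMSEQ_unique by blast
    then have "moment A B ?\<phi> (lim Y) = \<Sigma>" by (simp add: F_def)
    then have "pc_step A B \<psi> \<Sigma> \<delta> (t, C) \<in> solutions \<psi> \<Sigma>"
      using t' limC by (simp add: pc_step_def solutions_def X Y_def flip: t'_def)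
    with pw cw show ?thesis by blast
  qed
  show thesis
    by (rule that[OF \<delta>0(1)]) (use step in \<open>metis surj_pair\<close>)
qed

end

text \<open>The rank is the dimension of the row space; if it is full, there is a left inverse.\<close>

lemma full_rank_ker:
  fixes B :: "complex^'m^'n"
  assumes "rank B = CARD('m)" "B *v x = 0"
  shows "x = 0"
proof -
  have "vec.span (rows B) = UNIV"
    unfolding vec.dim_eq_full[symmetric] vec.dimension_def card_cart_basis
    using assms(1) by (simp add: row_rank_def_gen)
  then have "\<exists>B'. B' ** B = mat 1"
    by (simp only: matrix_left_invertible_span_rows_gen)
  then show ?thesis
    using assms(2) unfolding matrix_left_invertible_ker by blast
qed

lemma fst_pc_state: "0 \<le> \<delta> \<Longrightarrow> fst (pc_state A B \<psi> \<Sigma> \<delta> k) = min 1 (real k * \<delta>)"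
  by (induction k) (auto simp: pc_state_def pc_step_def next_t_def algebra_simps min_def)

theorem theorem4:
  fixes A :: "complex^'n^'n"
    and B :: "complex^'m::{finite,wellorder}^'n"
    and \<psi> :: "complex \<Rightarrow> real"
    and \<Sigma> :: "complex^'n^'n"
  assumes "CARD('m) \<le> CARD('n)"
    and "schur_stable A"
    and "rank B = CARD('m)"
    and "reachable A B"
    and "\<psi> \<in> C_pos"
    and "\<Sigma> \<in> range_Gamma_pos A B"
  shows "\<exists>\<delta>0>0. \<forall>\<delta>. 0 < \<delta> \<and> \<delta> \<le> \<delta>0 \<longrightarrow>
    init_well_defined A B \<Sigma> \<and>
    (\<forall>k. fst (pc_state A B \<psi> \<Sigma> \<delta> k) < 1 \<longrightarrow>
       predictor_well_defined A B \<psi> (pc_state A B \<psi> \<Sigma> \<delta> k) \<and>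
       corrector_well_defined A B \<psi> \<Sigma> \<delta> (pc_state A B \<psi> \<Sigma> \<delta> k) \<and>
       moment A B (psi_path \<psi> (fst (pc_state A B \<psi> \<Sigma> \<delta> (Suc k))))
         (snd (pc_state A B \<psi> \<Sigma> \<delta> (Suc k))) = \<Sigma>) \<and>
    (\<exists>N C. (\<forall>k<N. fst (pc_state A B \<psi> \<Sigma> \<delta> k) < 1) \<and>
       pc_state A B \<psi> \<Sigma> \<delta> N = (1, C) \<and>
       C \<in> C_plus A B \<and>
       moment A B (psi_path \<psi> 1) C = moment A B \<psi> C \<and>
       moment A B \<psi> C = \<Sigma>)"
proof -
  interpret reachable_pair A B
    using assms by unfold_locales (auto intro: full_rank_ker)
  note \<psi> = \<open>\<psi> \<in> C_pos\<close> and \<Sigma> = \<open>\<Sigma> \<in> range_Gamma_pos A B\<close>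
  obtain \<delta>0 where \<delta>0: "0 < \<delta>0" and step: "\<And>\<delta> s. 0 < \<delta> \<Longrightarrow> \<delta> \<le> \<delta>0 \<Longrightarrow> s \<in> solutions \<psi> \<Sigma> \<Longrightarrow>
    predictor_well_defined A B \<psi> s \<and> corrector_well_defined A B \<psi> \<Sigma> \<delta> s \<and>
    pc_step A B \<psi> \<Sigma> \<delta> s \<in> solutions \<psi> \<Sigma>"
    using uniform_step_length[OF \<psi> \<Sigma>] by metis
  have psi0: "psi_path \<psi> 0 = (\<lambda>z. 1)" and psi1: "psi_path \<psi> 1 = \<psi>"
    by (simp_all add: psi_path_def)
  have init: "init_well_defined A B \<Sigma>"
    unfolding init_well_defined_def using LL_factor_init[OF \<Sigma>] C_init_in_C_plus[OF \<Sigma>] by blast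
  have alg: "(\<forall>k. fst (pc_state A B \<psi> \<Sigma> \<delta> k) < 1 \<longrightarrow>
       predictor_well_defined A B \<psi> (pc_state A B \<psi> \<Sigma> \<delta> k) \<and>
       corrector_well_defined A B \<psi> \<Sigma> \<delta> (pc_state A B \<psi> \<Sigma> \<delta> k) \<and>
       moment A B (psi_path \<psi> (fst (pc_state A B \<psi> \<Sigma> \<delta> (Suc k))))
         (snd (pc_state A B \<psi> \<Sigma> \<delta> (Suc k))) = \<Sigma>) \<and>
    (\<exists>N C. (\<forall>k<N. fst (pc_state A B \<psi> \<Sigma> \<delta> k) < 1) \<and>
       pc_state A B \<psi> \<Sigma> \<delta> N = (1, C) \<and>
       C \<in> C_plus A B \<and>
       moment A B (psi_path \<psi> 1) C = moment A B \<psi> C \<and>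
       moment A B \<psi> C = \<Sigma>)" if \<delta>: "0 < \<delta>" "\<delta> \<le> \<delta>0" for \<delta>
  proof -
    let ?s = "pc_state A B \<psi> \<Sigma> \<delta>"
    have sol: "?s k \<in> solutions \<psi> \<Sigma>" for k
    proof (induction k)
      case 0
      show ?case
        using C_init_in_C_plus[OF \<Sigma>] moment_C_init[OF \<Sigma>] by (simp add: pc_state_def solutions_def psi0)
    next
      case (Suc k)
      with step[OF \<delta>] show ?case by (simp add: pc_state_def)
    qed
    have time: "fst (?s k) = min 1 (real k * \<delta>)" for k
      using \<delta> by (intro fst_pc_state) simp
    define N where "N = (LEAST k. 1 \<le> real k * \<delta>)"
    have ex: "\<exists>k. 1 \<le> real k * \<delta>"
      using reals_Archimedean3[OF \<delta>(1), rule_format, of 1] by (auto intro: less_imp_le)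
    have N: "1 \<le> real N * \<delta>" unfolding N_def by (rule LeastI_ex[OF ex])
    have before: "fst (?s k) < 1" if "k < N" for k
      using not_less_Least[OF that[unfolded N_def]] by (simp add: time)
    obtain C where C: "?s N = (1, C)"
      using time[of N] N by (metis min.absorb1 prod.collapse)
    have "C \<in> C_plus A B" "moment A B (psi_path \<psi> 1) C = \<Sigma>"
      using sol[of N] by (simp_all add: C solutions_def)
    moreover have "moment A B (psi_path \<psi> (fst (?s (Suc k)))) (snd (?s (Suc k))) = \<Sigma>" for k
      using sol[of "Suc k"] by (auto simp: solutions_def)
    ultimately show ?thesis
      using step[OF \<delta> sol] before C psi1 by auto
  qed
  show ?thesis
    using \<delta>0 init alg by blast
qed

end
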